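(* Let $q>0$ and let $h\in \mathcal{D}_q'$ be a distribution on $\mathbb{C}$. Then the following two properties are equivalent: (a) for any $q'\in(0,q/e)$ there exists a distribution $g\in \mathcal{D}_{q'}'$ such that $\bar\partial g=h$; (b) $\langle h,z^k\rangle=0$ for all integers $k\ge 0$.
   Context: Here $e=2.718\ldots$ is the base of natural logarithms. For $q>0$, $\mathcal{D}_q$ is the space of functions $\psi\in C^\infty(\mathbb{C})$ such that, for every multi-index $\alpha=(\alpha_1,\alpha_2)$, the derivative $D^{\alpha}\psi=D_1^{\alpha_1}D_2^{\alpha_2}\psi$ with respect to the two real coordinates satisfies $|D^\alpha\psi(z)|=o(e^{q|z|^2})$ as $|z|\to\infty$, with the locally convex topology defined by the seminorms $\sup_{z\in\mathbb{C}}|D^\alpha\psi(z)|e^{-q|z|^2}$. $\mathcal{D}_q'$ is its dual space (so $\mathcal{E}'\subset \mathcal{D}_q'\subset \mathcal{S}'$, with $\mathcal{E}'$ the compactly supported distributions and $\mathcal{S}'$ the tempered ones), and $\langle\cdot,\cdot\rangle$ is the (bilinear) action of a distribution on a function. The operator $\bar\partial=\frac12(\partial_x+i\partial_y)$, $z=x+iy$, acts on distributions in the usual way, $\langle\bar\partial g,\psi\rangle=-\langle g,\bar\partial\psi\rangle$; $\bar\partial g=h$ is an equality of distributions on $\mathbb{C}$. *)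

theory Defs
  imports "HOL-Analysis.Analysis" "HOL-Library.Landau_Symbols"
begin

text \<open>Differentiability of maps of type \<^typ>\<open>complex \<Rightarrow> complex\<close> is real (Frechet)
  differentiability throughout; \<^const>\<open>differentiable\<close> does not mean holomorphic.\<close>

definition D1 :: "(complex \<Rightarrow> complex) \<Rightarrow> complex \<Rightarrow> complex" where
  "D1 \<psi> z = vector_derivative (\<lambda>t::real. \<psi> (z + of_real t)) (at 0)"

definition D2 :: "(complex \<Rightarrow> complex) \<Rightarrow> complex \<Rightarrow> complex" where
  "D2 \<psi> z = vector_derivative (\<lambda>t::real. \<psi> (z + \<i> * of_real t)) (at 0)"

definition D_multi :: "nat \<times> nat \<Rightarrow> (complex \<Rightarrow> complex) \<Rightarrow> complex \<Rightarrow> complex" where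
  "D_multi \<alpha> \<psi> = (D1 ^^ fst \<alpha>) ((D2 ^^ snd \<alpha>) \<psi>)"

definition dbar :: "(complex \<Rightarrow> complex) \<Rightarrow> complex \<Rightarrow> complex" where
  "dbar \<psi> z = (D1 \<psi> z + \<i> * D2 \<psi> z) / 2"

primrec C_k :: "nat \<Rightarrow> (complex \<Rightarrow> complex) \<Rightarrow> bool" where
  "C_k 0 \<psi> \<longleftrightarrow> continuous_on UNIV \<psi>"
| "C_k (Suc k) \<psi> \<longleftrightarrow> (\<forall>z. \<psi> differentiable (at z)) \<and> C_k k (D1 \<psi>) \<and> C_k k (D2 \<psi>)"

definition smooth :: "(complex \<Rightarrow> complex) \<Rightarrow> bool" where
  "smooth \<psi> \<longleftrightarrow> (\<forall>k. C_k k \<psi>)"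

definition Dq_space :: "real \<Rightarrow> (complex \<Rightarrow> complex) set" where
  "Dq_space q = {\<psi>. smooth \<psi> \<and>
     (\<forall>\<alpha>. (\<lambda>z. cmod (D_multi \<alpha> \<psi> z)) \<in> o[at_infinity](\<lambda>z. exp (q * (cmod z)\<^sup>2)))}"

text \<open>The supremum is a genuine one, over a bounded set, for \<open>\<psi> \<in> Dq_space q\<close>; elsewhere
  the value is never used.\<close>

definition Dq_seminorm :: "real \<Rightarrow> nat \<times> nat \<Rightarrow> (complex \<Rightarrow> complex) \<Rightarrow> real" where
  "Dq_seminorm q \<alpha> \<psi> = (SUP z. cmod (D_multi \<alpha> \<psi> z) * exp (- q * (cmod z)\<^sup>2))"

text \<open>The locally convex topology of the seminorms, given by the subbasis of all seminorm balls.\<close>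

definition Dq_topology :: "real \<Rightarrow> (complex \<Rightarrow> complex) topology" where
  "Dq_topology q = topology_generated_by
     {{\<psi> \<in> Dq_space q. Dq_seminorm q \<alpha> (\<lambda>z. \<psi> z - \<phi> z) < r} | \<alpha> \<phi> r. \<phi> \<in> Dq_space q \<and> 0 < r}"

text \<open>The topological dual over the complex numbers. A functional is an unrestricted HOL function
  of which only the values on \<open>Dq_space q\<close> matter.\<close>

definition Dq_dual :: "real \<Rightarrow> ((complex \<Rightarrow> complex) \<Rightarrow> complex) set" where
  "Dq_dual q = {h.
     (\<forall>\<phi>\<in>Dq_space q. \<forall>\<psi>\<in>Dq_space q. h (\<lambda>z. \<phi> z + \<psi> z) = h \<phi> + h \<psi>) \<and>
     (\<forall>c. \<forall>\<psi>\<in>Dq_space q. h (\<lambda>z. c * \<psi> z) = c * h \<psi>) \<and>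
     continuous_map (Dq_topology q) euclidean h}"

definition test_functions :: "(complex \<Rightarrow> complex) set" where
  "test_functions = {\<phi>. smooth \<phi> \<and> compact (closure {z. \<phi> z \<noteq> 0})}"

definition dbar_distr ::
    "((complex \<Rightarrow> complex) \<Rightarrow> complex) \<Rightarrow> (complex \<Rightarrow> complex) \<Rightarrow> complex" where
  "dbar_distr g \<psi> = - g (dbar \<psi>)"

text \<open>Functionals in different dual spaces are compared as distributions on the plane, that is,
  on compactly supported smooth functions, which lie in every \<open>Dq_space q\<close> with \<open>q > 0\<close>.\<close>

definition distr_eq ::
    "((complex \<Rightarrow> complex) \<Rightarrow> complex) \<Rightarrow> ((complex \<Rightarrow> complex) \<Rightarrow> complex) \<Rightarrow> bool" where
  "distr_eq u v \<longleftrightarrow> (\<forall>\<phi>\<in>test_functions. u \<phi> = v \<phi>)"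

lemma D_multi_zero [simp]: "D_multi \<alpha> (\<lambda>z. 0) = (\<lambda>z. 0)"
proof -
  have "D1 (\<lambda>z. 0) = (\<lambda>z. 0)" "D2 (\<lambda>z. 0) = (\<lambda>z. 0)"
    by (auto simp: D1_def D2_def fun_eq_iff)
  then have "(D1 ^^ n) (\<lambda>z. 0) = (\<lambda>z. 0)" "(D2 ^^ n) (\<lambda>z. 0) = (\<lambda>z. 0)" for n
    by (induction n) auto
  then show ?thesis by (simp add: D_multi_def)
qed

lemma topspace_Dq_topology: "topspace (Dq_topology q) = Dq_space q"
proof -
  have "Dq_seminorm q \<alpha> (\<lambda>z. \<phi> z - \<phi> z) < 1" for \<alpha> \<phi>
    by (simp add: Dq_seminorm_def)
  then have "\<phi> \<in> {\<psi> \<in> Dq_space q. Dq_seminorm q (0, 0) (\<lambda>z. \<psi> z - \<phi> z) < 1}"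
    if "\<phi> \<in> Dq_space q" for \<phi>
    using that by blast
  moreover have "(0::real) < 1" by simp
  ultimately show ?thesis
    unfolding Dq_topology_def topology_generated_by_topspace by blast
qed

end

theory Submission
  imports Defs "HOL-Complex_Analysis.Cauchy_Integral_Formula" "HOL-Probability.Distributions"
begin

text \<open>If \<open>g\<close> solves \<open>dbar g = h\<close>, then \<open>h (z ^ k)\<close> is the limit of
\<open>h (A (z / n) * z ^ k) = - g (dbar (A (z / n) * z ^ k))\<close> for a bump function \<open>A\<close> with \<open>A 0 = 1\<close>.
All derivatives of \<open>A (z / n) * z ^ k - z ^ k\<close> are \<open>O (1 / n)\<close> with constants that grow slower than
every Gaussian weight, and \<open>dbar (z ^ k) = 0\<close>, so the right-hand side tends to \<open>0\<close>
(\<open>dbar_solvable_imp_moments_zero\<close>).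

For the converse, the operator \<open>dbar\<close> is inverted explicitly. For \<open>0 < b < q\<close> put
\<open>T \<psi> z\<close> = the integral of \<open>\<psi> w * exp (2 * b * cnj w * (z - w)) / (z - w)\<close> over all \<open>w\<close>.
The exponential is the reproducing kernel of the Fock space, normalised to be \<open>1\<close> on the diagonal.
It is entire in \<open>z\<close>, so it does not disturb the Cauchy kernel: \<open>dbar (T \<psi>) = pi * \<psi>\<close>
(\<open>dbar_fock_cauchy\<close>, by the Cauchy-Pompeiu formula). Its modulus is
\<open>exp (b * |z|^2 - b * |w|^2 - b * |z - w|^2)\<close>; the growth \<open>exp (b * |w|^2)\<close> of \<open>\<psi>\<close> is cancelled
exactly, a Gaussian in \<open>z - w\<close> makes the integral converge, and the weight \<open>exp (b * |z|^2)\<close> comes out.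
In the variable \<open>u = z - w\<close> the derivatives of \<open>T \<psi>\<close> are again integrals of this kind, for derivatives
of \<open>\<psi>\<close> and with additional powers of \<open>u\<close>, so \<open>T\<close> is continuous from the space with parameter \<open>b\<close> to the one with
parameter \<open>q\<close> (\<open>continuous_map_fock_cauchy\<close>), and \<open>g = - h \<circ> T / pi\<close> is a continuous functional.

For a test function \<open>\<phi>\<close> the difference \<open>f = T (dbar \<phi>) - pi * \<phi>\<close> satisfies \<open>dbar f = 0\<close>, hence is
entire, and it is \<open>O (exp (b * |z|^2))\<close> with \<open>b < q\<close>. By Cauchy's estimates its Taylor polynomials
converge to it in the space with parameter \<open>q\<close>, so a functional that annihilates all \<open>z ^ k\<close>
annihilates \<open>f\<close> (\<open>Dq_dual_entire_eq_0\<close>). This says \<open>g (dbar \<phi>) = - h \<phi>\<close>, that is, \<open>dbar g = h\<close>.\<close>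

section \<open>Partial derivatives and smooth functions\<close>

text \<open>Total real differentiability together with the values of the two partial derivatives; this is the
form in which \<^const>\<open>D1\<close> and \<^const>\<open>D2\<close> obey the usual rules of calculus.\<close>

definition has_partials :: "(complex \<Rightarrow> complex) \<Rightarrow> complex \<Rightarrow> complex \<Rightarrow> complex \<Rightarrow> bool" where
  "has_partials f a b z \<longleftrightarrow>
     (f has_derivative (\<lambda>v. of_real (Re v) * a + of_real (Im v) * b)) (at z)"

lemma has_derivative_D1:
  assumes "(f has_derivative f') (at z)"
  shows "D1 f z = f' 1"
proof -
  have "((\<lambda>t::real. z + of_real t) has_derivative of_real) (at 0)"
    by (auto intro!: derivative_eq_intros)
  with assms have "((f \<circ> (\<lambda>t::real. z + of_real t)) has_derivative f' \<circ> of_real) (at 0)"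
    by (intro diff_chain_at) auto
  moreover have "f' (of_real t) = t *\<^sub>R f' 1" for t
    using linear_scale[OF has_derivative_linear[OF assms], of t 1] by (simp add: scaleR_conv_of_real)
  ultimately have "((\<lambda>t::real. f (z + of_real t)) has_vector_derivative f' 1) (at 0)"
    by (simp add: has_vector_derivative_def o_def)
  then show ?thesis
    by (simp add: D1_def vector_derivative_at)
qed

lemma has_derivative_D2:
  assumes "(f has_derivative f') (at z)"
  shows "D2 f z = f' \<i>"
proof -
  have "((\<lambda>t::real. z + \<i> * of_real t) has_derivative (\<lambda>t. \<i> * of_real t)) (at 0)"
    by (auto intro!: derivative_eq_intros)
  with assms have "((f \<circ> (\<lambda>t::real. z + \<i> * of_real t)) has_derivative f' \<circ> (\<lambda>t. \<i> * of_real t)) (at 0)"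
    by (intro diff_chain_at) auto
  moreover have "f' (\<i> * of_real t) = t *\<^sub>R f' \<i>" for t
    using linear_scale[OF has_derivative_linear[OF assms], of t \<i>]
    by (simp add: scaleR_conv_of_real mult.commute)
  ultimately have "((\<lambda>t::real. f (z + \<i> * of_real t)) has_vector_derivative f' \<i>) (at 0)"
    by (simp add: has_vector_derivative_def o_def)
  then show ?thesis
    by (simp add: D2_def vector_derivative_at)
qed

lemma has_partials_D1: "has_partials f a b z \<Longrightarrow> D1 f z = a"
  by (auto simp: has_partials_def dest: has_derivative_D1)

lemma has_partials_D2: "has_partials f a b z \<Longrightarrow> D2 f z = b"
  by (auto simp: has_partials_def dest: has_derivative_D2)

lemma has_partials_differentiable: "has_partials f a b z \<Longrightarrow> f differentiable (at z)"
  by (auto simp: has_partials_def differentiable_def)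

lemma differentiable_has_partials:
  assumes "f differentiable (at z)"
  shows "has_partials f (D1 f z) (D2 f z) z"
proof -
  obtain f' where f': "(f has_derivative f') (at z)"
    using assms by (auto simp: differentiable_def)
  interpret linear f' using f' by (rule has_derivative_linear)
  have "f' v = of_real (Re v) * f' 1 + of_real (Im v) * f' \<i>" for v
  proof -
    have "v = Re v *\<^sub>R 1 + Im v *\<^sub>R \<i>"
      by (simp add: complex_eq_iff)
    then have "f' v = f' (Re v *\<^sub>R 1 + Im v *\<^sub>R \<i>)"
      by simp
    also have "\<dots> = of_real (Re v) * f' 1 + of_real (Im v) * f' \<i>"
      unfolding add scale by (simp add: scaleR_conv_of_real)
    finally show ?thesis .
  qed
  then show ?thesis
    unfolding has_partials_def has_derivative_D1[OF f'] has_derivative_D2[OF f']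
    by (intro has_derivative_eq_rhs[OF f'] ext)
qed

lemma has_partials_eq: "has_partials f a b z \<Longrightarrow> a = a' \<Longrightarrow> b = b' \<Longrightarrow> has_partials f a' b' z"
  by simp

lemma has_partials_const: "has_partials (\<lambda>z. c) 0 0 z"
  by (simp add: has_partials_def)

lemma has_partials_add:
  "has_partials f a b z \<Longrightarrow> has_partials g a' b' z \<Longrightarrow>
     has_partials (\<lambda>z. f z + g z) (a + a') (b + b') z"
  unfolding has_partials_def by (auto intro!: derivative_eq_intros simp: algebra_simps)

lemma has_partials_diff:
  "has_partials f a b z \<Longrightarrow> has_partials g a' b' z \<Longrightarrow>
     has_partials (\<lambda>z. f z - g z) (a - a') (b - b') z"
  unfolding has_partials_def by (auto intro!: derivative_eq_intros simp: algebra_simps)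

lemma has_partials_mult:
  "has_partials f a b z \<Longrightarrow> has_partials g a' b' z \<Longrightarrow>
     has_partials (\<lambda>z. f z * g z) (f z * a' + a * g z) (f z * b' + b * g z) z"
  unfolding has_partials_def by (auto intro!: derivative_eq_intros simp: algebra_simps)

lemma has_partials_cmult:
  "has_partials f a b z \<Longrightarrow> has_partials (\<lambda>z. c * f z) (c * a) (c * b) z"
  unfolding has_partials_def by (auto intro!: derivative_eq_intros simp: algebra_simps)

lemma has_partials_Re: "has_partials (\<lambda>z. of_real (Re z)) 1 0 z"
  unfolding has_partials_def by (auto intro!: derivative_eq_intros)

lemma has_partials_Im: "has_partials (\<lambda>z. of_real (Im z)) 0 1 z"
  unfolding has_partials_def by (auto intro!: derivative_eq_intros)

lemma has_partials_cnj: "has_partials cnj 1 (-\<i>) z"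
  unfolding has_partials_def by (auto intro!: derivative_eq_intros simp: complex_eq_iff)

lemma of_real_Re_Im: "of_real (Re v) * a + of_real (Im v) * (\<i> * a) = v * (a::complex)"
  by (simp add: complex_eq_iff algebra_simps)

text \<open>The Cauchy-Riemann equations: a real derivative with \<open>D2 f = \<i> * D1 f\<close> is multiplication by a
complex number.\<close>

lemma has_partials_holomorphic_iff:
  "has_partials f a (\<i> * a) z \<longleftrightarrow> (f has_field_derivative a) (at z)"
  by (simp add: has_partials_def has_field_derivative_def of_real_Re_Im mult_commute_abs)

lemma has_partials_compose_holomorphic:
  assumes "has_partials f a b z" "(g has_field_derivative g') (at (f z))"
  shows "has_partials (\<lambda>z. g (f z)) (g' * a) (g' * b) z"
proof -
  have "((\<lambda>z. g (f z)) has_derivative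
      (\<lambda>v. g' * (of_real (Re v) * a + of_real (Im v) * b))) (at z)"
    using diff_chain_at[OF assms(1)[unfolded has_partials_def] assms(2)[unfolded has_field_derivative_def]]
    by (simp add: o_def)
  then show ?thesis
    by (simp add: has_partials_def algebra_simps)
qed

lemma has_partials_chain_affine:
  assumes "has_partials f a b (c * z + d)" "c \<in> \<real>"
  shows "has_partials (\<lambda>z. f (c * z + d)) (c * a) (c * b) z"
proof -
  have 1: "((\<lambda>z. c * z + d) has_derivative (\<lambda>v. c * v)) (at z)"
    by (auto intro!: derivative_eq_intros)
  obtain r where c: "c = of_real r"
    using assms(2) by (auto elim: Reals_cases)
  show ?thesis
    using diff_chain_at[OF 1 assms(1)[unfolded has_partials_def]]
    by (simp add: has_partials_def o_def c algebra_simps)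
qed

lemma C_k_Suc_D: "C_k (Suc k) f \<Longrightarrow> C_k k f"
proof (induction k arbitrary: f)
  case 0
  then show ?case
    by (auto intro!: differentiable_imp_continuous_on simp: differentiable_on_def
        intro: differentiable_at_withinI)
next
  case (Suc k)
  show ?case
    using Suc.prems Suc.IH[of "D1 f"] Suc.IH[of "D2 f"]
    unfolding C_k.simps(2)[of "Suc k" f] C_k.simps(2)[of k f] by blast
qed

lemma C_k_continuous: "C_k k f \<Longrightarrow> continuous_on UNIV f"
proof (induction k)
  case (Suc k)
  then show ?case using C_k_Suc_D by blast
qed simp

lemma C_k_SucI:
  assumes "\<And>z. has_partials f (a z) (b z) z" "C_k k a" "C_k k b"
  shows "C_k (Suc k) f"
proof -
  have "D1 f = a" "D2 f = b"
    using assms(1) by (auto intro!: ext has_partials_D1 has_partials_D2)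
  then show ?thesis
    using assms has_partials_differentiable[OF assms(1)] by simp
qed

lemma C_k_has_partials: "C_k (Suc k) f \<Longrightarrow> has_partials f (D1 f z) (D2 f z) z"
  by (auto intro: differentiable_has_partials)

lemma C_k_const: "C_k k (\<lambda>z. c)"
proof (induction k arbitrary: c)
  case (Suc k)
  show ?case by (rule C_k_SucI[OF has_partials_const Suc Suc])
qed simp

lemma C_k_add: "C_k k f \<Longrightarrow> C_k k g \<Longrightarrow> C_k k (\<lambda>z. f z + g z)"
proof (induction k arbitrary: f g)
  case 0
  then show ?case by (auto intro: continuous_intros)
next
  case (Suc k)
  show ?case
    by (rule C_k_SucI[OF has_partials_add[OF C_k_has_partials[OF Suc.prems(1)] C_k_has_partials[OF Suc.prems(2)]]])
       (use Suc in auto)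
qed

lemma C_k_mult: "C_k k f \<Longrightarrow> C_k k g \<Longrightarrow> C_k k (\<lambda>z. f z * g z)"
proof (induction k arbitrary: f g)
  case 0
  then show ?case by (auto intro: continuous_intros)
next
  case (Suc k)
  note f = Suc.prems(1) and g = Suc.prems(2)
  show ?case
  proof (rule C_k_SucI[OF has_partials_mult[OF C_k_has_partials[OF f] C_k_has_partials[OF g]]])
    show "C_k k (\<lambda>z. f z * D1 g z + D1 f z * g z)"
      using f g by (intro C_k_add Suc.IH C_k_Suc_D[OF f] C_k_Suc_D[OF g]) simp_all
    show "C_k k (\<lambda>z. f z * D2 g z + D2 f z * g z)"
      using f g by (intro C_k_add Suc.IH C_k_Suc_D[OF f] C_k_Suc_D[OF g]) simp_all
  qed
qed

lemma C_k_cmult: "C_k k f \<Longrightarrow> C_k k (\<lambda>z. c * f z)"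
  by (intro C_k_mult C_k_const)

lemma C_k_diff: "C_k k f \<Longrightarrow> C_k k g \<Longrightarrow> C_k k (\<lambda>z. f z - g z)"
  using C_k_add[OF _ C_k_cmult[of k g "-1"], of f] by simp

lemma C_k_Re: "C_k k (\<lambda>z. of_real (Re z))"
proof (cases k)
  case 0
  then show ?thesis by (auto intro: continuous_intros)
next
  case (Suc n)
  show ?thesis unfolding Suc by (rule C_k_SucI[OF has_partials_Re C_k_const C_k_const])
qed

lemma C_k_Im: "C_k k (\<lambda>z. of_real (Im z))"
proof (cases k)
  case 0
  then show ?thesis by (auto intro: continuous_intros)
next
  case (Suc n)
  show ?thesis unfolding Suc by (rule C_k_SucI[OF has_partials_Im C_k_const C_k_const])
qed

lemma smooth_const: "smooth (\<lambda>z. c)"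
  and smooth_add: "smooth f \<Longrightarrow> smooth g \<Longrightarrow> smooth (\<lambda>z. f z + g z)"
  and smooth_mult: "smooth f \<Longrightarrow> smooth g \<Longrightarrow> smooth (\<lambda>z. f z * g z)"
  and smooth_cmult: "smooth f \<Longrightarrow> smooth (\<lambda>z. c * f z)"
  and smooth_diff: "smooth f \<Longrightarrow> smooth g \<Longrightarrow> smooth (\<lambda>z. f z - g z)"
  by (simp_all add: smooth_def C_k_const C_k_add C_k_mult C_k_cmult C_k_diff)

lemma smooth_differentiable: "smooth f \<Longrightarrow> f differentiable (at z)"
  using C_k.simps(2) unfolding smooth_def by blast

lemma smooth_has_partials: "smooth f \<Longrightarrow> has_partials f (D1 f z) (D2 f z) z"
  by (simp add: differentiable_has_partials smooth_differentiable)

lemma smooth_continuous: "smooth f \<Longrightarrow> continuous_on A f"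
  unfolding smooth_def by (meson C_k_continuous continuous_on_subset subset_UNIV)

lemma smooth_D1: "smooth f \<Longrightarrow> smooth (D1 f)"
  and smooth_D2: "smooth f \<Longrightarrow> smooth (D2 f)"
  using C_k.simps(2) unfolding smooth_def by blast+

lemma smooth_D1_iter: "smooth f \<Longrightarrow> smooth ((D1 ^^ n) f)"
  and smooth_D2_iter: "smooth f \<Longrightarrow> smooth ((D2 ^^ n) f)"
  by (induction n) (auto simp: smooth_D1 smooth_D2)

lemma smooth_D_multi: "smooth f \<Longrightarrow> smooth (D_multi \<alpha> f)"
  by (simp add: D_multi_def smooth_D1_iter smooth_D2_iter)

lemma smooth_dbar: "smooth f \<Longrightarrow> smooth (dbar f)"
proof -
  assume f: "smooth f"
  have "smooth (\<lambda>z. (1/2) * (D1 f z + \<i> * D2 f z))"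
    using f by (intro smooth_cmult smooth_add smooth_D1 smooth_D2)
  then show ?thesis by (simp add: dbar_def[abs_def])
qed

lemma D1_add:
  assumes "smooth f" "smooth g"
  shows "D1 (\<lambda>z. f z + g z) = (\<lambda>z. D1 f z + D1 g z)"
  by (rule ext has_partials_D1 has_partials_add smooth_has_partials assms)+

lemma D1_cmult:
  assumes "smooth f"
  shows "D1 (\<lambda>z. c * f z) = (\<lambda>z. c * D1 f z)"
  by (rule ext has_partials_D1 has_partials_cmult smooth_has_partials assms)+

lemma D2_add:
  assumes "smooth f" "smooth g"
  shows "D2 (\<lambda>z. f z + g z) = (\<lambda>z. D2 f z + D2 g z)"
  by (rule ext has_partials_D2 has_partials_add smooth_has_partials assms)+

lemma D2_cmult:
  assumes "smooth f"
  shows "D2 (\<lambda>z. c * f z) = (\<lambda>z. c * D2 f z)"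
  by (rule ext has_partials_D2 has_partials_cmult smooth_has_partials assms)+

lemma D_multi_add:
  assumes "smooth f" "smooth g"
  shows "D_multi \<alpha> (\<lambda>z. f z + g z) = (\<lambda>z. D_multi \<alpha> f z + D_multi \<alpha> g z)"
proof -
  have 2: "(D2 ^^ n) (\<lambda>z. f z + g z) = (\<lambda>z. (D2 ^^ n) f z + (D2 ^^ n) g z)" for n
    by (induction n) (simp_all add: D2_add smooth_D2_iter assms)
  have "(D1 ^^ n) (\<lambda>z. (D2 ^^ m) f z + (D2 ^^ m) g z) =
      (\<lambda>z. (D1 ^^ n) ((D2 ^^ m) f) z + (D1 ^^ n) ((D2 ^^ m) g) z)" for n m
    by (induction n) (simp_all add: D1_add smooth_D1_iter smooth_D2_iter assms)
  with 2 show ?thesis by (simp add: D_multi_def)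
qed

lemma D_multi_cmult:
  assumes "smooth f"
  shows "D_multi \<alpha> (\<lambda>z. c * f z) = (\<lambda>z. c * D_multi \<alpha> f z)"
proof -
  have 2: "(D2 ^^ n) (\<lambda>z. c * f z) = (\<lambda>z. c * (D2 ^^ n) f z)" for n
    by (induction n) (simp_all add: D2_cmult smooth_D2_iter assms)
  have "(D1 ^^ n) (\<lambda>z. c * (D2 ^^ m) f z) = (\<lambda>z. c * (D1 ^^ n) ((D2 ^^ m) f) z)" for n m
    by (induction n) (simp_all add: D1_cmult smooth_D1_iter smooth_D2_iter assms)
  with 2 show ?thesis by (simp add: D_multi_def)
qed

lemma D_multi_0: "D_multi (0, 0) f = f"
  by (simp add: D_multi_def)

lemma D_multi_Suc_right: "D_multi (i, Suc j) f = D_multi (i, j) (D2 f)"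
  by (simp add: D_multi_def funpow_swap1)

lemma has_partials_horizontal:
  assumes "has_partials f a b (Complex x y)"
  shows "((\<lambda>x. f (Complex x y)) has_vector_derivative a) (at x within S)"
proof -
  have "((\<lambda>x. Complex x y) has_derivative of_real) (at x within S)"
    unfolding Complex_eq by (auto intro!: derivative_eq_intros)
  from has_derivative_compose[OF this assms[unfolded has_partials_def]]
  show ?thesis
    by (simp add: has_vector_derivative_def scaleR_conv_of_real)
qed

lemma has_partials_vertical:
  assumes "has_partials f a b (Complex x y)"
  shows "((\<lambda>y. f (Complex x y)) has_vector_derivative b) (at y within S)"
proof -
  have "((\<lambda>y. Complex x y) has_derivative (\<lambda>t. \<i> * of_real t)) (at y within S)"
    unfolding Complex_eq by (auto intro!: derivative_eq_intros)
  from has_derivative_compose[OF this assms[unfolded has_partials_def]]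
  show ?thesis
    by (simp add: has_vector_derivative_def scaleR_conv_of_real)
qed

lemmas D1_line = has_partials_horizontal[OF smooth_has_partials]
lemmas D2_line = has_partials_vertical[OF smooth_has_partials]

lemma smooth_continuous_Complex:
  assumes "smooth f" "continuous_on S a" "continuous_on S b"
  shows "continuous_on S (\<lambda>x. f (Complex (a x) (b x)))"
  unfolding Complex_eq
  by (rule continuous_on_compose2[OF smooth_continuous[OF assms(1), of UNIV]])
     (auto intro!: continuous_intros assms)

text \<open>Symmetry of the second derivatives: differentiate
\<open>f (Complex x y) = f (Complex x a) + (integral of D2 f over the vertical segment from a to y)\<close> first
in \<open>x\<close>, under the integral sign, and then in \<open>y\<close>. The membership of \<open>D1 \<psi>\<close> in a space
\<^const>\<open>Dq_space\<close> rests on it, because \<^const>\<open>D_multi\<close> applies the derivatives in a fixed order.\<close>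

lemma D1_D2_commute:
  assumes f: "smooth f"
  shows "D1 (D2 f) = D2 (D1 f)"
proof
  fix z
  obtain x0 y0 where z: "z = Complex x0 y0" by (cases z)
  define a b where "a = y0 - 1" and "b = y0 + 1"
  have y0: "y0 \<in> {a..b}" by (simp add: a_def b_def)
  have ftc: "f (Complex x y) = f (Complex x a) + integral {a..y} (\<lambda>s. D2 f (Complex x s))"
    if "y \<in> {a..b}" for x y
    using fundamental_theorem_of_calculus[of a y "\<lambda>y. f (Complex x y)" "\<lambda>s. D2 f (Complex x s)"]
      D2_line[OF f] that by (auto dest!: integral_unique simp: algebra_simps)
  have diff_x: "D1 f (Complex x0 y) = D1 f (Complex x0 a) + integral {a..y} (\<lambda>s. D1 (D2 f) (Complex x0 s))"
    if y: "y \<in> {a..b}" for y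
  proof -
    have "((\<lambda>x. integral (cbox a y) (\<lambda>s. D2 f (Complex x s))) has_vector_derivative
        integral (cbox a y) (\<lambda>s. D1 (D2 f) (Complex x0 s))) (at x0 within UNIV)"
      by (rule leibniz_rule_vector_derivative)
         (auto intro!: D1_line smooth_D2 f integrable_continuous_interval smooth_continuous_Complex
            smooth_D1 continuous_intros simp: split_beta)
    then have "((\<lambda>x. f (Complex x a) + integral {a..y} (\<lambda>s. D2 f (Complex x s))) has_vector_derivative
        D1 f (Complex x0 a) + integral {a..y} (\<lambda>s. D1 (D2 f) (Complex x0 s))) (at x0)"
      by (intro has_vector_derivative_add D1_line f) simp
    then have "((\<lambda>x. f (Complex x y)) has_vector_derivative
        D1 f (Complex x0 a) + integral {a..y} (\<lambda>s. D1 (D2 f) (Complex x0 s))) (at x0)"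
      using ftc[OF y] by simp
    then show ?thesis
      using D1_line[OF f] vector_derivative_unique_at by blast
  qed
  have "((\<lambda>y. integral {a..y} (\<lambda>s. D1 (D2 f) (Complex x0 s))) has_vector_derivative
      D1 (D2 f) (Complex x0 y0)) (at y0 within {a..b})"
    by (rule integral_has_vector_derivative)
       (auto simp: a_def b_def intro!: smooth_continuous_Complex smooth_D1 smooth_D2 f continuous_intros)
  then have "((\<lambda>y. D1 f (Complex x0 a) + integral {a..y} (\<lambda>s. D1 (D2 f) (Complex x0 s))) has_vector_derivative
      D1 (D2 f) (Complex x0 y0)) (at y0 within {a..b})"
    by (simp add: has_vector_derivative_add_const add.commute[of "D1 f (Complex x0 a)"])
  then have "((\<lambda>y. D1 f (Complex x0 y)) has_vector_derivative D1 (D2 f) (Complex x0 y0)) (at y0 within {a..b})"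
    by (rule has_vector_derivative_transform[OF y0, rotated]) (rule diff_x)
  moreover have "((\<lambda>y. D1 f (Complex x0 y)) has_vector_derivative D2 (D1 f) (Complex x0 y0)) (at y0 within {a..b})"
    by (intro D2_line smooth_D1 f)
  ultimately show "D1 (D2 f) z = D2 (D1 f) z"
    unfolding z
    using vector_derivative_unique_within_closed_interval[of a b y0] y0 by (auto simp: a_def b_def)
qed

lemma D_multi_Suc_left:
  assumes "smooth f"
  shows "D_multi (Suc i, j) f = D_multi (i, j) (D1 f)"
proof -
  have "(D2 ^^ n) (D1 f) = D1 ((D2 ^^ n) f)" for n
    by (induction n) (simp_all add: D1_D2_commute smooth_D2_iter assms)
  then show ?thesis
    by (simp add: D_multi_def funpow_swap1)
qed

section \<open>The spaces of test functions and their duals\<close>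

lemma Dq_smooth: "\<psi> \<in> Dq_space q \<Longrightarrow> smooth \<psi>"
  by (simp add: Dq_space_def)

lemma Dq_smallo:
  "\<psi> \<in> Dq_space q \<Longrightarrow>
     (\<lambda>z. cmod (D_multi \<alpha> \<psi> z)) \<in> o[at_infinity](\<lambda>z. exp (q * (cmod z)\<^sup>2))"
  unfolding Dq_space_def by blast

text \<open>Outside a disc the little-o condition bounds the weighted derivative by 1, inside it continuity
does. This makes the supremum in \<^const>\<open>Dq_seminorm\<close> an actual upper bound.\<close>

lemma norm_D_multi_bdd_above:
  assumes "\<psi> \<in> Dq_space q"
  shows "bdd_above (range (\<lambda>z. cmod (D_multi \<alpha> \<psi> z) * exp (- q * (cmod z)\<^sup>2)))"
proof -
  let ?f = "\<lambda>z. cmod (D_multi \<alpha> \<psi> z) * exp (- q * (cmod z)\<^sup>2)"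
  have "\<forall>\<^sub>F z in at_infinity. cmod (D_multi \<alpha> \<psi> z) \<le> exp (q * (cmod z)\<^sup>2)"
    using landau_o.smallD[OF Dq_smallo[OF assms, of \<alpha>], of 1] by simp
  then obtain R where "\<And>z. R \<le> norm z \<Longrightarrow> cmod (D_multi \<alpha> \<psi> z) \<le> exp (q * (cmod z)\<^sup>2)"
    unfolding eventually_at_infinity by blast
  then have far: "?f z \<le> 1" if "R \<le> norm z" for z
    using that by (simp add: exp_minus field_simps)
  have "continuous_on (cball 0 R) ?f"
    by (intro continuous_intros smooth_continuous smooth_D_multi Dq_smooth[OF assms])
  then have "bounded (?f ` cball 0 R)"
    by (intro compact_imp_bounded compact_continuous_image) auto
  then obtain K where near: "\<And>z. norm z \<le> R \<Longrightarrow> ?f z \<le> K"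
    by (fastforce simp: bounded_iff dist_norm)
  show ?thesis
    by (rule bdd_aboveI2[of _ _ "max 1 K"]) (metis far near le_max_iff_disj linear)
qed

lemma Dq_seminorm_bound:
  assumes "\<psi> \<in> Dq_space q"
  shows "cmod (D_multi \<alpha> \<psi> z) \<le> Dq_seminorm q \<alpha> \<psi> * exp (q * (cmod z)\<^sup>2)"
proof -
  have "cmod (D_multi \<alpha> \<psi> z) * exp (- q * (cmod z)\<^sup>2) \<le> Dq_seminorm q \<alpha> \<psi>"
    unfolding Dq_seminorm_def by (intro cSUP_upper norm_D_multi_bdd_above[OF assms]) auto
  then show ?thesis
    by (simp add: exp_minus field_simps)
qed

lemma Dq_seminorm_le:
  assumes "\<And>z. cmod (D_multi \<alpha> \<psi> z) \<le> K * exp (q * (cmod z)\<^sup>2)"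
  shows "Dq_seminorm q \<alpha> \<psi> \<le> K"
  unfolding Dq_seminorm_def
  using assms by (intro cSUP_least) (auto simp: exp_minus field_simps)

lemma Dq_seminorm_nonneg:
  assumes "\<psi> \<in> Dq_space q"
  shows "0 \<le> Dq_seminorm q \<alpha> \<psi>"
  using order_trans[OF norm_ge_zero Dq_seminorm_bound[OF assms, of \<alpha> 0]] by simp

lemma Dq_zero: "(\<lambda>z. 0) \<in> Dq_space q"
  by (simp add: Dq_space_def smooth_const)

lemma Dq_add:
  assumes "f \<in> Dq_space q" "g \<in> Dq_space q"
  shows "(\<lambda>z. f z + g z) \<in> Dq_space q"
proof -
  have "(\<lambda>z. cmod (D_multi \<alpha> f z + D_multi \<alpha> g z)) \<in> o[at_infinity](\<lambda>z. exp (q * (cmod z)\<^sup>2))" for \<alpha>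
  proof -
    have "(\<lambda>z. cmod (D_multi \<alpha> f z) + cmod (D_multi \<alpha> g z)) \<in> o[at_infinity](\<lambda>z. exp (q * (cmod z)\<^sup>2))"
      by (intro sum_in_smallo Dq_smallo assms)
    then show ?thesis
      by (rule landau_o.big_small_trans[rotated])
         (auto intro!: bigoI[of _ 1] always_eventually norm_triangle_ineq)
  qed
  then show ?thesis
    using assms[THEN Dq_smooth] by (simp add: Dq_space_def D_multi_add smooth_add)
qed

lemma Dq_cmult:
  assumes "f \<in> Dq_space q"
  shows "(\<lambda>z. c * f z) \<in> Dq_space q"
proof -
  have "(\<lambda>z. cmod (c * D_multi \<alpha> f z)) \<in> o[at_infinity](\<lambda>z. exp (q * (cmod z)\<^sup>2))" for \<alpha>
    by (rule landau_o.big_small_trans[OF bigoI[of _ "cmod c"] Dq_smallo[OF assms, of \<alpha>]])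
       (simp add: norm_mult)
  then show ?thesis
    using assms[THEN Dq_smooth] by (simp add: Dq_space_def D_multi_cmult smooth_cmult)
qed

lemma Dq_diff:
  assumes "f \<in> Dq_space q" "g \<in> Dq_space q"
  shows "(\<lambda>z. f z - g z) \<in> Dq_space q"
  using Dq_add[OF assms(1) Dq_cmult[OF assms(2), of "-1"]] by simp

lemma Dq_D1: "f \<in> Dq_space q \<Longrightarrow> D1 f \<in> Dq_space q"
  by (auto simp: Dq_space_def smooth_D1 D_multi_Suc_left[symmetric])

lemma Dq_D2: "f \<in> Dq_space q \<Longrightarrow> D2 f \<in> Dq_space q"
  by (auto simp: Dq_space_def smooth_D2 D_multi_Suc_right[symmetric])

lemma Dq_dbar:
  assumes "f \<in> Dq_space q"
  shows "dbar f \<in> Dq_space q"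
proof -
  have "(\<lambda>z. (1/2) * (D1 f z + \<i> * D2 f z)) \<in> Dq_space q"
    by (intro Dq_cmult Dq_add Dq_D1 Dq_D2 assms)
  then show ?thesis by (simp add: dbar_def[abs_def])
qed

lemma exp_square_smallo:
  assumes "b < q"
  shows "(\<lambda>z::complex. exp (b * (cmod z)\<^sup>2)) \<in> o[at_infinity](\<lambda>z. exp (q * (cmod z)\<^sup>2))"
proof (rule smalloI_tendsto)
  have "filterlim (\<lambda>z::complex. (q - b) * (cmod z)\<^sup>2) at_top at_infinity"
    by (rule filterlim_tendsto_pos_mult_at_top[OF tendsto_const])
       (use assms in \<open>auto intro!: filterlim_pow_at_top filterlim_norm_at_top\<close>)
  then have "((\<lambda>z::complex. exp (- ((q - b) * (cmod z)\<^sup>2))) \<longlongrightarrow> 0) at_infinity"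
    by (intro filterlim_compose[OF exp_at_bot] filterlim_compose[OF filterlim_uminus_at_bot_at_top])
  then show "((\<lambda>z::complex. exp (b * (cmod z)\<^sup>2) / exp (q * (cmod z)\<^sup>2)) \<longlongrightarrow> 0) at_infinity"
    by (simp add: exp_diff[symmetric] algebra_simps)
qed auto

lemma Dq_spaceI:
  assumes "smooth \<psi>" "b < q"
    and "\<And>\<alpha>. \<exists>C. \<forall>z. cmod (D_multi \<alpha> \<psi> z) \<le> C * exp (b * (cmod z)\<^sup>2)"
  shows "\<psi> \<in> Dq_space q"
proof -
  have "(\<lambda>z. cmod (D_multi \<alpha> \<psi> z)) \<in> o[at_infinity](\<lambda>z. exp (q * (cmod z)\<^sup>2))" for \<alpha>
  proof -
    obtain C where C: "\<And>z. cmod (D_multi \<alpha> \<psi> z) \<le> C * exp (b * (cmod z)\<^sup>2)"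
      using assms(3) by blast
    show ?thesis
      by (rule landau_o.big_small_trans[OF bigoI[of _ C] exp_square_smallo[OF assms(2)]])
         (use C in auto)
  qed
  then show ?thesis
    using assms(1) by (simp add: Dq_space_def)
qed

lemma Dq_seminorm_triangle:
  assumes "f \<in> Dq_space q" "g \<in> Dq_space q"
  shows "Dq_seminorm q \<alpha> (\<lambda>z. f z + g z) \<le> Dq_seminorm q \<alpha> f + Dq_seminorm q \<alpha> g"
proof (rule Dq_seminorm_le)
  fix z
  have "cmod (D_multi \<alpha> (\<lambda>z. f z + g z) z) \<le> cmod (D_multi \<alpha> f z) + cmod (D_multi \<alpha> g z)"
    using assms by (simp add: D_multi_add Dq_smooth norm_triangle_ineq)
  also have "\<dots> \<le> Dq_seminorm q \<alpha> f * exp (q * (cmod z)\<^sup>2) + Dq_seminorm q \<alpha> g * exp (q * (cmod z)\<^sup>2)"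
    by (intro add_mono Dq_seminorm_bound assms)
  finally show "cmod (D_multi \<alpha> (\<lambda>z. f z + g z) z)
      \<le> (Dq_seminorm q \<alpha> f + Dq_seminorm q \<alpha> g) * exp (q * (cmod z)\<^sup>2)"
    by (simp add: algebra_simps)
qed

lemma Dq_seminorm_triangle_diff:
  assumes "f \<in> Dq_space q" "g \<in> Dq_space q" "k \<in> Dq_space q"
  shows "Dq_seminorm q \<alpha> (\<lambda>z. f z - k z)
      \<le> Dq_seminorm q \<alpha> (\<lambda>z. f z - g z) + Dq_seminorm q \<alpha> (\<lambda>z. g z - k z)"
  using Dq_seminorm_triangle[OF Dq_diff[OF assms(1,2)] Dq_diff[OF assms(2,3)]] by simp

lemma Dq_seminorm_zero [simp]: "Dq_seminorm q \<alpha> (\<lambda>z. 0) = 0"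
  by (simp add: Dq_seminorm_def)

text \<open>Convergence in all seminorms is convergence in the topology: it suffices to check the subbasic
balls, and for a ball around another centre the triangle inequality does it.\<close>

lemma Dq_limitin:
  assumes "\<And>n. f n \<in> Dq_space q" "l \<in> Dq_space q"
    and lim: "\<And>\<alpha>. (\<lambda>n::nat. Dq_seminorm q \<alpha> (\<lambda>z. f n z - l z)) \<longlonglongrightarrow> 0"
  shows "limitin (Dq_topology q) f l sequentially"
proof -
  have "\<forall>\<^sub>F n in sequentially. f n \<in> U"
    if "generate_topology_on {{\<psi> \<in> Dq_space q. Dq_seminorm q \<alpha> (\<lambda>z. \<psi> z - \<phi> z) < r} | \<alpha> \<phi> r.
          \<phi> \<in> Dq_space q \<and> 0 < r} U" and "l \<in> U" for U
    using that
  proof (induction rule: generate_topology_on.induct)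
    case (Int a b)
    then show ?case by (auto intro: eventually_conj)
  next
    case (UN K)
    then obtain k where k: "k \<in> K" "l \<in> k" by auto
    with UN.IH have "\<forall>\<^sub>F n in sequentially. f n \<in> k" by blast
    with k(1) show ?case by (auto elim!: eventually_mono)
  next
    case (Basis s)
    then obtain \<alpha> \<phi> r where s: "s = {\<psi> \<in> Dq_space q. Dq_seminorm q \<alpha> (\<lambda>z. \<psi> z - \<phi> z) < r}"
      and \<phi>: "\<phi> \<in> Dq_space q" by blast
    have "Dq_seminorm q \<alpha> (\<lambda>z. l z - \<phi> z) < r"
      using Basis s by simp
    then have "\<forall>\<^sub>F n in sequentially. Dq_seminorm q \<alpha> (\<lambda>z. f n z - l z) < r - Dq_seminorm q \<alpha> (\<lambda>z. l z - \<phi> z)"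
      by (intro order_tendstoD[OF lim]) simp
    then show ?case
    proof eventually_elim
      case (elim n)
      then show ?case
        using Dq_seminorm_triangle_diff[OF assms(1)[of n] assms(2) \<phi>, of \<alpha>] assms(1) by (simp add: s)
    qed
  qed auto
  then show ?thesis
    unfolding limitin_def topspace_Dq_topology
    using assms(2) by (auto simp: Dq_topology_def openin_topology_generated_by_iff)
qed

lemma Dq_dual_tendsto:
  assumes "h \<in> Dq_dual q" "\<And>n. f n \<in> Dq_space q" "l \<in> Dq_space q"
    and "\<And>\<alpha>. (\<lambda>n::nat. Dq_seminorm q \<alpha> (\<lambda>z. f n z - l z)) \<longlonglongrightarrow> 0"
  shows "(\<lambda>n. h (f n)) \<longlonglongrightarrow> h l"
proof -
  have "continuous_map (Dq_topology q) euclidean h"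
    using assms(1) by (simp add: Dq_dual_def)
  from continuous_map_limit[OF this Dq_limitin[OF assms(2-)]]
  show ?thesis by (simp add: o_def)
qed

text \<open>A linear operator is continuous if each seminorm of the image is bounded by finitely many seminorms
of the argument: a finite intersection of balls around \<open>\<eta>\<close> is mapped into a given subbasic ball
that contains \<open>T \<eta>\<close>.\<close>

lemma continuous_map_Dq:
  assumes maps: "\<And>\<psi>. \<psi> \<in> Dq_space q' \<Longrightarrow> T \<psi> \<in> Dq_space q"
    and diff: "\<And>f g. f \<in> Dq_space q' \<Longrightarrow> g \<in> Dq_space q' \<Longrightarrow> T (\<lambda>z. f z - g z) = (\<lambda>z. T f z - T g z)"
    and bound: "\<And>\<alpha>. \<exists>C B. finite B \<and>
       (\<forall>\<psi>\<in>Dq_space q'. Dq_seminorm q \<alpha> (T \<psi>) \<le> C * (\<Sum>\<beta>\<in>B. Dq_seminorm q' \<beta> \<psi>))"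
  shows "continuous_map (Dq_topology q') (Dq_topology q) T"
proof -
  have "openin (Dq_topology q') (T -` {\<psi> \<in> Dq_space q. Dq_seminorm q \<alpha> (\<lambda>z. \<psi> z - \<phi> z) < r} \<inter> Dq_space q')"
    (is "openin _ ?V") if \<phi>: "\<phi> \<in> Dq_space q" for \<alpha> \<phi> r
  proof (subst openin_subopen, intro ballI)
    fix \<eta> assume "\<eta> \<in> ?V"
    then have \<eta>: "\<eta> \<in> Dq_space q'" "Dq_seminorm q \<alpha> (\<lambda>z. T \<eta> z - \<phi> z) < r" by auto
    define s where "s = r - Dq_seminorm q \<alpha> (\<lambda>z. T \<eta> z - \<phi> z)"
    have s: "s > 0" using \<eta> by (simp add: s_def)
    obtain C B where B: "finite B" and
      C: "\<And>\<psi>. \<psi> \<in> Dq_space q' \<Longrightarrow> Dq_seminorm q \<alpha> (T \<psi>) \<le> C * (\<Sum>\<beta>\<in>B. Dq_seminorm q' \<beta> \<psi>)"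
      using bound by metis
    define \<delta> where "\<delta> = s / (\<bar>C\<bar> * real (card B) + 1)"
    have d: "\<delta> > 0" using s by (auto simp: \<delta>_def intro!: divide_pos_pos add_nonneg_pos)
    have Cd: "\<bar>C\<bar> * (real (card B) * \<delta>) < s"
      using s by (simp add: \<delta>_def field_simps add_pos_nonneg add_nonneg_pos)
    let ?ball = "\<lambda>\<beta>. {\<psi> \<in> Dq_space q'. Dq_seminorm q' \<beta> (\<lambda>z. \<psi> z - \<eta> z) < \<delta>}"
    \<comment> \<open>The index \<open>(0, 0)\<close> only keeps the intersection from being empty when \<open>B\<close> is.\<close>
    let ?U = "\<Inter>\<beta>\<in>insert (0,0) B. ?ball \<beta>"
    have "openin (Dq_topology q') (?ball \<beta>)" for \<beta>
      unfolding Dq_topology_def openin_topology_generated_by_iff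
      by (rule generate_topology_on.Basis) (use d \<eta> in blast)
    then have "openin (Dq_topology q') ?U"
      using B by (intro openin_INT2) auto
    moreover have "\<eta> \<in> ?U"
      using \<eta> d by auto
    moreover have "?U \<subseteq> ?V"
    proof
      fix \<psi> assume \<psi>: "\<psi> \<in> ?U"
      then have \<psi>D: "\<psi> \<in> Dq_space q'" by auto
      have dif: "(\<lambda>z. \<psi> z - \<eta> z) \<in> Dq_space q'" using \<psi>D \<eta> by (intro Dq_diff)
      have "Dq_seminorm q \<alpha> (\<lambda>z. T \<psi> z - T \<eta> z) = Dq_seminorm q \<alpha> (T (\<lambda>z. \<psi> z - \<eta> z))"
        using diff[OF \<psi>D \<eta>(1)] by simp
      also have "\<dots> \<le> C * (\<Sum>\<beta>\<in>B. Dq_seminorm q' \<beta> (\<lambda>z. \<psi> z - \<eta> z))"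
        by (rule C[OF dif])
      also have "\<dots> \<le> \<bar>C\<bar> * (\<Sum>\<beta>\<in>B. Dq_seminorm q' \<beta> (\<lambda>z. \<psi> z - \<eta> z))"
        by (intro mult_right_mono sum_nonneg Dq_seminorm_nonneg dif) auto
      also have "\<dots> \<le> \<bar>C\<bar> * (\<Sum>\<beta>\<in>B. \<delta>)"
        using \<psi> by (intro mult_left_mono sum_mono) (auto intro: less_imp_le)
      also have "\<dots> < s" using Cd by simp
      finally have "Dq_seminorm q \<alpha> (\<lambda>z. T \<psi> z - \<phi> z) < r"
        using Dq_seminorm_triangle_diff[OF maps[OF \<psi>D] maps[OF \<eta>(1)] \<phi>, of \<alpha>] by (simp add: s_def)
      then show "\<psi> \<in> ?V" using \<psi>D maps by auto
    qed
    ultimately show "\<exists>U. openin (Dq_topology q') U \<and> \<eta> \<in> U \<and> U \<subseteq> ?V" by blast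
  qed
  moreover have "T ` topspace (Dq_topology q') \<subseteq> topspace (Dq_topology q)"
    using maps by (auto simp: topspace_Dq_topology)
  ultimately show ?thesis
    unfolding Dq_topology_def[of q] continuous_on_generated_topo_iff topology_generated_by_topspace
    by (auto simp: topspace_Dq_topology)
qed

section \<open>Integrals over the plane with a Cauchy singularity\<close>

text \<open>Every power is dominated by every Gaussian; the constant comes from
\<open>(1 + x / m) ^ m \<le> exp x\<close>.\<close>

lemma power_le_exp_square:
  fixes c :: real
  assumes "0 < c"
  obtains K where "0 < K" "\<And>r. 0 \<le> r \<Longrightarrow> r ^ m \<le> K * exp (c * r\<^sup>2)"
proof (cases "m = 0")
  case True
  with assms show ?thesis by (intro that[of 1]) auto
next
  case False
  show ?thesis
  proof (rule that[of "1 + (real m / c) ^ m"])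
    fix r :: real assume r: "0 \<le> r"
    have "r ^ m \<le> 1 + (r\<^sup>2) ^ m"
    proof (cases "r \<le> 1")
      case True
      then have "r ^ m \<le> 1" using r by (simp add: power_le_one)
      then show ?thesis by (smt (verit) zero_le_power zero_le_power2)
    next
      case False
      then have "r ^ m \<le> r ^ (2 * m)" by (intro power_increasing) auto
      then show ?thesis by (simp add: power_mult)
    qed
    moreover have "(r\<^sup>2) ^ m \<le> (real m / c) ^ m * exp (c * r\<^sup>2)"
    proof -
      have "0 \<le> c * r\<^sup>2 / real m" using assms by simp
      then have "(c * r\<^sup>2 / real m) ^ m \<le> (1 + c * r\<^sup>2 / real m) ^ m"
        by (intro power_mono) auto
      also have "\<dots> \<le> exp (c * r\<^sup>2)"
        using assms False by (intro exp_ge_one_plus_x_over_n_power_n) (auto intro: order_trans[of _ 0])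
      finally have "(real m / c) ^ m * (c * r\<^sup>2 / real m) ^ m \<le> (real m / c) ^ m * exp (c * r\<^sup>2)"
        using assms by (intro mult_left_mono) auto
      moreover have "(real m / c) ^ m * (c * r\<^sup>2 / real m) ^ m = (r\<^sup>2) ^ m"
        using assms False by (simp add: power_mult_distrib[symmetric])
      ultimately show ?thesis by simp
    qed
    moreover have "1 \<le> exp (c * r\<^sup>2)" using assms by simp
    ultimately have "r ^ m \<le> exp (c * r\<^sup>2) + (real m / c) ^ m * exp (c * r\<^sup>2)"
      by linarith
    then show "r ^ m \<le> (1 + (real m / c) ^ m) * exp (c * r\<^sup>2)"
      by (simp add: algebra_simps)
  qed (use assms in \<open>auto intro: add_pos_nonneg\<close>)
qed

text \<open>The Gaussian is below a multiple of \<open>exp (- |x|)\<close> by completing the square, and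
\<open>x powr (-1/2) * exp (- x)\<close> is the integrand of the Gamma function at 1/2.\<close>

lemma integrable_inverse_sqrt_gaussian:
  fixes c :: real
  assumes "0 < c"
  shows "integrable lborel (\<lambda>x::real. \<bar>x\<bar> powr (-1/2) * exp (- c * x\<^sup>2))"
proof -
  define g where "g = (\<lambda>x::real. indicator {0<..} x * (x powr (-1/2) * exp (- x)))"
  have "(\<lambda>t. complex_of_real t powr (1/2 - 1) / of_real (exp t)) absolutely_integrable_on {0<..}"
    by (rule absolutely_integrable_Gamma_integral') simp
  then have "integrable lebesgue (\<lambda>t. norm (indicator {0<..} t *\<^sub>R (complex_of_real t powr (1/2 - 1) / of_real (exp t))))"
    unfolding set_integrable_def by (rule integrable_norm)
  also have "(\<lambda>t. norm (indicator {0<..} t *\<^sub>R (complex_of_real t powr (1/2 - 1) / of_real (exp t)))) = g"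
    by (auto simp: g_def fun_eq_iff indicator_def norm_divide norm_powr_real_powr exp_minus field_simps)
  finally have g: "integrable lborel g"
    by (subst (asm) integrable_completion) (simp_all add: g_def)
  have "integrable lborel (\<lambda>x. g (0 + (-1) * x))"
    by (rule lborel_integrable_real_affine[OF g]) simp
  with g have "integrable lborel (\<lambda>x. exp (1 / (4 * c)) * (g x + g (- x)))"
    by (intro integrable_mult_right Bochner_Integration.integrable_add) auto
  then show ?thesis
  proof (rule Bochner_Integration.integrable_bound)
    have "\<bar>x\<bar> powr (-1/2) * exp (- c * x\<^sup>2) \<le> exp (1 / (4 * c)) * (g x + g (- x))" for x :: real
    proof -
      have "0 \<le> c * (\<bar>x\<bar> - 1 / (2 * c))\<^sup>2" using assms by simp
      also have "\<dots> = c * x\<^sup>2 - \<bar>x\<bar> + 1 / (4 * c)"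
        using assms by (simp add: power2_eq_square field_simps)
      finally have "exp (- c * x\<^sup>2) \<le> exp (1 / (4 * c)) * exp (- \<bar>x\<bar>)"
        by (simp add: exp_add[symmetric])
      then have "\<bar>x\<bar> powr (-1/2) * exp (- c * x\<^sup>2) \<le> \<bar>x\<bar> powr (-1/2) * (exp (1 / (4 * c)) * exp (- \<bar>x\<bar>))"
        by (intro mult_left_mono) auto
      also have "\<dots> = exp (1 / (4 * c)) * (g x + g (- x))"
        by (cases "x = 0") (auto simp: g_def indicator_def abs_if)
      finally show ?thesis .
    qed
    then show "AE x in lborel. norm (\<bar>x\<bar> powr (-1/2) * exp (- c * x\<^sup>2)) \<le> norm (exp (1 / (4 * c)) * (g x + g (- x)))"
      by (intro always_eventually allI) (smt (verit) real_norm_def mult_nonneg_nonneg powr_ge_zero exp_ge_zero)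
  qed simp
qed

lemma integrable_lborel_pair_mult:
  fixes f g :: "real \<Rightarrow> real"
  assumes f: "integrable lborel f" and g: "integrable lborel g"
  shows "integrable (lborel \<Otimes>\<^sub>M lborel) (\<lambda>p. f (fst p) * g (snd p))"
proof (rule lborel_pair.Fubini_integrable)
  have [measurable]: "f \<in> borel_measurable borel" "g \<in> borel_measurable borel"
    using f g by (auto dest: borel_measurable_integrable)
  show "(\<lambda>p. f (fst p) * g (snd p)) \<in> borel_measurable (lborel \<Otimes>\<^sub>M lborel)"
    by measurable
  have "integrable lborel (\<lambda>x. norm (f x) * (\<integral>y. norm (g y) \<partial>lborel))"
    by (intro integrable_mult_left integrable_norm f)
  then show "integrable lborel (\<lambda>x. \<integral>y. norm (f (fst (x, y)) * g (snd (x, y))) \<partial>lborel)"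
    by (simp add: abs_mult)
qed (use g in simp)

abbreviation plane :: "real \<times> real \<Rightarrow> complex" where
  "plane p \<equiv> Complex (fst p) (snd p)"

lemma borel_measurable_plane [measurable]: "plane \<in> borel_measurable borel"
  unfolding Complex_eq by (intro borel_measurable_continuous_onI continuous_intros)

lemma borel_measurable_compose_plane:
  "continuous_on UNIV f \<Longrightarrow> (\<lambda>p. f (plane p) :: complex) \<in> borel_measurable lborel"
  by (rule measurable_compose[OF _ borel_measurable_continuous_onI]) simp_all

lemma AE_lborel_coordinates_nonzero:
  "AE p in lborel. fst p \<noteq> (0::real) \<and> snd p \<noteq> (0::real)"
proof -
  have "AE p in lborel \<Otimes>\<^sub>M lborel. fst p \<noteq> (0::real) \<and> snd p \<noteq> (0::real)"
  proof (rule lborel_pair.AE_pair_measure)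
    have "AE y in lborel. y \<noteq> (0::real)" by (rule AE_lborel_singleton)
    then show "AE x in lborel. AE y in lborel. fst (x, y) \<noteq> (0::real) \<and> snd (x, y) \<noteq> (0::real)"
      by (auto elim!: eventually_mono)
  qed measurable
  then show ?thesis unfolding lborel_prod .
qed

text \<open>The singularity \<open>1 / |u|\<close> of the Cauchy kernel is integrable in the plane. Instead of polar
coordinates the proof uses \<open>|x| * |y| \<le> |u|^2\<close>, so that \<open>1 / |u|\<close> is at most
\<open>|x| powr (-1/2) * |y| powr (-1/2)\<close> off the axes and the integrand is dominated by a product of
two integrable functions of one variable.\<close>

lemma integrable_cauchy_gaussian:
  fixes c :: real
  assumes c: "0 < c"
  shows "integrable lborel (\<lambda>p. cmod (plane p) ^ m * exp (- c * (cmod (plane p))\<^sup>2) / cmod (plane p))"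
proof -
  obtain K where K: "0 < K" "\<And>r. 0 \<le> r \<Longrightarrow> r ^ m \<le> K * exp (c / 2 * r\<^sup>2)"
    using power_le_exp_square[of "c/2" m] c by auto
  let ?w = "\<lambda>x::real. \<bar>x\<bar> powr (-1/2) * exp (- (c/2) * x\<^sup>2)"
  have w: "integrable lborel ?w"
    by (rule integrable_inverse_sqrt_gaussian) (use c in simp)
  have "integrable lborel (\<lambda>p. K * (?w (fst p) * ?w (snd p)))"
    using integrable_lborel_pair_mult[OF w w] by (simp add: lborel_prod)
  then show ?thesis
  proof (rule Bochner_Integration.integrable_bound)
    show "AE p in lborel. norm (cmod (plane p) ^ m * exp (- c * (cmod (plane p))\<^sup>2) / cmod (plane p))
        \<le> norm (K * (?w (fst p) * ?w (snd p)))"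
      using AE_lborel_coordinates_nonzero
    proof eventually_elim
      case (elim p)
      obtain x y where p: "p = (x, y)" by (cases p)
      define r where "r = cmod (plane p)"
      have r2: "r\<^sup>2 = x\<^sup>2 + y\<^sup>2" by (simp add: r_def p cmod_power2)
      have xy: "x \<noteq> 0" "y \<noteq> 0" using elim p by auto
      then have r: "r > 0" by (simp add: r_def p complex_eq_iff)
      have "2 * \<bar>x\<bar> * \<bar>y\<bar> \<le> r\<^sup>2"
        unfolding r2 using sum_squares_bound[of "\<bar>x\<bar>" "\<bar>y\<bar>"] by simp
      moreover have "0 \<le> \<bar>x\<bar> * \<bar>y\<bar>" by simp
      ultimately have "\<bar>x\<bar> * \<bar>y\<bar> \<le> r\<^sup>2" by linarith
      then have "(r\<^sup>2) powr (-1/2) \<le> (\<bar>x\<bar> * \<bar>y\<bar>) powr (-1/2)"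
        using xy by (intro powr_mono2') auto
      moreover have "(r\<^sup>2) powr (-1/2) = 1 / r"
        using r by (simp add: powr_minus_divide powr_half_sqrt)
      ultimately have inv: "1 / r \<le> \<bar>x\<bar> powr (-1/2) * \<bar>y\<bar> powr (-1/2)"
        by (simp add: powr_mult)
      have "r ^ m * exp (- c * r\<^sup>2) \<le> K * exp (c / 2 * r\<^sup>2) * exp (- c * r\<^sup>2)"
        using K(2)[of r] r by (intro mult_right_mono) auto
      also have "\<dots> = K * exp (- (c/2) * r\<^sup>2)"
        by (simp add: mult_exp_exp)
      also have "\<dots> = K * (exp (- (c/2) * x\<^sup>2) * exp (- (c/2) * y\<^sup>2))"
        by (simp add: r2 exp_add[symmetric] algebra_simps)
      finally have "(r ^ m * exp (- c * r\<^sup>2)) * (1 / r) \<le>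
          (K * (exp (- (c/2) * x\<^sup>2) * exp (- (c/2) * y\<^sup>2))) * (\<bar>x\<bar> powr (-1/2) * \<bar>y\<bar> powr (-1/2))"
        by (rule mult_mono[OF _ inv]) (use r K(1) in auto)
      also have "\<dots> = K * (?w (fst p) * ?w (snd p))"
        by (simp only: p fst_conv snd_conv mult_ac)
      also have "\<dots> \<le> norm (K * (?w (fst p) * ?w (snd p)))"
        unfolding real_norm_def by (rule abs_ge_self)
      finally show ?case
        using r by (simp add: r_def[symmetric])
    qed
  qed simp
qed

lemma integrable_gaussian_bounded:
  fixes f :: "real \<times> real \<Rightarrow> complex"
  assumes "f \<in> borel_measurable lborel" "0 < c"
    and "\<And>p. cmod (f p) \<le> K * (cmod (plane p) ^ m * exp (- c * (cmod (plane p))\<^sup>2) / cmod (plane p))"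
  shows "integrable lborel f"
  by (rule Bochner_Integration.integrable_bound[OF integrable_mult_right[OF integrable_cauchy_gaussian[OF assms(2), of m], of K]])
     (use assms(1) order_trans[OF assms(3) abs_ge_self] in auto)

lemma integral_gaussian_plane:
  "integrable lborel (\<lambda>p. exp (- (cmod (plane p))\<^sup>2))"
  "(\<integral>p. exp (- (cmod (plane p))\<^sup>2) \<partial>lborel) = pi"
proof -
  have density: "normal_density 0 (1 / sqrt 2) x = exp (- x\<^sup>2) / sqrt pi" for x
    by (simp add: normal_density_def power_divide)
  have "integrable lborel (\<lambda>x. sqrt pi * normal_density 0 (1 / sqrt 2) x)"
    by (intro integrable_mult_right integrable_normal_density) simp
  then have g: "integrable lborel (\<lambda>x::real. exp (- x\<^sup>2))"
    by (simp add: density)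
  have "(\<integral>x. sqrt pi * normal_density 0 (1 / sqrt 2) x \<partial>lborel) = sqrt pi"
    by (subst integral_mult_right_zero, subst integral_normal_density) auto
  then have v: "integral\<^sup>L lborel (\<lambda>x::real. exp (- x\<^sup>2)) = sqrt pi"
    by (simp add: density)
  have eq: "exp (- (cmod (plane p))\<^sup>2) = exp (- (fst p)\<^sup>2) * exp (- (snd p)\<^sup>2)" for p
    by (simp add: cmod_power2 exp_add[symmetric])
  have i: "integrable (lborel \<Otimes>\<^sub>M lborel) (\<lambda>p. exp (- (fst p)\<^sup>2) * exp (- (snd p)\<^sup>2) :: real)"
    by (rule integrable_lborel_pair_mult[OF g g])
  show "integrable lborel (\<lambda>p. exp (- (cmod (plane p))\<^sup>2))"
    using i by (simp add: eq lborel_prod)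
  have "integral\<^sup>L (lborel \<Otimes>\<^sub>M lborel) (\<lambda>p. exp (- (fst p)\<^sup>2) * exp (- (snd p)\<^sup>2) :: real)
      = (\<integral>x. (\<integral>y. exp (- x\<^sup>2) * exp (- y\<^sup>2) \<partial>lborel) \<partial>lborel)"
    using lborel_pair.integral_fst'[OF i] by simp
  also have "\<dots> = pi"
    by (simp add: v)
  finally show "(\<integral>p. exp (- (cmod (plane p))\<^sup>2) \<partial>lborel) = pi"
    by (simp add: eq lborel_prod)
qed

lemma norm_real_linear_le:
  assumes "cmod a \<le> w" "cmod b \<le> w"
  shows "cmod (of_real (Re v) * a + of_real (Im v) * b) \<le> 2 * w * cmod v"
proof -
  have w: "0 \<le> w" using assms(1) norm_ge_zero order_trans by blast
  have "cmod (of_real (Re v) * a + of_real (Im v) * b) \<le> \<bar>Re v\<bar> * cmod a + \<bar>Im v\<bar> * cmod b"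
    using norm_triangle_ineq[of "of_real (Re v) * a" "of_real (Im v) * b"] by (simp add: norm_mult)
  also have "\<dots> \<le> cmod v * w + cmod v * w"
    using w by (intro add_mono mult_mono abs_Re_le_cmod abs_Im_le_cmod assms) auto
  finally show ?thesis by simp
qed

lemma has_partials_lipschitz:
  assumes "\<And>z. z \<in> cball z0 1 \<Longrightarrow> has_partials f (a z) (b z) z"
    and "\<And>z. z \<in> cball z0 1 \<Longrightarrow> cmod (a z) \<le> w" "\<And>z. z \<in> cball z0 1 \<Longrightarrow> cmod (b z) \<le> w"
    and z: "z \<in> cball z0 1"
  shows "cmod (f z - f z0) \<le> 2 * w * cmod (z - z0)"
proof (rule differentiable_bound)
  fix y assume y: "y \<in> cball z0 1"
  show "(f has_derivative (\<lambda>v. of_real (Re v) * a y + of_real (Im v) * b y)) (at y within cball z0 1)"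
    using assms(1)[OF y] by (auto simp: has_partials_def intro: has_derivative_at_withinI)
  have "cmod (of_real (Re v) * a y + of_real (Im v) * b y) \<le> 2 * w * cmod v" for v
    by (rule norm_real_linear_le) (use assms(2,3)[OF y] in auto)
  then show "onorm (\<lambda>v. of_real (Re v) * a y + of_real (Im v) * b y) \<le> 2 * w"
    by (rule onorm_le)
qed (use z in auto)

text \<open>Differentiation under the integral sign. By dominated convergence the remainder quotient \<open>R z\<close>
has integral tending to 0: it tends to 0 pointwise, and by the mean value inequality it is at most
\<open>4 * w\<close> for \<open>z\<close> in the unit disc around \<open>z0\<close>.\<close>

lemma has_partials_integral:
  fixes F :: "complex \<Rightarrow> 'a \<Rightarrow> complex"
  assumes F: "\<And>z. integrable M (F z)"
    and part: "\<And>z p. has_partials (\<lambda>z. F z p) (A z p) (B z p) z"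
    and meas: "A z0 \<in> borel_measurable M" "B z0 \<in> borel_measurable M"
    and w: "integrable M w"
    and bound: "\<And>z p. z \<in> cball z0 1 \<Longrightarrow> cmod (A z p) \<le> w p" "\<And>z p. z \<in> cball z0 1 \<Longrightarrow> cmod (B z p) \<le> w p"
  shows "has_partials (\<lambda>z. \<integral>p. F z p \<partial>M) (\<integral>p. A z0 p \<partial>M) (\<integral>p. B z0 p \<partial>M) z0"
proof -
  have w0: "0 \<le> w p" for p
    using order_trans[OF norm_ge_zero bound(1)[of z0 p]] by simp
  have A: "integrable M (A z0)" and B: "integrable M (B z0)"
    by (rule Bochner_Integration.integrable_bound[OF w]; use meas bound w0 in \<open>auto\<close>)+
  define R where "R = (\<lambda>z p. (F z p - F z0 p - (of_real (Re (z - z0)) * A z0 p + of_real (Im (z - z0)) * B z0 p))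
      / of_real (cmod (z - z0)))"
  have lim: "((\<lambda>z. R z p) \<longlongrightarrow> 0) (at z0)" for p
  proof (rule tendsto_norm_zero_cancel)
    show "((\<lambda>z. norm (R z p)) \<longlongrightarrow> 0) (at z0)"
      using conjunct2[OF part[where z=z0 and p=p, unfolded has_partials_def has_derivative_iff_norm]]
      unfolding R_def norm_divide norm_of_real abs_norm_cancel .
  qed
  have R_le: "cmod (R z p) \<le> 4 * w p" if z: "z \<in> cball z0 1" "z \<noteq> z0" for z p
  proof -
    let ?L = "of_real (Re (z - z0)) * A z0 p + of_real (Im (z - z0)) * B z0 p"
    have "cmod ?L \<le> 2 * w p * cmod (z - z0)"
      by (rule norm_real_linear_le) (use bound[of z0 p] in auto)
    moreover have "cmod (F z p - F z0 p) \<le> 2 * w p * cmod (z - z0)"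
      by (rule has_partials_lipschitz[of z0 "\<lambda>z. F z p" "\<lambda>z. A z p" "\<lambda>z. B z p"])
         (use part bound z in auto)
    ultimately have "cmod (F z p - F z0 p - ?L) \<le> 4 * w p * cmod (z - z0)"
      using norm_triangle_ineq4[of "F z p - F z0 p" ?L] by linarith
    then show ?thesis
      using z by (simp add: R_def norm_divide divide_le_eq)
  qed
  have int_R: "(\<integral>p. R z p \<partial>M) = ((\<integral>p. F z p \<partial>M) - (\<integral>p. F z0 p \<partial>M)
      - (of_real (Re (z - z0)) * (\<integral>p. A z0 p \<partial>M) + of_real (Im (z - z0)) * (\<integral>p. B z0 p \<partial>M)))
      / of_real (cmod (z - z0))" for z
    unfolding R_def using F A B by simp
  have "((\<lambda>z. \<integral>p. R z p \<partial>M) \<longlongrightarrow> 0) (at z0)"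
    unfolding tendsto_at_iff_sequentially
  proof (intro allI impI)
    fix X assume X: "\<forall>i. X i \<in> UNIV - {z0}" "X \<longlonglongrightarrow> z0"
    then have "\<forall>\<^sub>F n in sequentially. X n \<in> cball z0 1"
      by (auto simp: dist_commute dest: tendstoD[of _ _ _ 1] elim!: eventually_mono)
    then obtain N where N: "\<And>n. n \<ge> N \<Longrightarrow> X n \<in> cball z0 1"
      by (auto simp: eventually_sequentially)
    have XN: "(\<lambda>n. X (n + N)) \<longlonglongrightarrow> z0" using X(2) by (rule LIMSEQ_ignore_initial_segment)
    have "(\<lambda>n. \<integral>p. R (X (n + N)) p \<partial>M) \<longlonglongrightarrow> (\<integral>p. 0 \<partial>M)"
    proof (rule integral_dominated_convergence)
      show "integrable M (\<lambda>p. 4 * w p)" using w by simp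
      show "AE p in M. (\<lambda>n. R (X (n + N)) p) \<longlonglongrightarrow> 0"
      proof (intro always_eventually allI)
        fix p
        have "filterlim (\<lambda>n. X (n + N)) (at z0) sequentially"
          using XN X(1) by (auto simp: filterlim_at)
        then show "(\<lambda>n. R (X (n + N)) p) \<longlonglongrightarrow> 0"
          by (rule filterlim_compose[OF lim])
      qed
      show "AE p in M. norm (R (X (n + N)) p) \<le> 4 * w p" for n
        using R_le N X(1) by (intro always_eventually allI) auto
      show "R (X (n + N)) \<in> borel_measurable M" for n
        unfolding R_def using F[THEN borel_measurable_integrable] meas by measurable
    qed simp
    then show "((\<lambda>z. \<integral>p. R z p \<partial>M) \<circ> X) \<longlonglongrightarrow> 0"
      unfolding o_def by (intro LIMSEQ_offset[of "\<lambda>n. \<integral>p. R (X n) p \<partial>M" N]) simp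
  qed
  then have "((\<lambda>z. cmod (\<integral>p. R z p \<partial>M)) \<longlongrightarrow> 0) (at z0)"
    by (rule tendsto_norm_zero)
  moreover have "bounded_linear (\<lambda>v. of_real (Re v) * a + of_real (Im v) * b :: complex)" for a b
    by (intro bounded_linear_intros bounded_linear_compose[OF bounded_linear_of_real] bounded_linear_Re bounded_linear_Im)
  ultimately show ?thesis
    unfolding has_partials_def has_derivative_iff_norm int_R by (simp add: norm_divide)
qed

section \<open>The Cauchy transform with a Fock space kernel\<close>

text \<open>The integrand of the transform after the substitution \<open>u = z - w\<close>, which moves the singularity to
the fixed point \<open>u = 0\<close> and all derivatives in \<open>z\<close> onto \<open>\<psi>\<close> and the exponential. Each derivative of
the exponential produces a factor \<open>u\<close>; the exponent \<open>m\<close> counts them.\<close>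

definition fock_cauchy_integrand ::
    "real \<Rightarrow> nat \<Rightarrow> (complex \<Rightarrow> complex) \<Rightarrow> complex \<Rightarrow> complex \<Rightarrow> complex" where
  "fock_cauchy_integrand b m \<psi> z u = \<psi> (z - u) * u ^ m * exp (2 * of_real b * u * cnj (z - u)) / u"

definition fock_cauchy :: "real \<Rightarrow> nat \<Rightarrow> (complex \<Rightarrow> complex) \<Rightarrow> complex \<Rightarrow> complex" where
  "fock_cauchy b m \<psi> z = (\<integral>p. fock_cauchy_integrand b m \<psi> z (plane p) \<partial>lborel)"

lemma Re_mult_cnj_diff: "2 * Re (u * cnj (z - u)) = (cmod z)\<^sup>2 - (cmod u)\<^sup>2 - (cmod (z - u))\<^sup>2"
  unfolding cmod_power2 by (simp add: power2_eq_square algebra_simps)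

text \<open>This identity is the point of the kernel: the last factor cancels the growth
\<open>exp (b * |z - u|^2)\<close> of \<open>\<psi> (z - u)\<close>, the middle one makes the integral over \<open>u\<close> converge, and the first one
is the weight of the result.\<close>

lemma norm_exp_fock:
  "cmod (exp (2 * of_real b * u * cnj (z - u)))
     = exp (b * (cmod z)\<^sup>2) * exp (- b * (cmod u)\<^sup>2) * exp (- b * (cmod (z - u))\<^sup>2)"
proof -
  have "cmod (exp (2 * of_real b * u * cnj (z - u))) = exp (b * (2 * Re (u * cnj (z - u))))"
    by (simp add: algebra_simps)
  also have "\<dots> = exp (b * (cmod z)\<^sup>2 + - b * (cmod u)\<^sup>2 + - b * (cmod (z - u))\<^sup>2)"
    unfolding Re_mult_cnj_diff by (simp add: algebra_simps)
  finally show ?thesis unfolding exp_add .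
qed

lemma norm_fock_cauchy_integrand:
  assumes "\<And>w. cmod (\<psi> w) \<le> K * exp (b * (cmod w)\<^sup>2)"
  shows "cmod (fock_cauchy_integrand b m \<psi> z u)
     \<le> K * exp (b * (cmod z)\<^sup>2) * (cmod u ^ m * exp (- b * (cmod u)\<^sup>2) / cmod u)"
proof -
  have "cmod (fock_cauchy_integrand b m \<psi> z u) = cmod (\<psi> (z - u)) * exp (- b * (cmod (z - u))\<^sup>2) *
      (exp (b * (cmod z)\<^sup>2) * (cmod u ^ m * exp (- b * (cmod u)\<^sup>2) / cmod u))"
    unfolding fock_cauchy_integrand_def norm_divide norm_mult norm_power norm_exp_fock by (simp add: mult_ac)
  also have "\<dots> \<le> K * exp (b * (cmod (z - u))\<^sup>2) * exp (- b * (cmod (z - u))\<^sup>2) *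
      (exp (b * (cmod z)\<^sup>2) * (cmod u ^ m * exp (- b * (cmod u)\<^sup>2) / cmod u))"
    by (intro mult_right_mono assms) auto
  also have "\<dots> = K * exp (b * (cmod z)\<^sup>2) * (cmod u ^ m * exp (- b * (cmod u)\<^sup>2) / cmod u)"
    by (simp add: exp_minus)
  finally show ?thesis .
qed

lemma borel_measurable_fock_cauchy_integrand:
  assumes "continuous_on UNIV \<psi>"
  shows "(\<lambda>p. fock_cauchy_integrand b m \<psi> z (plane p)) \<in> borel_measurable lborel"
  unfolding fock_cauchy_integrand_def
  by (intro borel_measurable_divide
        borel_measurable_compose_plane[of "\<lambda>u. \<psi> (z - u) * u ^ m * exp (2 * of_real b * u * cnj (z - u))"]
        borel_measurable_compose_plane[of "\<lambda>u. u"] continuous_intros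
        continuous_on_compose2[OF assms]) auto

lemma Dq_growth:
  assumes "\<psi> \<in> Dq_space b"
  shows "cmod (\<psi> w) \<le> Dq_seminorm b (0, 0) \<psi> * exp (b * (cmod w)\<^sup>2)"
  using Dq_seminorm_bound[OF assms, of "(0, 0)"] by (simp add: D_multi_0)

lemma integrable_fock_cauchy:
  assumes b: "0 < b" and "\<psi> \<in> Dq_space b"
  shows "integrable lborel (\<lambda>p. fock_cauchy_integrand b m \<psi> z (plane p))"
  by (rule integrable_gaussian_bounded[OF borel_measurable_fock_cauchy_integrand b
        norm_fock_cauchy_integrand[OF Dq_growth]])
     (use assms in \<open>auto intro: smooth_continuous Dq_smooth\<close>)

lemma has_partials_fock_cauchy_integrand:
  assumes "smooth \<psi>"
  shows "has_partials (\<lambda>z. fock_cauchy_integrand b m \<psi> z u)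
    (fock_cauchy_integrand b m (D1 \<psi>) z u + 2 * of_real b * fock_cauchy_integrand b (Suc m) \<psi> z u)
    (fock_cauchy_integrand b m (D2 \<psi>) z u - 2 * of_real b * \<i> * fock_cauchy_integrand b (Suc m) \<psi> z u) z"
proof -
  have 1: "has_partials (\<lambda>z. \<psi> (1 * z + (- u))) (1 * D1 \<psi> (z - u)) (1 * D2 \<psi> (z - u)) z"
    by (rule has_partials_chain_affine) (use assms in \<open>auto intro: smooth_has_partials\<close>)
  have 2: "has_partials (\<lambda>z. 2 * of_real b * u * (cnj z - cnj u)) (2 * of_real b * u * (1 - 0))
      (2 * of_real b * u * (- \<i> - 0)) z"
    by (intro has_partials_cmult has_partials_diff has_partials_cnj has_partials_const)
  have 3: "has_partials (\<lambda>z. exp (2 * of_real b * u * (cnj z - cnj u)))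
      (exp (2 * of_real b * u * (cnj z - cnj u)) * (2 * of_real b * u * (1 - 0)))
      (exp (2 * of_real b * u * (cnj z - cnj u)) * (2 * of_real b * u * (- \<i> - 0))) z"
    by (rule has_partials_compose_holomorphic[OF 2]) (rule DERIV_exp)
  have "has_partials (\<lambda>z. (u ^ m / u) * (\<psi> (1 * z + (- u)) * exp (2 * of_real b * u * (cnj z - cnj u))))
    (fock_cauchy_integrand b m (D1 \<psi>) z u + 2 * of_real b * fock_cauchy_integrand b (Suc m) \<psi> z u)
    (fock_cauchy_integrand b m (D2 \<psi>) z u - 2 * of_real b * \<i> * fock_cauchy_integrand b (Suc m) \<psi> z u) z"
    by (rule has_partials_eq[OF has_partials_cmult[OF has_partials_mult[OF 1 3]]])
       (auto simp: fock_cauchy_integrand_def field_simps)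
  then show ?thesis
    by (simp add: fock_cauchy_integrand_def mult_ac)
qed

text \<open>The partial derivatives of a transform are combinations of transforms of functions in the same space, so
smoothness and all derivative bounds follow by induction. For the domination, \<open>z\<close> varies in a unit
disc, on which the weight \<open>exp (b * |z|^2)\<close> is bounded by \<open>E\<close>.\<close>

lemma has_partials_fock_cauchy:
  assumes b: "0 < b" and \<psi>: "\<psi> \<in> Dq_space b"
  shows "has_partials (fock_cauchy b m \<psi>)
    (fock_cauchy b m (D1 \<psi>) z + 2 * of_real b * fock_cauchy b (Suc m) \<psi> z)
    (fock_cauchy b m (D2 \<psi>) z - 2 * of_real b * \<i> * fock_cauchy b (Suc m) \<psi> z) z"
proof -
  note int = integrable_fock_cauchy[OF b]
  note D = Dq_D1[OF \<psi>] Dq_D2[OF \<psi>]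
  define A where "A = (\<lambda>z p. fock_cauchy_integrand b m (D1 \<psi>) z (plane p)
      + 2 * of_real b * fock_cauchy_integrand b (Suc m) \<psi> z (plane p))"
  define B where "B = (\<lambda>z p. fock_cauchy_integrand b m (D2 \<psi>) z (plane p)
      - 2 * of_real b * \<i> * fock_cauchy_integrand b (Suc m) \<psi> z (plane p))"
  have intA: "integrable lborel (A z)" and intB: "integrable lborel (B z)" for z
    unfolding A_def B_def by (intro Bochner_Integration.integrable_add Bochner_Integration.integrable_diff
        integrable_mult_right int D \<psi>)+
  define k where "k = (\<lambda>n p. cmod (plane p) ^ n * exp (- b * (cmod (plane p))\<^sup>2) / cmod (plane p))"
  have k: "integrable lborel (k n)" "0 \<le> k n p" for n p
    unfolding k_def by (rule integrable_cauchy_gaussian[OF b]) simp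
  define E where "E = exp (b * (cmod z + 1)\<^sup>2)"
  define K where "K = Dq_seminorm b (0,0) (D1 \<psi>) + Dq_seminorm b (0,0) (D2 \<psi>) + Dq_seminorm b (0,0) \<psi>"
  define w where "w = (\<lambda>p. K * E * k m p + 2 * b * (K * E * k (Suc m) p))"
  have nonneg: "0 \<le> Dq_seminorm b (0,0) (D1 \<psi>)" "0 \<le> Dq_seminorm b (0,0) (D2 \<psi>)" "0 \<le> Dq_seminorm b (0,0) \<psi>"
    by (intro Dq_seminorm_nonneg D \<psi>)+
  have w: "integrable lborel w"
    unfolding w_def by (intro Bochner_Integration.integrable_add integrable_mult_right k)
  have bnd: "cmod (fock_cauchy_integrand b n \<phi> y (plane p)) \<le> K * E * k n p"
    if \<phi>: "\<phi> \<in> Dq_space b" "Dq_seminorm b (0,0) \<phi> \<le> K" and y: "y \<in> cball z 1" for y \<phi> n p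
  proof -
    have "cmod y \<le> cmod z + 1"
      using y norm_triangle_ineq2[of y z] by (simp add: dist_norm norm_minus_commute)
    then have "exp (b * (cmod y)\<^sup>2) \<le> E"
      using b by (simp add: E_def power_mono)
    then have "Dq_seminorm b (0,0) \<phi> * exp (b * (cmod y)\<^sup>2) * k n p \<le> K * E * k n p"
      using \<phi> Dq_seminorm_nonneg[OF \<phi>(1)] k by (intro mult_right_mono mult_mono) (auto intro: order_trans)
    then show ?thesis
      using norm_fock_cauchy_integrand[OF Dq_growth[OF \<phi>(1)], of n y "plane p"] by (simp add: k_def)
  qed
  have K: "Dq_seminorm b (0,0) (D1 \<psi>) \<le> K" "Dq_seminorm b (0,0) (D2 \<psi>) \<le> K" "Dq_seminorm b (0,0) \<psi> \<le> K"
    using nonneg by (auto simp: K_def)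
  have "has_partials (\<lambda>z. \<integral>p. fock_cauchy_integrand b m \<psi> z (plane p) \<partial>lborel)
      (\<integral>p. A z p \<partial>lborel) (\<integral>p. B z p \<partial>lborel) z"
  proof (rule has_partials_integral[OF int[OF \<psi>] _ _ _ w])
    show "has_partials (\<lambda>z. fock_cauchy_integrand b m \<psi> z (plane p)) (A z p) (B z p) z" for z p
      unfolding A_def B_def by (rule has_partials_fock_cauchy_integrand[OF Dq_smooth[OF \<psi>]])
    fix y p assume y: "y \<in> cball z 1"
    have 2: "cmod (2 * of_real b * fock_cauchy_integrand b (Suc m) \<psi> y (plane p)) \<le> 2 * b * (K * E * k (Suc m) p)"
      using bnd[OF \<psi> K(3) y, of "Suc m" p] b by (simp add: norm_mult)
    show "cmod (A y p) \<le> w p"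
      unfolding A_def w_def
      by (rule order_trans[OF norm_triangle_ineq add_mono[OF bnd[OF D(1) K(1) y] 2]])
    have "cmod (2 * of_real b * \<i> * fock_cauchy_integrand b (Suc m) \<psi> y (plane p)) \<le> 2 * b * (K * E * k (Suc m) p)"
      using 2 by (simp add: norm_mult)
    then show "cmod (B y p) \<le> w p"
      unfolding B_def w_def
      by (intro order_trans[OF norm_triangle_ineq4 add_mono[OF bnd[OF D(2) K(2) y]]])
  qed (use intA intB in \<open>auto dest: borel_measurable_integrable\<close>)
  moreover have "(\<integral>p. A z p \<partial>lborel) = fock_cauchy b m (D1 \<psi>) z + 2 * of_real b * fock_cauchy b (Suc m) \<psi> z"
    unfolding A_def fock_cauchy_def using int[OF D(1)] int[OF \<psi>] by simp
  moreover have "(\<integral>p. B z p \<partial>lborel) = fock_cauchy b m (D2 \<psi>) z - 2 * of_real b * \<i> * fock_cauchy b (Suc m) \<psi> z"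
    unfolding B_def fock_cauchy_def using int[OF D(2)] int[OF \<psi>] by simp
  ultimately show ?thesis
    by (simp add: fock_cauchy_def[abs_def])
qed

lemma smooth_fock_cauchy:
  assumes b: "0 < b" and "\<psi> \<in> Dq_space b"
  shows "smooth (fock_cauchy b m \<psi>)"
proof -
  have "C_k k (fock_cauchy b m \<psi>)" if "\<psi> \<in> Dq_space b" for k m \<psi>
    using that
  proof (induction k arbitrary: m \<psi>)
    case 0
    show ?case
      using has_partials_differentiable[OF has_partials_fock_cauchy[OF b 0]]
      by (auto intro!: differentiable_imp_continuous_on simp: differentiable_on_def
          intro: differentiable_at_withinI)
  next
    case (Suc k)
    show ?case
      by (rule C_k_SucI[OF has_partials_fock_cauchy[OF b Suc.prems]];
          intro C_k_add C_k_diff C_k_cmult Suc.IH Dq_D1 Dq_D2 Suc.prems)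
  qed
  with assms show ?thesis by (simp add: smooth_def)
qed

lemma fock_cauchy_diff:
  assumes "0 < b" "f \<in> Dq_space b" "g \<in> Dq_space b"
  shows "fock_cauchy b m (\<lambda>z. f z - g z) = (\<lambda>z. fock_cauchy b m f z - fock_cauchy b m g z)"
proof
  fix z
  have "fock_cauchy_integrand b m (\<lambda>z. f z - g z) z u =
      fock_cauchy_integrand b m f z u - fock_cauchy_integrand b m g z u" for u
    by (simp add: fock_cauchy_integrand_def algebra_simps diff_divide_distrib)
  then show "fock_cauchy b m (\<lambda>z. f z - g z) z = fock_cauchy b m f z - fock_cauchy b m g z"
    using integrable_fock_cauchy[OF assms(1,2)] integrable_fock_cauchy[OF assms(1,3)]
    by (simp add: fock_cauchy_def)
qed

lemma fock_cauchy_add: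
  assumes "0 < b" "f \<in> Dq_space b" "g \<in> Dq_space b"
  shows "fock_cauchy b m (\<lambda>z. f z + g z) = (\<lambda>z. fock_cauchy b m f z + fock_cauchy b m g z)"
proof
  fix z
  have "fock_cauchy_integrand b m (\<lambda>z. f z + g z) z u =
      fock_cauchy_integrand b m f z u + fock_cauchy_integrand b m g z u" for u
    by (simp add: fock_cauchy_integrand_def algebra_simps add_divide_distrib)
  then show "fock_cauchy b m (\<lambda>z. f z + g z) z = fock_cauchy b m f z + fock_cauchy b m g z"
    using integrable_fock_cauchy[OF assms(1,2)] integrable_fock_cauchy[OF assms(1,3)]
    by (simp add: fock_cauchy_def)
qed

lemma fock_cauchy_cmult:
  assumes "0 < b" "f \<in> Dq_space b"
  shows "fock_cauchy b m (\<lambda>z. c * f z) = (\<lambda>z. c * fock_cauchy b m f z)"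
proof
  fix z
  have "fock_cauchy_integrand b m (\<lambda>z. c * f z) z u = c * fock_cauchy_integrand b m f z u" for u
    by (simp add: fock_cauchy_integrand_def)
  then show "fock_cauchy b m (\<lambda>z. c * f z) z = c * fock_cauchy b m f z"
    using integrable_fock_cauchy[OF assms(1,2)]
    by (simp add: fock_cauchy_def)
qed

lemma norm_fock_cauchy_le:
  assumes "0 < b"
  shows "\<exists>c\<ge>0. \<forall>\<psi>\<in>Dq_space b. \<forall>z.
    cmod (fock_cauchy b m \<psi> z) \<le> c * Dq_seminorm b (0, 0) \<psi> * exp (b * (cmod z)\<^sup>2)"
proof -
  define k where "k = (\<lambda>p. cmod (plane p) ^ m * exp (- b * (cmod (plane p))\<^sup>2) / cmod (plane p))"
  have k: "integrable lborel k"
    unfolding k_def by (rule integrable_cauchy_gaussian[OF assms])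
  have "cmod (fock_cauchy b m \<psi> z) \<le> (\<integral>p. k p \<partial>lborel) * Dq_seminorm b (0, 0) \<psi> * exp (b * (cmod z)\<^sup>2)"
    if \<psi>: "\<psi> \<in> Dq_space b" for \<psi> z
  proof -
    let ?K = "Dq_seminorm b (0, 0) \<psi> * exp (b * (cmod z)\<^sup>2)"
    have "cmod (fock_cauchy b m \<psi> z) \<le> (\<integral>p. cmod (fock_cauchy_integrand b m \<psi> z (plane p)) \<partial>lborel)"
      unfolding fock_cauchy_def by (rule integral_norm_bound)
    also have "\<dots> \<le> (\<integral>p. ?K * k p \<partial>lborel)"
      unfolding k_def
      by (intro integral_mono integrable_norm integrable_fock_cauchy[OF assms \<psi>] integrable_mult_right
          norm_fock_cauchy_integrand[OF Dq_growth[OF \<psi>]] k[unfolded k_def])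
    also have "\<dots> = ?K * (\<integral>p. k p \<partial>lborel)" by simp
    finally show ?thesis by (simp add: mult_ac)
  qed
  moreover have "0 \<le> (\<integral>p. k p \<partial>lborel)"
    by (simp add: k_def)
  ultimately show ?thesis by blast
qed

text \<open>The weight on the right is that of the space of \<open>\<psi>\<close>. The induction
peels off one derivative at a time, with \<open>m\<close> arbitrary since the derivatives raise it; \<open>step\<close> treats
both directions at once, \<open>D\<close> being the derivative and \<open>s\<close> its effect on multi-indices.\<close>

lemma norm_D_multi_fock_cauchy_le:
  assumes b: "0 < b"
  shows "\<exists>c\<ge>0. \<exists>B. finite B \<and> (\<forall>\<psi>\<in>Dq_space b. \<forall>z.
    cmod (D_multi \<alpha> (fock_cauchy b m \<psi>) z) \<le> c * (\<Sum>\<beta>\<in>B. Dq_seminorm b \<beta> \<psi>) * exp (b * (cmod z)\<^sup>2))"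
proof -
  define P where "P = (\<lambda>\<alpha> m. \<exists>c\<ge>0. \<exists>B. finite B \<and> (\<forall>\<psi>\<in>Dq_space b. \<forall>z.
    cmod (D_multi \<alpha> (fock_cauchy b m \<psi>) z) \<le> c * (\<Sum>\<beta>\<in>B. Dq_seminorm b \<beta> \<psi>) * exp (b * (cmod z)\<^sup>2)))"
  have step: "P \<alpha>' m"
    if IH: "\<And>m. P \<alpha> m"
      and D: "\<And>\<psi>. \<psi> \<in> Dq_space b \<Longrightarrow> D \<psi> \<in> Dq_space b"
      and semi: "\<And>\<beta> \<psi>. \<psi> \<in> Dq_space b \<Longrightarrow> Dq_seminorm b \<beta> (D \<psi>) = Dq_seminorm b (s \<beta>) \<psi>"
      and eq: "\<And>\<psi> z. \<psi> \<in> Dq_space b \<Longrightarrow> D_multi \<alpha>' (fock_cauchy b m \<psi>) z =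
          D_multi \<alpha> (fock_cauchy b m (D \<psi>)) z + e * D_multi \<alpha> (fock_cauchy b (Suc m) \<psi>) z"
    for \<alpha> \<alpha>' m D s e
  proof -
    obtain c B where 1: "c \<ge> 0" "finite B" "\<And>\<psi> z. \<psi> \<in> Dq_space b \<Longrightarrow>
        cmod (D_multi \<alpha> (fock_cauchy b m \<psi>) z) \<le> c * (\<Sum>\<beta>\<in>B. Dq_seminorm b \<beta> \<psi>) * exp (b * (cmod z)\<^sup>2)"
      using IH[of m] unfolding P_def by blast
    obtain c' B' where 2: "c' \<ge> 0" "finite B'" "\<And>\<psi> z. \<psi> \<in> Dq_space b \<Longrightarrow>
        cmod (D_multi \<alpha> (fock_cauchy b (Suc m) \<psi>) z) \<le> c' * (\<Sum>\<beta>\<in>B'. Dq_seminorm b \<beta> \<psi>) * exp (b * (cmod z)\<^sup>2)"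
      using IH[of "Suc m"] unfolding P_def by blast
    let ?B = "(\<Union>\<beta>\<in>B. {s \<beta>}) \<union> B'"
    have "cmod (D_multi \<alpha>' (fock_cauchy b m \<psi>) z) \<le>
        (c * real (card B) + cmod e * c') * (\<Sum>\<beta>\<in>?B. Dq_seminorm b \<beta> \<psi>) * exp (b * (cmod z)\<^sup>2)"
      if \<psi>: "\<psi> \<in> Dq_space b" for \<psi> z
    proof -
      note nn = Dq_seminorm_nonneg[OF \<psi>]
      let ?S = "\<Sum>\<beta>\<in>?B. Dq_seminorm b \<beta> \<psi>" and ?E = "exp (b * (cmod z)\<^sup>2)"
      have "(\<Sum>\<beta>\<in>B. Dq_seminorm b \<beta> (D \<psi>)) \<le> (\<Sum>\<beta>\<in>B. ?S)"
      proof (rule sum_mono)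
        fix \<beta> assume "\<beta> \<in> B"
        then show "Dq_seminorm b \<beta> (D \<psi>) \<le> ?S"
          unfolding semi[OF \<psi>] using 1(2) 2(2) nn by (intro member_le_sum) auto
      qed
      then have "c * (\<Sum>\<beta>\<in>B. Dq_seminorm b \<beta> (D \<psi>)) * ?E \<le> c * (real (card B) * ?S) * ?E"
        using 1(1) by (intro mult_right_mono mult_left_mono) auto
      then have a: "cmod (D_multi \<alpha> (fock_cauchy b m (D \<psi>)) z) \<le> c * (real (card B) * ?S) * ?E"
        using 1(3)[OF D[OF \<psi>], of z] by linarith
      have "(\<Sum>\<beta>\<in>B'. Dq_seminorm b \<beta> \<psi>) \<le> ?S"
        using 1(2) 2(2) nn by (intro sum_mono2) auto
      then have "c' * (\<Sum>\<beta>\<in>B'. Dq_seminorm b \<beta> \<psi>) * ?E \<le> c' * ?S * ?E"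
        using 2(1) by (intro mult_right_mono mult_left_mono) auto
      then have "cmod (D_multi \<alpha> (fock_cauchy b (Suc m) \<psi>) z) \<le> c' * ?S * ?E"
        using 2(3)[OF \<psi>, of z] by linarith
      then have "cmod (e * D_multi \<alpha> (fock_cauchy b (Suc m) \<psi>) z) \<le> cmod e * (c' * ?S * ?E)"
        unfolding norm_mult by (intro mult_left_mono) auto
      with a have "cmod (D_multi \<alpha>' (fock_cauchy b m \<psi>) z) \<le> c * (real (card B) * ?S) * ?E + cmod e * (c' * ?S * ?E)"
        unfolding eq[OF \<psi>] by (rule norm_triangle_mono)
      then show ?thesis by (simp add: algebra_simps)
    qed
    moreover have "0 \<le> c * real (card B) + cmod e * c'" "finite ?B"
      using 1 2 by auto
    ultimately show ?thesis unfolding P_def by blast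
  qed
  have zero: "P (0, 0) m" for m
  proof -
    obtain c where c: "c \<ge> 0" "\<forall>\<psi>\<in>Dq_space b. \<forall>z.
        cmod (fock_cauchy b m \<psi> z) \<le> c * Dq_seminorm b (0, 0) \<psi> * exp (b * (cmod z)\<^sup>2)"
      using norm_fock_cauchy_le[OF b] by blast
    then show ?thesis
      unfolding P_def D_multi_0 by (intro exI[of _ c] conjI exI[of _ "{(0,0)}"]) auto
  qed
  have right: "P (0, j) m" for j m
  proof (induction j arbitrary: m)
    case (Suc j)
    show ?case
    proof (rule step[of "(0, j)" D2 "\<lambda>\<beta>. (fst \<beta>, Suc (snd \<beta>))" _ _ "- (2 * of_real b * \<i>)"])
      fix \<psi> z assume \<psi>: "\<psi> \<in> Dq_space b"
      have "D2 (fock_cauchy b m \<psi>) = (\<lambda>z. fock_cauchy b m (D2 \<psi>) z + (- (2 * of_real b * \<i>)) * fock_cauchy b (Suc m) \<psi> z)"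
        using has_partials_D2[OF has_partials_fock_cauchy[OF b \<psi>]] by auto
      then show "D_multi (0, Suc j) (fock_cauchy b m \<psi>) z = D_multi (0, j) (fock_cauchy b m (D2 \<psi>)) z
          + - (2 * of_real b * \<i>) * D_multi (0, j) (fock_cauchy b (Suc m) \<psi>) z"
        unfolding D_multi_Suc_right
        by (simp only: D_multi_add D_multi_cmult smooth_cmult smooth_fock_cauchy[OF b] \<psi> Dq_D2[OF \<psi>])
      show "Dq_seminorm b \<beta> (D2 \<psi>) = Dq_seminorm b (fst \<beta>, Suc (snd \<beta>)) \<psi>" for \<beta>
        by (simp add: Dq_seminorm_def D_multi_Suc_right)
    qed (auto intro: Suc.IH Dq_D2)
  qed (rule zero)
  have "P (i, j) m" for i j m
  proof (induction i arbitrary: m)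
    case (Suc i)
    show ?case
    proof (rule step[of "(i, j)" D1 "\<lambda>\<beta>. (Suc (fst \<beta>), snd \<beta>)" _ _ "2 * of_real b"])
      fix \<psi> z assume \<psi>: "\<psi> \<in> Dq_space b"
      have "D1 (fock_cauchy b m \<psi>) = (\<lambda>z. fock_cauchy b m (D1 \<psi>) z + 2 * of_real b * fock_cauchy b (Suc m) \<psi> z)"
        using has_partials_D1[OF has_partials_fock_cauchy[OF b \<psi>]] by auto
      then show "D_multi (Suc i, j) (fock_cauchy b m \<psi>) z = D_multi (i, j) (fock_cauchy b m (D1 \<psi>)) z
          + 2 * of_real b * D_multi (i, j) (fock_cauchy b (Suc m) \<psi>) z"
        unfolding D_multi_Suc_left[OF smooth_fock_cauchy[OF b \<psi>]]
        by (simp only: D_multi_add D_multi_cmult smooth_cmult smooth_fock_cauchy[OF b] \<psi> Dq_D1[OF \<psi>])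
      show "Dq_seminorm b \<beta> (D1 \<psi>) = Dq_seminorm b (Suc (fst \<beta>), snd \<beta>) \<psi>" for \<beta>
        by (simp add: Dq_seminorm_def D_multi_Suc_left[OF Dq_smooth[OF \<psi>]])
    qed (auto intro: Suc.IH Dq_D1)
  qed (rule right)
  from this[of "fst \<alpha>" "snd \<alpha>" m] show ?thesis
    by (simp add: P_def)
qed

text \<open>The bound by the weight of \<open>b\<close> becomes a little-o for the weight of \<open>q\<close> because \<open>b < q\<close>.\<close>

lemma fock_cauchy_in_Dq:
  assumes "0 < b" "b < q" and \<psi>: "\<psi> \<in> Dq_space b"
  shows "fock_cauchy b m \<psi> \<in> Dq_space q"
  by (rule Dq_spaceI[OF smooth_fock_cauchy[OF assms(1) \<psi>] assms(2)])
     (use norm_D_multi_fock_cauchy_le[OF assms(1)] \<psi> in blast)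

lemma continuous_map_fock_cauchy:
  assumes b: "0 < b" and bq: "b < q"
  shows "continuous_map (Dq_topology b) (Dq_topology q) (fock_cauchy b m)"
proof (rule continuous_map_Dq)
  fix \<alpha>
  obtain c B where c: "c \<ge> 0" "finite B" and le: "\<And>\<psi> z. \<psi> \<in> Dq_space b \<Longrightarrow>
      cmod (D_multi \<alpha> (fock_cauchy b m \<psi>) z) \<le> c * (\<Sum>\<beta>\<in>B. Dq_seminorm b \<beta> \<psi>) * exp (b * (cmod z)\<^sup>2)"
    using norm_D_multi_fock_cauchy_le[OF b, of \<alpha> m] by blast
  have "Dq_seminorm q \<alpha> (fock_cauchy b m \<psi>) \<le> c * (\<Sum>\<beta>\<in>B. Dq_seminorm b \<beta> \<psi>)" if \<psi>: "\<psi> \<in> Dq_space b" for \<psi>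
  proof (rule Dq_seminorm_le)
    fix z
    have "exp (b * (cmod z)\<^sup>2) \<le> exp (q * (cmod z)\<^sup>2)"
      using bq by (simp add: mult_right_mono)
    then have "c * (\<Sum>\<beta>\<in>B. Dq_seminorm b \<beta> \<psi>) * exp (b * (cmod z)\<^sup>2)
        \<le> c * (\<Sum>\<beta>\<in>B. Dq_seminorm b \<beta> \<psi>) * exp (q * (cmod z)\<^sup>2)"
      using c(1) by (intro mult_left_mono mult_nonneg_nonneg sum_nonneg Dq_seminorm_nonneg[OF \<psi>])
    with le[OF \<psi>, of z] show "cmod (D_multi \<alpha> (fock_cauchy b m \<psi>) z)
        \<le> c * (\<Sum>\<beta>\<in>B. Dq_seminorm b \<beta> \<psi>) * exp (q * (cmod z)\<^sup>2)"
      by linarith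
  qed
  with c(2) show "\<exists>C B. finite B \<and> (\<forall>\<psi>\<in>Dq_space b. Dq_seminorm q \<alpha> (fock_cauchy b m \<psi>)
      \<le> C * (\<Sum>\<beta>\<in>B. Dq_seminorm b \<beta> \<psi>))"
    by blast
qed (use assms in \<open>auto intro: fock_cauchy_in_Dq fock_cauchy_diff\<close>)

section \<open>The Cauchy-Pompeiu formula\<close>

lemma integral_derivative_eq_0:
  fixes f :: "real \<Rightarrow> complex"
  assumes "\<And>x. (f has_vector_derivative f' x) (at x)" "continuous_on UNIV f'" "integrable lborel f'"
    and "(f \<longlongrightarrow> 0) at_top" "(f \<longlongrightarrow> 0) at_bot"
  shows "(\<integral>x. f' x \<partial>lborel) = 0"
proof -
  have "(LBINT x=-\<infinity>..\<infinity>. f' x) = 0 - 0"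
  proof (rule interval_integral_FTC_integrable)
    show "isCont f' x" for x
      using assms(2) by (simp add: continuous_on_eq_continuous_at)
    show "set_integrable lborel (einterval (-\<infinity>) \<infinity>) f'"
      using assms(3) by (simp add: set_integrable_def)
  qed (use assms in \<open>auto simp: ereal_tendsto_simps1\<close>)
  then show ?thesis
    by (simp add: interval_lebesgue_integral_def set_lebesgue_integral_def)
qed

lemma filterlim_abs_at_bot: "filterlim (abs :: real \<Rightarrow> real) at_top at_bot"
  using filterlim_compose[OF filterlim_abs_real filterlim_uminus_at_top_at_bot] by simp

lemma tendsto_bounded_div_0:
  fixes f g :: "real \<Rightarrow> complex"
  assumes "\<And>x. cmod (f x) \<le> C" "\<And>x. \<bar>x\<bar> \<le> cmod (g x)" "filterlim abs at_top G"
  shows "((\<lambda>x. f x / g x) \<longlongrightarrow> 0) G"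
proof (rule Lim_null_comparison)
  have "\<forall>\<^sub>F x::real in G. \<bar>x\<bar> > 0"
    using assms(3) unfolding filterlim_at_top_dense by blast
  then show "\<forall>\<^sub>F x in G. norm (f x / g x) \<le> C / \<bar>x\<bar>"
  proof eventually_elim
    case (elim x)
    have "0 \<le> C" using assms(1)[of x] norm_ge_zero order_trans by blast
    then show ?case
      unfolding norm_divide using elim assms(1)[of x] assms(2)[of x] by (intro frac_le) auto
  qed
  show "((\<lambda>x. C / \<bar>x\<bar>) \<longlongrightarrow> 0) G"
    by (rule tendsto_divide_0[OF tendsto_const]) (rule filterlim_at_top_imp_at_infinity[OF assms(3)])
qed

lemma has_partials_div_id:
  assumes "has_partials F a b u" "u \<noteq> 0"
  shows "has_partials (\<lambda>u. F u / u) (a / u - F u / u\<^sup>2) (b / u - \<i> * F u / u\<^sup>2) u"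
proof -
  have "has_partials (\<lambda>u. inverse u) (- (inverse u ^ 2)) (\<i> * - (inverse u ^ 2)) u"
    unfolding has_partials_holomorphic_iff using assms(2)
    by (auto intro!: derivative_eq_intros simp: power2_eq_square)
  from has_partials_mult[OF assms(1) this] show ?thesis
    by (simp add: divide_inverse power_inverse algebra_simps)
qed

text \<open>If \<open>F 0 = 0\<close>, then \<open>H u = F u / u\<close> is bounded near \<open>0\<close> and its partial derivatives \<open>X\<close>, \<open>Y\<close> are
\<open>O (1 / |u|)\<close> there, hence integrable over the plane. Off the origin \<open>X + \<i> * Y = (A + \<i> * B) / u\<close>, because
\<open>1 / u\<close> is holomorphic. By Fubini's theorem \<open>X\<close> integrates to 0 along almost every
horizontal line, namely along those that miss the origin, and \<open>Y\<close> along almost every vertical one,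
by the fundamental theorem of calculus.\<close>

lemma integral_dbar_div_eq_0:
  fixes F A B :: "complex \<Rightarrow> complex"
  assumes part: "\<And>u. has_partials F (A u) (B u) u"
    and cont: "continuous_on UNIV A" "continuous_on UNIV B"
    and c: "0 < c"
    and F: "\<And>u. cmod (F u) \<le> C * exp (- c * (cmod u)\<^sup>2)"
    and A: "\<And>u. cmod (A u) \<le> C * exp (- c * (cmod u)\<^sup>2)"
    and B: "\<And>u. cmod (B u) \<le> C * exp (- c * (cmod u)\<^sup>2)"
    and F0: "F 0 = 0"
  shows "(\<integral>p. (A (plane p) + \<i> * B (plane p)) / plane p \<partial>lborel) = 0"
proof -
  define X where "X = (\<lambda>u. A u / u - F u / u\<^sup>2)"
  define Y where "Y = (\<lambda>u. B u / u - \<i> * F u / u\<^sup>2)"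
  have contF: "continuous_on UNIV F"
    using has_partials_differentiable[OF part]
    by (auto intro!: differentiable_imp_continuous_on simp: differentiable_on_def
          intro: differentiable_at_withinI)
  have C0: "0 \<le> C" using order_trans[OF norm_ge_zero F[of 0]] by simp
  have bound1: "cmod (F u) \<le> C" "cmod (A u) \<le> C" "cmod (B u) \<le> C" for u
  proof -
    have "C * exp (- c * (cmod u)\<^sup>2) \<le> C * 1"
      using C0 c by (intro mult_left_mono) auto
    then show "cmod (F u) \<le> C" "cmod (A u) \<le> C" "cmod (B u) \<le> C"
      using F[of u] A[of u] B[of u] by auto
  qed
  define K where "K = 2 * C * exp c"
  have F2: "cmod (F u / u\<^sup>2) \<le> K * (exp (- c * (cmod u)\<^sup>2) / cmod u)" for u
  proof (cases "cmod u \<le> 1")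
    case True
    have "cmod (F u) \<le> 2 * C * cmod u"
      using has_partials_lipschitz[of 0 F A B C u] part bound1 True F0 by auto
    then have "cmod (F u / u\<^sup>2) \<le> 2 * C / cmod u"
      by (cases "u = 0") (auto simp: norm_divide norm_mult power2_eq_square divide_simps)
    also have "\<dots> \<le> K * exp (- c * (cmod u)\<^sup>2) / cmod u"
    proof (rule divide_right_mono)
      have "c * (cmod u)\<^sup>2 \<le> c" using True c by (simp add: power_le_one)
      then have "1 \<le> exp c * exp (- c * (cmod u)\<^sup>2)" by (simp add: mult_exp_exp)
      then have "2 * C * 1 \<le> 2 * C * (exp c * exp (- c * (cmod u)\<^sup>2))"
        using C0 by (intro mult_left_mono) auto
      then show "2 * C \<le> K * exp (- c * (cmod u)\<^sup>2)" by (simp add: K_def)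
    qed simp
    finally show ?thesis by simp
  next
    case False
    have "1 \<le> exp c" using c by simp
    then have "1 \<le> 2 * exp c" by linarith
    then have "C * 1 \<le> C * (2 * exp c)" by (rule mult_left_mono) (rule C0)
    then have CK: "C \<le> K" by (simp add: K_def)
    have "cmod (F u / u\<^sup>2) = cmod (F u) / (cmod u)\<^sup>2" by (simp add: norm_divide norm_power)
    also have "\<dots> \<le> (K * exp (- c * (cmod u)\<^sup>2)) / cmod u"
    proof (rule frac_le)
      show "cmod (F u) \<le> K * exp (- c * (cmod u)\<^sup>2)"
        using F[of u] mult_right_mono[OF CK exp_ge_zero] by (rule order_trans)
      show "cmod u \<le> (cmod u)\<^sup>2"
        using False by (intro self_le_power) auto
      show "0 < cmod u" using False by linarith
    qed (use CK C0 in simp)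
    finally show ?thesis by simp
  qed
  have meas: "(\<lambda>p. f (plane p)) \<in> borel_measurable lborel" if "continuous_on UNIV f" for f :: "complex \<Rightarrow> complex"
    by (rule borel_measurable_compose_plane[OF that])
  have int: "integrable lborel (\<lambda>p. G (plane p) / plane p)" "integrable lborel (\<lambda>p. F (plane p) / (plane p)\<^sup>2)"
    if "continuous_on UNIV G" "\<And>u. cmod (G u) \<le> C * exp (- c * (cmod u)\<^sup>2)" for G
  proof -
    show "integrable lborel (\<lambda>p. G (plane p) / plane p)"
      using that(2)
      by (intro integrable_gaussian_bounded[OF _ c, where m = 0 and K = C] borel_measurable_divide meas that(1)
            borel_measurable_compose_plane[of "\<lambda>u. u"] continuous_intros)
         (auto simp: norm_divide intro: divide_right_mono)
    show "integrable lborel (\<lambda>p. F (plane p) / (plane p)\<^sup>2)"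
      using F2
      by (intro integrable_gaussian_bounded[OF _ c, where m = 0 and K = K] borel_measurable_divide meas contF
            borel_measurable_compose_plane[of "\<lambda>u. u^2"] continuous_intros) auto
  qed
  have intX: "integrable lborel (\<lambda>p. X (plane p))"
    unfolding X_def using int[OF cont(1) A] by simp
  have intY: "integrable lborel (\<lambda>p. Y (plane p))"
    unfolding Y_def times_divide_eq_right[symmetric]
    using int[OF cont(2) B] by (intro Bochner_Integration.integrable_diff integrable_mult_right)
  have "(\<integral>p. X (plane p) \<partial>lborel) = 0"
  proof -
    have i: "integrable (lborel \<Otimes>\<^sub>M lborel) (\<lambda>(x, y). X (Complex x y))"
      using intX by (simp add: lborel_prod case_prod_beta')
    have "AE y in lborel. y \<noteq> (0::real)" by (rule AE_lborel_singleton)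
    with lborel_pair.AE_integrable_snd[OF i]
    have "AE y in lborel. (\<integral>x. X (Complex x y) \<partial>lborel) = 0"
    proof eventually_elim
      case (elim y)
      have nz: "Complex x y \<noteq> 0" for x using elim by (simp add: complex_eq_iff)
      have le: "\<bar>x\<bar> \<le> cmod (Complex x y)" for x using abs_Re_le_cmod[of "Complex x y"] by simp
      show ?case
      proof (rule integral_derivative_eq_0)
        show "((\<lambda>x. F (Complex x y) / Complex x y) has_vector_derivative X (Complex x y)) (at x)" for x
          unfolding X_def by (rule has_partials_horizontal[OF has_partials_div_id[OF part nz]])
        show "continuous_on UNIV (\<lambda>x. X (Complex x y))"
          unfolding X_def Complex_eq using nz
          by (intro continuous_intros continuous_on_compose2[OF contF] continuous_on_compose2[OF cont(1)])
             (auto simp: Complex_eq)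
        show "((\<lambda>x. F (Complex x y) / Complex x y) \<longlongrightarrow> 0) at_top"
             "((\<lambda>x. F (Complex x y) / Complex x y) \<longlongrightarrow> 0) at_bot"
          using le by (auto intro!: tendsto_bounded_div_0[OF bound1(1)] filterlim_abs_real filterlim_abs_at_bot)
      qed (use elim in simp)
    qed
    then have "(\<integral>y. (\<integral>x. X (Complex x y) \<partial>lborel) \<partial>lborel) = 0"
      by (rule integral_eq_zero_AE)
    then show ?thesis
      using lborel_pair.integral_snd[OF i] by (simp add: lborel_prod case_prod_beta')
  qed
  moreover have "(\<integral>p. Y (plane p) \<partial>lborel) = 0"
  proof -
    have i: "integrable (lborel \<Otimes>\<^sub>M lborel) (\<lambda>(x, y). Y (Complex x y))"
      using intY by (simp add: lborel_prod case_prod_beta')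
    have "AE x in lborel. x \<noteq> (0::real)" by (rule AE_lborel_singleton)
    with lborel_pair.AE_integrable_fst[OF i]
    have "AE x in lborel. (\<integral>y. Y (Complex x y) \<partial>lborel) = 0"
    proof eventually_elim
      case (elim x)
      have nz: "Complex x y \<noteq> 0" for y using elim by (simp add: complex_eq_iff)
      have le: "\<bar>y\<bar> \<le> cmod (Complex x y)" for y using abs_Im_le_cmod[of "Complex x y"] by simp
      show ?case
      proof (rule integral_derivative_eq_0)
        show "((\<lambda>y. F (Complex x y) / Complex x y) has_vector_derivative Y (Complex x y)) (at y)" for y
          unfolding Y_def by (rule has_partials_vertical[OF has_partials_div_id[OF part nz]])
        show "continuous_on UNIV (\<lambda>y. Y (Complex x y))"
          unfolding Y_def Complex_eq using nz
          by (intro continuous_intros continuous_on_compose2[OF contF] continuous_on_compose2[OF cont(2)])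
             (auto simp: Complex_eq)
        show "((\<lambda>y. F (Complex x y) / Complex x y) \<longlongrightarrow> 0) at_top"
             "((\<lambda>y. F (Complex x y) / Complex x y) \<longlongrightarrow> 0) at_bot"
          using le by (auto intro!: tendsto_bounded_div_0[OF bound1(1)] filterlim_abs_real filterlim_abs_at_bot)
      qed (use elim in simp)
    qed
    then have "(\<integral>x. (\<integral>y. Y (Complex x y) \<partial>lborel) \<partial>lborel) = 0"
      by (rule integral_eq_zero_AE)
    then show ?thesis
      using lborel_pair.integral_fst[OF i] by (simp add: lborel_prod case_prod_beta')
  qed
  moreover have "(A u + \<i> * B u) / u = X u + \<i> * Y u" for u
    unfolding X_def Y_def by (simp add: algebra_simps add_divide_distrib)
  ultimately show ?thesis
    using intX intY by simp
qed

lemma has_partials_id: "has_partials (\<lambda>u. u) 1 \<i> u"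
  using has_partials_holomorphic_iff[of "\<lambda>u. u" 1 u] by simp

lemma exp_gaussian: "exp (- (u * cnj u)) = of_real (exp (- (cmod u)\<^sup>2))"
  by (simp add: complex_norm_square[symmetric] exp_of_real[symmetric])

lemma has_partials_gaussian:
  "has_partials (\<lambda>u. exp (- (u * cnj u))) (exp (- (u * cnj u)) * - (u + cnj u))
     (exp (- (u * cnj u)) * (\<i> * (u - cnj u))) u"
proof -
  have "has_partials (\<lambda>u. (-1) * (u * cnj u)) (- (u + cnj u)) (\<i> * (u - cnj u)) u"
    by (rule has_partials_eq[OF has_partials_cmult[OF has_partials_mult[OF has_partials_id has_partials_cnj]]])
       (simp_all add: algebra_simps)
  from has_partials_compose_holomorphic[OF this DERIV_exp] show ?thesis by simp
qed

text \<open>Subtracting \<open>F 0 * exp (- |u|^2)\<close> from \<open>F\<close> reduces to functions that vanish at the origin and keeps a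
Gaussian bound, with \<open>d\<close> at most 1/2 so that \<open>|u| * exp (- |u|^2)\<close> is covered too. For the Gaussian itself,
\<open>A + \<i> * B = - 2 * u * exp (- |u|^2)\<close>, so the singularity cancels and the
integral is a multiple of the Gaussian integral. The sum \<open>A + \<i> * B\<close> is twice the \<open>dbar\<close> derivative of \<open>F\<close>.\<close>

lemma cauchy_pompeiu:
  fixes F A B :: "complex \<Rightarrow> complex"
  assumes part: "\<And>u. has_partials F (A u) (B u) u"
    and cont: "continuous_on UNIV A" "continuous_on UNIV B"
    and c: "0 < c"
    and F: "\<And>u. cmod (F u) \<le> C * exp (- c * (cmod u)\<^sup>2)"
    and A: "\<And>u. cmod (A u) \<le> C * exp (- c * (cmod u)\<^sup>2)"
    and B: "\<And>u. cmod (B u) \<le> C * exp (- c * (cmod u)\<^sup>2)"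
  shows "(\<integral>p. (A (plane p) + \<i> * B (plane p)) / plane p \<partial>lborel) = - 2 * of_real pi * F 0"
proof -
  define g where "g = (\<lambda>u::complex. exp (- (u * cnj u)))"
  have cg: "cmod (g u) = exp (- (cmod u)\<^sup>2)" for u
    unfolding g_def exp_gaussian by simp
  define A' where "A' = (\<lambda>u. A u - F 0 * (g u * - (u + cnj u)))"
  define B' where "B' = (\<lambda>u. B u - F 0 * (g u * (\<i> * (u - cnj u))))"
  define d where "d = min c (1/2)"
  have d: "0 < d" "d \<le> c" "d \<le> 1/2" using c by (auto simp: d_def)
  obtain K where K: "0 < K" "\<And>r::real. 0 \<le> r \<Longrightarrow> r ^ 1 \<le> K * exp (1/2 * r\<^sup>2)"
    using power_le_exp_square[of "1/2" 1] by (metis half_gt_zero zero_less_one)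
  have C0: "0 \<le> C" using order_trans[OF norm_ge_zero F[of 0]] by simp
  define C' where "C' = C + cmod (F 0) * (1 + 2 * K)"
  have old: "C * exp (- c * (cmod u)\<^sup>2) \<le> C * exp (- d * (cmod u)\<^sup>2)" for u
    using C0 d by (intro mult_left_mono) (auto intro: mult_right_mono)
  have half: "exp (- (1/2) * (cmod u)\<^sup>2) \<le> exp (- d * (cmod u)\<^sup>2)" for u :: complex
    using mult_right_mono[OF d(3), of "(cmod u)\<^sup>2"] by simp
  have lin: "2 * cmod u * exp (- (cmod u)\<^sup>2) \<le> 2 * K * exp (- d * (cmod u)\<^sup>2)" for u :: complex
  proof -
    have "cmod u * exp (- (cmod u)\<^sup>2) \<le> K * exp (1/2 * (cmod u)\<^sup>2) * exp (- (cmod u)\<^sup>2)"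
      using K(2)[of "cmod u"] by (intro mult_right_mono) auto
    also have "\<dots> = K * exp (- (1/2) * (cmod u)\<^sup>2)" by (simp add: mult_exp_exp)
    also have "\<dots> \<le> K * exp (- d * (cmod u)\<^sup>2)" using half K(1) by (intro mult_left_mono) auto
    finally show ?thesis by simp
  qed
  have total: "cmod (f - F 0 * e) \<le> C' * exp (- d * (cmod u)\<^sup>2)"
    if "cmod f \<le> C * exp (- c * (cmod u)\<^sup>2)" "cmod e \<le> (1 + 2 * K) * exp (- d * (cmod u)\<^sup>2)" for f e u
  proof -
    have "cmod (F 0 * e) \<le> cmod (F 0) * ((1 + 2 * K) * exp (- d * (cmod u)\<^sup>2))"
      unfolding norm_mult using that(2) by (intro mult_left_mono) auto
    then have "cmod (f - F 0 * e) \<le> C * exp (- d * (cmod u)\<^sup>2) + cmod (F 0) * ((1 + 2 * K) * exp (- d * (cmod u)\<^sup>2))"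
      using norm_triangle_ineq4[of f "F 0 * e"] that(1) old[of u] by linarith
    then show ?thesis by (simp add: C'_def algebra_simps)
  qed
  have e1: "cmod (g u) \<le> (1 + 2 * K) * exp (- d * (cmod u)\<^sup>2)" for u
  proof -
    have "exp (- (cmod u)\<^sup>2) \<le> exp (- (1/2) * (cmod u)\<^sup>2)" by simp
    also note half[of u]
    also have "1 * exp (- d * (cmod u)\<^sup>2) \<le> (1 + 2 * K) * exp (- d * (cmod u)\<^sup>2)"
      using K(1) by (intro mult_right_mono) auto
    finally show ?thesis by (simp add: cg)
  qed
  have e2: "cmod (g u * v) \<le> (1 + 2 * K) * exp (- d * (cmod u)\<^sup>2)" if "cmod v \<le> 2 * cmod u" for u v
  proof -
    have "cmod (g u * v) \<le> exp (- (cmod u)\<^sup>2) * (2 * cmod u)"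
      unfolding norm_mult cg using that by (intro mult_left_mono) auto
    also have "\<dots> \<le> 2 * K * exp (- d * (cmod u)\<^sup>2)" using lin[of u] by (simp add: mult_ac)
    also have "\<dots> \<le> (1 + 2 * K) * exp (- d * (cmod u)\<^sup>2)" by (intro mult_right_mono) auto
    finally show ?thesis .
  qed
  have contg: "continuous_on UNIV g" unfolding g_def by (intro continuous_intros)
  have 0: "(\<integral>p. (A' (plane p) + \<i> * B' (plane p)) / plane p \<partial>lborel) = 0"
  proof (rule integral_dbar_div_eq_0[where F = "\<lambda>u. F u - F 0 * g u" and c = d and C = C'])
    show "has_partials (\<lambda>u. F u - F 0 * g u) (A' u) (B' u) u" for u
      unfolding A'_def B'_def g_def
      by (intro has_partials_diff part has_partials_cmult has_partials_gaussian)
    show "continuous_on UNIV A'" "continuous_on UNIV B'"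
      unfolding A'_def B'_def by (intro continuous_intros cont contg)+
    show "cmod (F u - F 0 * g u) \<le> C' * exp (- d * (cmod u)\<^sup>2)" for u
      by (rule total[OF F e1])
    have 2: "cmod (- (u + cnj u)) \<le> 2 * cmod u" "cmod (\<i> * (u - cnj u)) \<le> 2 * cmod u" for u
      using norm_triangle_ineq[of u "cnj u"] norm_triangle_ineq4[of u "cnj u"]
      by (simp_all only: norm_mult norm_minus_cancel norm_ii complex_mod_cnj mult_1)
    show "cmod (A' u) \<le> C' * exp (- d * (cmod u)\<^sup>2)" "cmod (B' u) \<le> C' * exp (- d * (cmod u)\<^sup>2)" for u
      unfolding A'_def B'_def by (rule total[OF A e2[OF 2(1)]], rule total[OF B e2[OF 2(2)]])
  qed (use d in \<open>auto simp: g_def\<close>)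
  have int: "integrable lborel (\<lambda>p. (A (plane p) + \<i> * B (plane p)) / plane p)"
  proof (rule integrable_gaussian_bounded[OF _ c, where m = 0 and K = "2 * C"])
    show "(\<lambda>p. (A (plane p) + \<i> * B (plane p)) / plane p) \<in> borel_measurable lborel"
      by (intro borel_measurable_divide borel_measurable_compose_plane[of "\<lambda>u. A u + \<i> * B u"]
            borel_measurable_compose_plane[of "\<lambda>u. u"] continuous_intros cont)
    fix p
    have "cmod (A (plane p) + \<i> * B (plane p)) \<le> 2 * C * exp (- c * (cmod (plane p))\<^sup>2)"
      using norm_triangle_ineq[of "A (plane p)" "\<i> * B (plane p)"] A[of "plane p"] B[of "plane p"]
      by (simp add: norm_mult)
    then have "cmod (A (plane p) + \<i> * B (plane p)) / cmod (plane p)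
        \<le> 2 * C * exp (- c * (cmod (plane p))\<^sup>2) / cmod (plane p)"
      by (rule divide_right_mono) simp
    then show "cmod ((A (plane p) + \<i> * B (plane p)) / plane p)
        \<le> 2 * C * (cmod (plane p) ^ 0 * exp (- c * (cmod (plane p))\<^sup>2) / cmod (plane p))"
      by (simp add: norm_divide)
  qed
  have intg: "integrable lborel (\<lambda>p. g (plane p))"
    and valg: "(\<integral>p. g (plane p) \<partial>lborel) = of_real pi"
    unfolding g_def exp_gaussian using integral_gaussian_plane by simp_all
  have eq: "(A' u + \<i> * B' u) / u = (A u + \<i> * B u) / u + 2 * F 0 * g u" if "u \<noteq> 0" for u
  proof -
    have "A' u + \<i> * B' u = A u + \<i> * B u + 2 * F 0 * g u * u"
      unfolding A'_def B'_def by (simp add: algebra_simps)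
    then show ?thesis using that by (simp add: add_divide_distrib)
  qed
  have "(\<integral>p. (A' (plane p) + \<i> * B' (plane p)) / plane p \<partial>lborel)
      = (\<integral>p. (A (plane p) + \<i> * B (plane p)) / plane p + 2 * F 0 * g (plane p) \<partial>lborel)"
  proof (rule integral_cong_AE)
    show "AE p in lborel. (A' (plane p) + \<i> * B' (plane p)) / plane p
        = (A (plane p) + \<i> * B (plane p)) / plane p + 2 * F 0 * g (plane p)"
      using AE_lborel_coordinates_nonzero
    proof eventually_elim
      case (elim p)
      then show ?case by (intro eq) (simp add: complex_eq_iff)
    qed
    show "(\<lambda>p. (A' (plane p) + \<i> * B' (plane p)) / plane p) \<in> borel_measurable lborel"
      unfolding A'_def B'_def
      by (intro borel_measurable_divide
            borel_measurable_compose_plane[of "\<lambda>u. A u - F 0 * (g u * - (u + cnj u)) + \<i> * (B u - F 0 * (g u * (\<i> * (u - cnj u))))"]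
            borel_measurable_compose_plane[of "\<lambda>u. u"] continuous_intros cont contg)
    show "(\<lambda>p. (A (plane p) + \<i> * B (plane p)) / plane p + 2 * F 0 * g (plane p)) \<in> borel_measurable lborel"
      using int intg by (intro borel_measurable_integrable) auto
  qed
  also have "\<dots> = (\<integral>p. (A (plane p) + \<i> * B (plane p)) / plane p \<partial>lborel) + 2 * F 0 * of_real pi"
    using int intg valg by simp
  finally show ?thesis
    unfolding 0 by (simp add: algebra_simps eq_neg_iff_add_eq_0)
qed

text \<open>For fixed \<open>z\<close> let \<open>F u = \<psi> (z - u) * exp (2 * b * u * cnj (z - u))\<close>. The dependence on \<open>z\<close> is
through \<open>z - u\<close> and, apart from this, \<open>F\<close> is holomorphic in \<open>u\<close>; so the \<open>dbar\<close> derivative in \<open>z\<close> is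
minus the one in \<open>u\<close>, and the Cauchy-Pompeiu formula evaluates the integral as a multiple of
\<open>F 0 = \<psi> z\<close>. The bounds before it verify its hypotheses with \<open>c = b / 2\<close>; half of the exponent
absorbs the linear factors that come from differentiating the exponential.\<close>

lemma dbar_fock_cauchy:
  assumes b: "0 < b" and \<psi>: "\<psi> \<in> Dq_space b"
  shows "dbar (fock_cauchy b 0 \<psi>) z = of_real pi * \<psi> z"
proof -
  define e where "e = (\<lambda>u. exp (2 * of_real b * u * cnj (z - u)))"
  define F where "F = (\<lambda>u. \<psi> (z - u) * e u)"
  define A where "A = (\<lambda>u. \<psi> (z - u) * (e u * (2 * of_real b * (cnj (z - u) - u))) + - D1 \<psi> (z - u) * e u)"
  define B where "B = (\<lambda>u. \<psi> (z - u) * (e u * (2 * of_real b * \<i> * (cnj (z - u) + u))) + - D2 \<psi> (z - u) * e u)"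
  have part: "has_partials F (A u) (B u) u" for u
  proof -
    have 1: "has_partials (\<lambda>u. \<psi> ((-1) * u + z)) ((-1) * D1 \<psi> (z - u)) ((-1) * D2 \<psi> (z - u)) u"
      by (rule has_partials_chain_affine) (use smooth_has_partials[OF Dq_smooth[OF \<psi>], of "z - u"] in auto)
    have 2: "has_partials (\<lambda>u. 2 * of_real b * (u * (cnj z - cnj u)))
        (2 * of_real b * (cnj (z - u) - u)) (2 * of_real b * \<i> * (cnj (z - u) + u)) u"
      by (rule has_partials_eq[OF has_partials_cmult[OF has_partials_mult[OF has_partials_id
              has_partials_diff[OF has_partials_const has_partials_cnj]]]])
         (simp_all add: algebra_simps)
    from has_partials_mult[OF 1 has_partials_compose_holomorphic[OF 2 DERIV_exp]] show ?thesis
      by (simp add: F_def A_def B_def e_def mult.assoc)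
  qed
  have conte: "continuous_on UNIV e" unfolding e_def by (intro continuous_intros)
  have cont: "continuous_on UNIV A" "continuous_on UNIV B"
    unfolding A_def B_def using Dq_smooth[OF \<psi>]
    by (intro continuous_intros conte
        continuous_on_compose2[OF smooth_continuous[of \<psi> UNIV]]
        continuous_on_compose2[OF smooth_continuous[OF smooth_D1, of \<psi> UNIV]]
        continuous_on_compose2[OF smooth_continuous[OF smooth_D2, of \<psi> UNIV]]; simp)+
  define E where "E = exp (b * (cmod z)\<^sup>2)"
  have E: "0 < E" by (simp add: E_def)
  have gr: "cmod (\<phi> (z - u) * e u) \<le> Dq_seminorm b (0,0) \<phi> * E * exp (- b * (cmod u)\<^sup>2)"
    if "\<phi> \<in> Dq_space b" for \<phi> u
  proof -
    have "cmod (\<phi> (z - u) * e u) = cmod (\<phi> (z - u)) * (E * exp (- b * (cmod u)\<^sup>2) * exp (- b * (cmod (z - u))\<^sup>2))"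
      unfolding norm_mult e_def norm_exp_fock E_def ..
    also have "\<dots> \<le> Dq_seminorm b (0,0) \<phi> * exp (b * (cmod (z - u))\<^sup>2) * (E * exp (- b * (cmod u)\<^sup>2) * exp (- b * (cmod (z - u))\<^sup>2))"
      using E by (intro mult_right_mono Dq_growth[OF that]) auto
    also have "\<dots> = Dq_seminorm b (0,0) \<phi> * E * exp (- b * (cmod u)\<^sup>2)"
      by (simp add: exp_minus)
    finally show ?thesis .
  qed
  obtain K where K: "0 < K" "\<And>r. 0 \<le> r \<Longrightarrow> r ^ 1 \<le> K * exp (b/2 * r\<^sup>2)"
    using power_le_exp_square[of "b/2" 1] b by auto
  define N where "N = Dq_seminorm b (0,0) \<psi> + Dq_seminorm b (0,0) (D1 \<psi>) + Dq_seminorm b (0,0) (D2 \<psi>)"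
  have N: "0 \<le> N" "Dq_seminorm b (0,0) \<psi> \<le> N" "Dq_seminorm b (0,0) (D1 \<psi>) \<le> N" "Dq_seminorm b (0,0) (D2 \<psi>) \<le> N"
    using Dq_seminorm_nonneg[OF \<psi>, of "(0,0)"] Dq_seminorm_nonneg[OF Dq_D1[OF \<psi>], of "(0,0)"]
      Dq_seminorm_nonneg[OF Dq_D2[OF \<psi>], of "(0,0)"] by (auto simp: N_def)
  have le1: "cmod (\<phi> (z - u) * e u) \<le> N * E * exp (- (b/2) * (cmod u)\<^sup>2)"
    if "\<phi> \<in> Dq_space b" "Dq_seminorm b (0,0) \<phi> \<le> N" for \<phi> u
  proof -
    have "exp (- b * (cmod u)\<^sup>2) \<le> exp (- (b/2) * (cmod u)\<^sup>2)"
      using b by simp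
    then have "Dq_seminorm b (0,0) \<phi> * E * exp (- b * (cmod u)\<^sup>2) \<le> N * E * exp (- (b/2) * (cmod u)\<^sup>2)"
      using that(2) N(1) E by (intro mult_mono) auto
    then show ?thesis using gr[OF that(1), of u] by linarith
  qed
  have le2: "cmod (\<psi> (z - u) * (e u * v)) \<le> N * E * (2 * b * (cmod z + 2 * K)) * exp (- (b/2) * (cmod u)\<^sup>2)"
    if v: "cmod v \<le> 2 * b * (cmod z + 2 * cmod u)" for u v
  proof -
    have u: "cmod z + 2 * cmod u \<le> (cmod z + 2 * K) * exp (b/2 * (cmod u)\<^sup>2)"
    proof -
      have "cmod z * 1 \<le> cmod z * exp (b/2 * (cmod u)\<^sup>2)"
        using b by (intro mult_left_mono) auto
      then show ?thesis using K(2)[of "cmod u"] by (simp add: algebra_simps)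
    qed
    have "cmod (\<psi> (z - u) * (e u * v)) = cmod (\<psi> (z - u) * e u) * cmod v"
      by (simp add: norm_mult)
    also have "\<dots> \<le> (N * E * exp (- b * (cmod u)\<^sup>2)) * (2 * b * ((cmod z + 2 * K) * exp (b/2 * (cmod u)\<^sup>2)))"
    proof (rule mult_mono)
      have "Dq_seminorm b (0,0) \<psi> * E * exp (- b * (cmod u)\<^sup>2) \<le> N * E * exp (- b * (cmod u)\<^sup>2)"
        using N E by (intro mult_right_mono) auto
      then show "cmod (\<psi> (z - u) * e u) \<le> N * E * exp (- b * (cmod u)\<^sup>2)"
        using gr[OF \<psi>, of u] by linarith
      have "2 * b * (cmod z + 2 * cmod u) \<le> 2 * b * ((cmod z + 2 * K) * exp (b/2 * (cmod u)\<^sup>2))"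
        using u b by (intro mult_left_mono) auto
      with v show "cmod v \<le> 2 * b * ((cmod z + 2 * K) * exp (b/2 * (cmod u)\<^sup>2))"
        by linarith
    qed (use N E in auto)
    also have "\<dots> = N * E * (2 * b * (cmod z + 2 * K)) * (exp (- b * (cmod u)\<^sup>2) * exp (b/2 * (cmod u)\<^sup>2))"
      by (simp only: mult_ac)
    also have "exp (- b * (cmod u)\<^sup>2) * exp (b/2 * (cmod u)\<^sup>2) = exp (- (b/2) * (cmod u)\<^sup>2)"
      by (simp add: mult_exp_exp)
    finally show ?thesis .
  qed
  define C where "C = N * E * (2 * b * (cmod z + 2 * K)) + N * E"
  have le3: "cmod (\<psi> (z - u) * (e u * v) + - \<phi> (z - u) * e u) \<le> C * exp (- (b/2) * (cmod u)\<^sup>2)"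
    if "cmod v \<le> 2 * b * (cmod z + 2 * cmod u)" "\<phi> \<in> Dq_space b" "Dq_seminorm b (0,0) \<phi> \<le> N" for v \<phi> u
  proof -
    have "cmod (- \<phi> (z - u) * e u) \<le> N * E * exp (- (b/2) * (cmod u)\<^sup>2)"
      using le1[OF that(2,3), of u] by simp
    from norm_triangle_mono[OF le2[OF that(1)] this] show ?thesis
      by (simp add: C_def algebra_simps)
  qed
  have tri: "cmod (cnj (z - u) - u) \<le> cmod z + 2 * cmod u" "cmod (cnj (z - u) + u) \<le> cmod z + 2 * cmod u" for u
    using norm_triangle_ineq4[of "cnj (z - u)" u] norm_triangle_ineq[of "cnj (z - u)" u] norm_triangle_ineq4[of z u]
    unfolding complex_mod_cnj by linarith+
  have "(\<integral>p. (A (plane p) + \<i> * B (plane p)) / plane p \<partial>lborel) = - 2 * of_real pi * F 0"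
  proof (rule cauchy_pompeiu[OF part cont, where c = "b/2" and C = C])
    show "cmod (A u) \<le> C * exp (- (b/2) * (cmod u)\<^sup>2)" for u
      unfolding A_def by (rule le3[OF _ Dq_D1[OF \<psi>] N(3)]) (use tri[of u] b in \<open>auto simp: norm_mult\<close>)
    show "cmod (B u) \<le> C * exp (- (b/2) * (cmod u)\<^sup>2)" for u
      unfolding B_def by (rule le3[OF _ Dq_D2[OF \<psi>] N(4)]) (use tri[of u] b in \<open>auto simp: norm_mult\<close>)
    show "cmod (F u) \<le> C * exp (- (b/2) * (cmod u)\<^sup>2)" for u
    proof -
      have "N * E \<le> C" using N E b K by (auto simp: C_def)
      then have "N * E * exp (- (b/2) * (cmod u)\<^sup>2) \<le> C * exp (- (b/2) * (cmod u)\<^sup>2)"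
        by (intro mult_right_mono) auto
      with le1[OF \<psi> N(2), of u] show ?thesis unfolding F_def by (rule order_trans)
    qed
  qed (use b in auto)
  also have "(\<integral>p. (A (plane p) + \<i> * B (plane p)) / plane p \<partial>lborel)
      = (\<integral>p. - (fock_cauchy_integrand b 0 (D1 \<psi>) z (plane p) + \<i> * fock_cauchy_integrand b 0 (D2 \<psi>) z (plane p)
           + 4 * of_real b * fock_cauchy_integrand b 1 \<psi> z (plane p)) \<partial>lborel)"
  proof (rule Bochner_Integration.integral_cong[OF refl])
    fix p
    show "(A (plane p) + \<i> * B (plane p)) / plane p
      = - (fock_cauchy_integrand b 0 (D1 \<psi>) z (plane p) + \<i> * fock_cauchy_integrand b 0 (D2 \<psi>) z (plane p)
           + 4 * of_real b * fock_cauchy_integrand b 1 \<psi> z (plane p))"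
    proof -
      have "A u + \<i> * B u = - (D1 \<psi> (z - u) * e u + \<i> * (D2 \<psi> (z - u) * e u) + 4 * of_real b * (\<psi> (z - u) * u * e u))" for u
        unfolding A_def B_def by (simp add: algebra_simps)
      then show ?thesis
        unfolding fock_cauchy_integrand_def
        by (simp only: e_def power_0 power_one_right mult_1_right add_divide_distrib minus_divide_left[symmetric]
              times_divide_eq_right)
    qed
  qed
  also have "\<dots> = - (fock_cauchy b 0 (D1 \<psi>) z + \<i> * fock_cauchy b 0 (D2 \<psi>) z + 4 * of_real b * fock_cauchy b 1 \<psi> z)"
    unfolding fock_cauchy_def
    using integrable_fock_cauchy[OF b \<psi>] integrable_fock_cauchy[OF b Dq_D1[OF \<psi>]] integrable_fock_cauchy[OF b Dq_D2[OF \<psi>]]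
    by simp
  also have "- 2 * of_real pi * F 0 = - (2 * of_real pi * \<psi> z)"
    by (simp add: F_def e_def)
  finally have *: "fock_cauchy b 0 (D1 \<psi>) z + \<i> * fock_cauchy b 0 (D2 \<psi>) z + 4 * of_real b * fock_cauchy b 1 \<psi> z
      = 2 * of_real pi * \<psi> z"
    unfolding neg_equal_iff_equal .
  have "D1 (fock_cauchy b 0 \<psi>) z + \<i> * D2 (fock_cauchy b 0 \<psi>) z
      = fock_cauchy b 0 (D1 \<psi>) z + \<i> * fock_cauchy b 0 (D2 \<psi>) z + 4 * of_real b * fock_cauchy b 1 \<psi> z"
    unfolding has_partials_D1[OF has_partials_fock_cauchy[OF b \<psi>]] has_partials_D2[OF has_partials_fock_cauchy[OF b \<psi>]]
    by (simp add: algebra_simps)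
  then show ?thesis
    unfolding dbar_def * by simp
qed

section \<open>Entire functions are limits of their Taylor polynomials\<close>

lemma entire_has_partials:
  assumes "f holomorphic_on UNIV"
  shows "has_partials f (deriv f z) (\<i> * deriv f z) z"
  unfolding has_partials_holomorphic_iff
  using assms by (rule holomorphic_derivI) auto

lemma entire_D1: "f holomorphic_on UNIV \<Longrightarrow> D1 f = deriv f"
  and entire_D2: "f holomorphic_on UNIV \<Longrightarrow> D2 f = (\<lambda>z. \<i> * deriv f z)"
  using has_partials_D1[OF entire_has_partials] has_partials_D2[OF entire_has_partials] by blast+

lemma smooth_entire:
  assumes "f holomorphic_on UNIV"
  shows "smooth f"
proof -
  have "C_k k f" if "f holomorphic_on UNIV" for k f
    using that
  proof (induction k arbitrary: f)
    case 0
    then show ?case by (simp add: holomorphic_on_imp_continuous_on)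
  next
    case (Suc k)
    then show ?case
      by (intro C_k_SucI[OF entire_has_partials] C_k_cmult Suc.IH holomorphic_deriv) auto
  qed
  with assms show ?thesis by (simp add: smooth_def)
qed

lemma D_multi_entire:
  assumes f: "f holomorphic_on UNIV"
  shows "D_multi (i, j) f = (\<lambda>z. \<i> ^ j * (deriv ^^ (i + j)) f z)"
proof -
  have hol: "(deriv ^^ n) f holomorphic_on UNIV" for n
    by (rule holomorphic_higher_deriv[OF f]) auto
  have diff: "(deriv ^^ n) f field_differentiable at z" for n z
    using hol by (auto simp: holomorphic_on_def)
  have 2: "(D2 ^^ n) f = (\<lambda>z. \<i> ^ n * (deriv ^^ n) f z)" for n
  proof (induction n)
    case (Suc n)
    show ?case
      using D2_cmult[OF smooth_entire[OF hol[of n]], of "\<i> ^ n"] entire_D2[OF hol[of n]]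
      by (simp add: Suc.IH mult_ac)
  qed simp
  have "(D1 ^^ m) (\<lambda>z. \<i> ^ n * (deriv ^^ n) f z) = (\<lambda>z. \<i> ^ n * (deriv ^^ (m + n)) f z)" for m n
  proof (induction m)
    case (Suc m)
    show ?case
      using D1_cmult[OF smooth_entire[OF hol[of "m + n"]], of "\<i> ^ n"] entire_D1[OF hol[of "m + n"]]
      by (simp add: Suc.IH)
  qed simp
  with 2 show ?thesis by (simp add: D_multi_def)
qed

text \<open>Cauchy's estimate on the unit circle around \<open>z\<close>: the shift from \<open>|z|\<close> to \<open>|z| + 1\<close> in the weight
costs only a constant when the parameter is raised, since
\<open>b * (r + 1)^2 \<le> e + b' * r^2\<close> by completing the square.\<close>

lemma entire_D_multi_bound:
  fixes b b' :: real
  assumes b: "0 < b" "b < b'"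
  shows "\<exists>K. \<forall>f C. f holomorphic_on UNIV \<longrightarrow> (\<forall>w. cmod (f w) \<le> C * exp (b * (cmod w)\<^sup>2)) \<longrightarrow>
    (\<forall>z. cmod (D_multi \<alpha> f z) \<le> K * C * exp (b' * (cmod z)\<^sup>2))"
proof -
  obtain i j where \<alpha>: "\<alpha> = (i, j)" by (cases \<alpha>)
  define n where "n = i + j"
  define e where "e = b + b\<^sup>2 / (b' - b)"
  have "cmod (D_multi \<alpha> f z) \<le> (fact n * exp e) * C * exp (b' * (cmod z)\<^sup>2)"
    if f: "f holomorphic_on UNIV" and C: "\<And>w. cmod (f w) \<le> C * exp (b * (cmod w)\<^sup>2)" for f C z
  proof -
    have C0: "0 \<le> C" using order_trans[OF norm_ge_zero C[of 0]] by simp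
    define B where "B = C * exp (b * (cmod z + 1)\<^sup>2)"
    have "cmod ((deriv ^^ n) f z) \<le> fact n * B / 1 ^ n"
    proof (rule Cauchy_inequality)
      show "f holomorphic_on ball z 1" by (rule holomorphic_on_subset[OF f]) auto
      show "continuous_on (cball z 1) f"
        by (rule holomorphic_on_imp_continuous_on[OF holomorphic_on_subset[OF f]]) auto
      fix x assume x: "cmod (z - x) = 1"
      have "cmod x \<le> cmod z + 1" using norm_triangle_ineq2[of x z] x by (simp add: norm_minus_commute)
      then have "exp (b * (cmod x)\<^sup>2) \<le> exp (b * (cmod z + 1)\<^sup>2)"
        using b by (simp add: power_mono)
      then have "C * exp (b * (cmod x)\<^sup>2) \<le> B"
        unfolding B_def using C0 by (intro mult_left_mono)
      with C[of x] show "cmod (f x) \<le> B" by linarith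
    qed simp
    moreover have "B \<le> C * (exp e * exp (b' * (cmod z)\<^sup>2))"
    proof -
      define r where "r = cmod z"
      have "0 \<le> ((b' - b) * r - b)\<^sup>2 / (b' - b)" using b by simp
      also have "\<dots> = (b' - b) * r\<^sup>2 - 2 * b * r + b\<^sup>2 / (b' - b)"
        using b by (simp add: power2_eq_square field_simps)
      finally have "b * (r + 1)\<^sup>2 \<le> e + b' * r\<^sup>2"
        by (simp add: e_def power2_eq_square algebra_simps)
      then show ?thesis
        unfolding B_def using C0 by (intro mult_left_mono) (auto simp: exp_add[symmetric] r_def)
    qed
    ultimately have "cmod ((deriv ^^ n) f z) \<le> fact n * (C * (exp e * exp (b' * (cmod z)\<^sup>2)))"
      by (smt (verit) divide_self_if fact_ge_zero mult_left_mono power_one div_by_1)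
    then show ?thesis
      unfolding \<alpha> D_multi_entire[OF f] by (simp add: norm_mult norm_power n_def mult_ac)
  qed
  then show ?thesis by blast
qed

lemma entire_in_Dq:
  assumes "0 < b" "b < q" "f holomorphic_on UNIV" "\<And>w. cmod (f w) \<le> C * exp (b * (cmod w)\<^sup>2)"
  shows "f \<in> Dq_space q"
proof (rule Dq_spaceI)
  show "smooth f" by (rule smooth_entire) fact
  show "(b + q) / 2 < q" using assms by simp
  fix \<alpha>
  have "b < (b + q) / 2" using assms by simp
  from entire_D_multi_bound[OF assms(1) this, of \<alpha>] assms(3,4)
  show "\<exists>C. \<forall>z. cmod (D_multi \<alpha> f z) \<le> C * exp ((b + q) / 2 * (cmod z)\<^sup>2)"
    by blast
qed

lemma power_growth:
  fixes b :: real
  assumes "0 < b"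
  obtains K where "0 < K" "\<And>z. cmod (z ^ k) \<le> K * exp (b * (cmod z)\<^sup>2)"
  using power_le_exp_square[OF assms, of k] by (metis norm_ge_zero norm_power)

lemma power_in_Dq:
  assumes "0 < q"
  shows "(\<lambda>z. z ^ k) \<in> Dq_space q"
proof -
  obtain K where "\<And>z. cmod (z ^ k) \<le> K * exp (q / 2 * (cmod z)\<^sup>2)"
    using power_growth[of "q/2" k] assms by auto
  then show ?thesis
    by (intro entire_in_Dq[of "q/2"]) (use assms in \<open>auto intro: holomorphic_intros\<close>)
qed

lemma Dq_dual_add: "h \<in> Dq_dual q \<Longrightarrow> f \<in> Dq_space q \<Longrightarrow> g \<in> Dq_space q \<Longrightarrow> h (\<lambda>z. f z + g z) = h f + h g"
  and Dq_dual_cmult: "h \<in> Dq_dual q \<Longrightarrow> f \<in> Dq_space q \<Longrightarrow> h (\<lambda>z. c * f z) = c * h f"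
  by (auto simp: Dq_dual_def)

lemma Dq_dual_zero: "h \<in> Dq_dual q \<Longrightarrow> h (\<lambda>z. 0) = 0"
  using Dq_dual_cmult[OF _ Dq_zero, of h q 0] by simp

lemma Dq_dual_polynomial:
  assumes h: "h \<in> Dq_dual q" and q: "0 < q" and moments: "\<And>k. h (\<lambda>z. z ^ k) = 0"
  shows "(\<lambda>z. \<Sum>k<n. a k * z ^ k) \<in> Dq_space q \<and> h (\<lambda>z. \<Sum>k<n. a k * z ^ k) = 0"
proof (induction n)
  case 0
  show ?case using Dq_zero Dq_dual_zero[OF h] by simp
next
  case (Suc n)
  have *: "(\<lambda>z. a n * z ^ n) \<in> Dq_space q" by (rule Dq_cmult[OF power_in_Dq[OF q]])
  show ?case
    using Suc.IH Dq_add[OF _ *] Dq_dual_add[OF h _ *] Dq_dual_cmult[OF h power_in_Dq[OF q]] moments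
    by simp
qed

text \<open>Cauchy's estimate for the k-th Taylor coefficient on the circle of radius \<open>|z| / \<mu>\<close>, depending on \<open>z\<close>, gives
\<open>|a k * z ^ k| \<le> C * \<mu> ^ k * exp (b * |z|^2 / \<mu>^2)\<close>. With \<open>\<mu>^2 = b / m\<close> the weight is the one for \<open>m\<close>, and
the series is dominated by a geometric one.\<close>

lemma entire_tail_bound:
  fixes b m :: real
  assumes b: "0 < b" "b < m" and f: "f holomorphic_on UNIV"
    and C: "\<And>w. cmod (f w) \<le> C * exp (b * (cmod w)\<^sup>2)"
  shows "cmod (f z - (\<Sum>k<n. (deriv ^^ k) f 0 / fact k * z ^ k))
    \<le> C * sqrt (b / m) ^ n / (1 - sqrt (b / m)) * exp (m * (cmod z)\<^sup>2)"
proof -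
  define \<mu> where "\<mu> = sqrt (b / m)"
  define a where "a = (\<lambda>k. (deriv ^^ k) f 0 / fact k)"
  define E where "E = C * exp (m * (cmod z)\<^sup>2)"
  have C0: "0 \<le> C" using order_trans[OF norm_ge_zero C[of 0]] by simp
  have \<mu>: "0 < \<mu>" "\<mu> < 1" "\<mu>\<^sup>2 = b / m" using b by (auto simp: \<mu>_def)
  have sums: "(\<lambda>k. a k * z ^ k) sums f z"
    using holomorphic_power_series[of f 0 "cmod z + 1" z] holomorphic_on_subset[OF f]
    by (simp add: a_def)
  have coeff: "cmod (a k) * r ^ k \<le> C * exp (b * r\<^sup>2)" if "0 < r" for k r
  proof -
    have "cmod ((deriv ^^ k) f 0) \<le> fact k * (C * exp (b * r\<^sup>2)) / r ^ k"
    proof (rule Cauchy_inequality)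
      show "f holomorphic_on ball 0 r" by (rule holomorphic_on_subset[OF f]) auto
      show "continuous_on (cball 0 r) f"
        by (rule holomorphic_on_imp_continuous_on[OF holomorphic_on_subset[OF f]]) auto
    qed (use that C in auto)
    then show ?thesis
      using that by (simp add: a_def norm_divide field_simps)
  qed
  have summand: "cmod (a k * z ^ k) \<le> E * \<mu> ^ k" for k
  proof (cases "z = 0")
    case True
    then show ?thesis
      using C[of 0] C0 \<mu> by (cases k) (auto simp: a_def E_def)
  next
    case False
    define r where "r = cmod z / \<mu>"
    have r: "0 < r" using False \<mu> by (simp add: r_def)
    have "cmod (a k * z ^ k) = (cmod (a k) * r ^ k) * \<mu> ^ k"
      using \<mu> by (simp add: r_def norm_mult norm_power power_divide)
    also have "\<dots> \<le> (C * exp (b * r\<^sup>2)) * \<mu> ^ k"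
      using \<mu> by (intro mult_right_mono coeff r) auto
    also have "b * r\<^sup>2 = m * (cmod z)\<^sup>2"
      using b by (simp add: r_def power_divide \<mu>(3))
    finally show ?thesis by (simp add: E_def)
  qed
  have "f z - (\<Sum>k<n. a k * z ^ k) = (\<Sum>k. a (k + n) * z ^ (k + n))"
    using suminf_minus_initial_segment[OF sums_summable[OF sums], of n] sums_unique[OF sums] by simp
  also have "cmod \<dots> \<le> (\<Sum>k. E * \<mu> ^ n * \<mu> ^ k)"
  proof (rule norm_suminf_le)
    show "norm (a (k + n) * z ^ (k + n)) \<le> E * \<mu> ^ n * \<mu> ^ k" for k
      using summand[of "k + n"] by (simp add: power_add mult_ac)
    show "summable (\<lambda>k. E * \<mu> ^ n * \<mu> ^ k)"
      using \<mu> by (intro summable_mult summable_geometric) auto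
  qed
  also have "\<dots> = E * \<mu> ^ n * (1 / (1 - \<mu>))"
    using \<mu> by (subst suminf_mult) (auto intro: summable_geometric simp: suminf_geometric)
  finally show ?thesis
    by (simp add: a_def E_def \<mu>_def mult_ac)
qed

text \<open>The Taylor polynomials converge to \<open>f\<close> in the space: the parameter \<open>m\<close> between \<open>b\<close> and \<open>q\<close> leaves room
first for the tail estimate and then for passing from values to derivatives.\<close>

lemma Dq_dual_entire_eq_0:
  assumes h: "h \<in> Dq_dual q" and moments: "\<And>k. h (\<lambda>z. z ^ k) = 0"
    and b: "0 < b" "b < q" and f: "f holomorphic_on UNIV"
    and C: "\<And>w. cmod (f w) \<le> C * exp (b * (cmod w)\<^sup>2)"
  shows "h f = 0"
proof -
  have q: "0 < q" using b by simp
  define m where "m = (b + q) / 2"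
  have m: "0 < m" "b < m" "m < q" using b by (auto simp: m_def)
  define S where "S = (\<lambda>n z. \<Sum>k<n. (deriv ^^ k) f 0 / fact k * z ^ k)"
  define \<mu> where "\<mu> = sqrt (b / m)"
  have \<mu>: "0 < \<mu>" "\<mu> < 1" using b m by (auto simp: \<mu>_def)
  have fD: "f \<in> Dq_space q" by (rule entire_in_Dq[OF b f C])
  have S: "S n \<in> Dq_space q" "h (S n) = 0" for n
    using Dq_dual_polynomial[OF h q moments, of "\<lambda>k. (deriv ^^ k) f 0 / fact k" n]
    unfolding S_def by blast+
  have "(\<lambda>n. h (S n)) \<longlonglongrightarrow> h f"
  proof (rule Dq_dual_tendsto[OF h S(1) fD])
    fix \<alpha>
    obtain K where K: "\<And>g C z. g holomorphic_on UNIV \<Longrightarrow> (\<And>w. cmod (g w) \<le> C * exp (m * (cmod w)\<^sup>2)) \<Longrightarrow>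
        cmod (D_multi \<alpha> g z) \<le> K * C * exp (q * (cmod z)\<^sup>2)"
      using entire_D_multi_bound[OF m(1,3), of \<alpha>] by blast
    have le: "Dq_seminorm q \<alpha> (\<lambda>z. S n z - f z) \<le> K * (C * \<mu> ^ n / (1 - \<mu>))" for n
    proof (intro Dq_seminorm_le K)
      show "(\<lambda>z. S n z - f z) holomorphic_on UNIV"
        unfolding S_def by (intro holomorphic_intros f)
      show "cmod (S n w - f w) \<le> C * \<mu> ^ n / (1 - \<mu>) * exp (m * (cmod w)\<^sup>2)" for w
        using entire_tail_bound[OF b(1) m(2) f C, of w n]
        by (simp add: S_def \<mu>_def norm_minus_commute)
    qed
    have "(\<lambda>n. K * (C * \<mu> ^ n / (1 - \<mu>))) \<longlonglongrightarrow> K * (C * 0 / (1 - \<mu>))"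
      using \<mu> by (intro tendsto_intros LIMSEQ_realpow_zero) auto
    then have "(\<lambda>n. K * (C * \<mu> ^ n / (1 - \<mu>))) \<longlonglongrightarrow> 0" by simp
    then show "(\<lambda>n. Dq_seminorm q \<alpha> (\<lambda>z. S n z - f z)) \<longlonglongrightarrow> 0"
      by (rule tendsto_sandwich[OF always_eventually always_eventually tendsto_const, rotated 2])
         (use le Dq_seminorm_nonneg[OF Dq_diff[OF S(1) fD]] in auto)
  qed
  then have "(\<lambda>n. 0) \<longlonglongrightarrow> h f" by (simp add: S)
  then show ?thesis by (simp add: LIMSEQ_const_iff)
qed

section \<open>Cutoff functions\<close>

text \<open>The family \<open>t ^ (- m) * exp (- 1 / t)\<close>, extended by 0; it is closed under differentiation up to
linear combinations, which makes smoothness an induction over all \<open>m\<close> simultaneously.\<close>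

definition flat_exp :: "nat \<Rightarrow> real \<Rightarrow> real" where
  "flat_exp m t = (if t \<le> 0 then 0 else inverse t ^ m * exp (- inverse t))"

text \<open>The quadratic bound gives the derivative 0 at \<open>t = 0\<close>, where the two branches meet.\<close>

lemma flat_exp_bound: "\<exists>K\<ge>0. \<forall>t. \<bar>flat_exp m t\<bar> \<le> K * t\<^sup>2"
proof -
  define n where "n = m + 2"
  define N where "N = real n ^ n"
  have n: "0 < n" by (simp add: n_def)
  have "\<bar>flat_exp m t\<bar> \<le> N * t\<^sup>2" for t :: real
  proof (cases "t \<le> 0")
    case False
    define s where "s = inverse t"
    have s: "0 < s" "s * t = 1" using False by (auto simp: s_def)
    have "(s / real n) ^ n \<le> (1 + s / real n) ^ n" using s by (intro power_mono) auto
    also have "\<dots> \<le> exp s"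
      using s n by (intro exp_ge_one_plus_x_over_n_power_n) auto
    finally have "s ^ n \<le> N * exp s"
      using n by (simp add: power_divide N_def field_simps)
    then have "s ^ n * exp (- s) \<le> N"
      by (simp add: exp_minus field_simps)
    then have "s ^ n * exp (- s) * t\<^sup>2 \<le> N * t\<^sup>2"
      by (intro mult_right_mono) auto
    moreover have "s ^ n * exp (- s) * t\<^sup>2 = s ^ m * exp (- s) * (s * t)\<^sup>2"
      unfolding n_def power_add power_mult_distrib by (simp only: mult_ac)
    ultimately have "s ^ m * exp (- s) \<le> N * t\<^sup>2"
      unfolding s(2) by simp
    moreover have "\<bar>flat_exp m t\<bar> = s ^ m * exp (- s)"
      using False by (simp add: flat_exp_def s_def)
    ultimately show ?thesis by simp
  qed (simp add: flat_exp_def N_def)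
  moreover have "0 \<le> N" by (simp add: N_def)
  ultimately show ?thesis by blast
qed

lemma has_derivative_flat_exp:
  "(flat_exp m has_real_derivative flat_exp (m + 2) t - real m * flat_exp (m + 1) t) (at t)"
proof -
  consider "t < 0" | "t = 0" | "t > 0" by linarith
  then show ?thesis
  proof cases
    case 1
    have "((\<lambda>t::real. 0::real) has_real_derivative 0) (at t)" by simp
    then have "(flat_exp m has_real_derivative 0) (at t)"
      by (rule has_field_derivative_transform_within_open[where S = "{..<0}"])
         (use 1 in \<open>auto simp: flat_exp_def\<close>)
    with 1 show ?thesis by (simp add: flat_exp_def)
  next
    case 2
    obtain K where K: "0 \<le> K" "\<And>t. \<bar>flat_exp m t\<bar> \<le> K * t\<^sup>2" using flat_exp_bound by blast
    have "((\<lambda>h. (flat_exp m (0 + h) - flat_exp m 0) / h) \<longlongrightarrow> 0) (at 0)"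
    proof (rule Lim_null_comparison)
      show "((\<lambda>h. K * \<bar>h\<bar>) \<longlongrightarrow> 0) (at 0)"
        by (auto intro!: tendsto_eq_intros)
      show "\<forall>\<^sub>F h in at 0. norm ((flat_exp m (0 + h) - flat_exp m 0) / h) \<le> K * \<bar>h\<bar>"
        using K(2) by (intro always_eventually allI)
          (auto simp: flat_exp_def[of _ 0] divide_le_eq power2_eq_square abs_mult mult.assoc)
    qed
    then show ?thesis unfolding 2 by (simp add: DERIV_def flat_exp_def[of _ 0])
  next
    case 3
    have "real m * inverse t ^ (m - 1) * (inverse t)\<^sup>2 = real m * inverse t ^ (m + 1)"
      by (cases m) (auto simp: power2_eq_square)
    then have 1: "((\<lambda>t. inverse t ^ m) has_real_derivative - (real m * inverse t ^ (m + 1))) (at t)"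
      using 3 by (auto intro!: derivative_eq_intros simp: power2_eq_square mult.commute)
    have 2: "((\<lambda>t. exp (- inverse t)) has_real_derivative exp (- inverse t) * (inverse t)\<^sup>2) (at t)"
      using 3 by (auto intro!: derivative_eq_intros simp: power2_eq_square)
    have "((\<lambda>t. inverse t ^ m * exp (- inverse t)) has_real_derivative
        flat_exp (m + 2) t - real m * flat_exp (m + 1) t) (at t)"
      by (rule DERIV_cong[OF DERIV_mult[OF 1 2]])
         (use 3 in \<open>simp add: flat_exp_def power_add power2_eq_square algebra_simps\<close>)
    then show ?thesis
      by (rule has_field_derivative_transform_within_open[where S = "{0<..}"])
         (use 3 in \<open>auto simp: flat_exp_def\<close>)
  qed
qed

definition radial_bump :: "nat \<Rightarrow> complex \<Rightarrow> complex" where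
  "radial_bump m z = of_real (flat_exp m (1 - (cmod z)\<^sup>2))"

lemma has_partials_radial_bump:
  "has_partials (radial_bump m)
     ((radial_bump (m + 2) z + (- of_nat m) * radial_bump (m + 1) z) * ((-2) * of_real (Re z)))
     ((radial_bump (m + 2) z + (- of_nat m) * radial_bump (m + 1) z) * ((-2) * of_real (Im z))) z"
proof -
  let ?d = "flat_exp (m + 2) (1 - (cmod z)\<^sup>2) - real m * flat_exp (m + 1) (1 - (cmod z)\<^sup>2)"
  have 1: "((\<lambda>z. 1 - (cmod z)\<^sup>2) has_derivative (\<lambda>v. - 2 * (Re z * Re v + Im z * Im v))) (at z)"
    unfolding cmod_power2 by (auto intro!: derivative_eq_intros simp: algebra_simps)
  have "((\<lambda>z. flat_exp m (1 - (cmod z)\<^sup>2)) has_derivative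
      (\<lambda>v. ?d * (- 2 * (Re z * Re v + Im z * Im v)))) (at z)"
    using has_derivative_compose[OF 1 has_derivative_flat_exp[unfolded has_field_derivative_def]] by simp
  then have "(radial_bump m has_derivative (\<lambda>v. of_real (?d * (- 2 * (Re z * Re v + Im z * Im v))))) (at z)"
    unfolding radial_bump_def by (rule has_derivative_of_real)
  then show ?thesis
    unfolding has_partials_def
    by (rule has_derivative_eq_rhs) (simp add: radial_bump_def algebra_simps)
qed

lemma smooth_radial_bump: "smooth (radial_bump m)"
proof -
  have "C_k k (radial_bump m)" for k m
  proof (induction k arbitrary: m)
    case 0
    show ?case
      using has_partials_differentiable[OF has_partials_radial_bump]
      by (auto intro!: differentiable_imp_continuous_on simp: differentiable_on_def
          intro: differentiable_at_withinI)
  next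
    case (Suc k)
    show ?case
      by (rule C_k_SucI[OF has_partials_radial_bump]; intro C_k_mult C_k_add C_k_cmult Suc.IH C_k_Re C_k_Im)
  qed
  then show ?thesis by (simp add: smooth_def)
qed

definition vanishes_outside :: "real \<Rightarrow> (complex \<Rightarrow> complex) \<Rightarrow> bool" where
  "vanishes_outside R f \<longleftrightarrow> (\<forall>z. R < cmod z \<longrightarrow> f z = 0)"

lemma vanishes_outside_D:
  assumes "vanishes_outside R f"
  shows "vanishes_outside R (D1 f)" "vanishes_outside R (D2 f)"
proof -
  have "has_partials f 0 0 z" if "R < cmod z" for z
    unfolding has_partials_def
  proof (rule has_derivative_transform_within_open[where s = "{z. R < cmod z}" and f = "\<lambda>z. 0"])
    show "open {z::complex. R < cmod z}" by (intro open_Collect_less continuous_intros)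
  qed (use that assms in \<open>auto simp: vanishes_outside_def\<close>)
  then show "vanishes_outside R (D1 f)" "vanishes_outside R (D2 f)"
    using has_partials_D1 has_partials_D2 unfolding vanishes_outside_def by blast+
qed

lemma vanishes_outside_D_multi:
  assumes "vanishes_outside R f"
  shows "vanishes_outside R (D_multi \<alpha> f)"
proof -
  have "vanishes_outside R ((D2 ^^ n) f)" for n
    by (induction n) (auto intro: vanishes_outside_D assms)
  then have "vanishes_outside R ((D1 ^^ m) ((D2 ^^ n) f))" for m n
    by (induction m) (auto intro: vanishes_outside_D)
  then show ?thesis by (simp add: D_multi_def)
qed

lemma vanishes_outside_bounded:
  assumes "vanishes_outside R f" "continuous_on UNIV f"
  shows "\<exists>C\<ge>0. \<forall>z. cmod (f z) \<le> C"
proof -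
  have "compact (f ` cball 0 R)"
    by (intro compact_continuous_image continuous_on_subset[OF assms(2)]) auto
  then have "bounded (f ` cball 0 R)" by (rule compact_imp_bounded)
  then obtain C where C: "\<forall>y\<in>f ` cball 0 R. cmod y \<le> C"
    unfolding bounded_iff by (rule exE)
  have "cmod (f z) \<le> C" if "cmod z \<le> R" for z
    using C that by simp
  then have "cmod (f z) \<le> max 0 C" for z
    using assms(1) by (cases "cmod z \<le> R") (auto simp: vanishes_outside_def max.coboundedI2)
  then show ?thesis by (intro exI[of _ "max 0 C"]) auto
qed

lemma test_function_vanishes_outside:
  assumes "\<phi> \<in> test_functions"
  obtains R where "vanishes_outside R \<phi>"
proof -
  have "bounded {z. \<phi> z \<noteq> 0}"
    using assms unfolding test_functions_def
    by (auto intro: bounded_subset[OF compact_imp_bounded closure_subset])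
  then obtain R where "\<And>z. \<phi> z \<noteq> 0 \<Longrightarrow> cmod z \<le> R" by (auto simp: bounded_iff)
  then have "vanishes_outside R \<phi>"
    unfolding vanishes_outside_def by (meson not_le)
  then show ?thesis by (rule that)
qed

lemma vanishes_outside_test_function:
  assumes "smooth \<phi>" "vanishes_outside R \<phi>"
  shows "\<phi> \<in> test_functions"
proof -
  have "{z. \<phi> z \<noteq> 0} \<subseteq> cball 0 R"
    using assms(2) by (force simp: vanishes_outside_def)
  then have "bounded {z. \<phi> z \<noteq> 0}" by (rule bounded_subset[OF bounded_cball])
  then show ?thesis using assms(1) by (simp add: test_functions_def compact_closure)
qed

text \<open>The derivatives of a test function are bounded, so \<open>Dq_spaceI\<close> applies with growth parameter 0.\<close>

lemma test_function_in_Dq: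
  assumes "\<phi> \<in> test_functions" "0 < q"
  shows "\<phi> \<in> Dq_space q"
proof (rule Dq_spaceI)
  obtain R where R: "vanishes_outside R \<phi>" using test_function_vanishes_outside[OF assms(1)] .
  show sm: "smooth \<phi>" using assms by (simp add: test_functions_def)
  fix \<alpha>
  obtain C where C: "0 \<le> C" "\<And>z. cmod (D_multi \<alpha> \<phi> z) \<le> C"
    using vanishes_outside_bounded[OF vanishes_outside_D_multi[OF R, of \<alpha>] smooth_continuous[OF smooth_D_multi[OF sm]]]
    by blast
  have "cmod (D_multi \<alpha> \<phi> z) \<le> C * exp (0 * (cmod z)\<^sup>2)" for z using C by simp
  then show "\<exists>C. \<forall>z. cmod (D_multi \<alpha> \<phi> z) \<le> C * exp (0 * (cmod z)\<^sup>2)" by blast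
qed (use assms in auto)

text \<open>Uniform growth below every Gaussian weight. Unlike growth of a fixed Gaussian order, this is
stable under products.\<close>

definition subgaussian :: "(nat \<Rightarrow> complex \<Rightarrow> complex) \<Rightarrow> bool" where
  "subgaussian f \<longleftrightarrow> (\<forall>s>0. \<exists>C. \<forall>n z. cmod (f n z) \<le> C * exp (s * (cmod z)\<^sup>2))"

text \<open>The same bound for all mixed derivatives up to a given order, taken in every possible succession; the
recursion mirrors \<^const>\<open>C_k\<close> so that the product rule can be iterated.\<close>

primrec subgaussian_family :: "nat \<Rightarrow> (nat \<Rightarrow> complex \<Rightarrow> complex) \<Rightarrow> bool" where
  "subgaussian_family 0 f \<longleftrightarrow> subgaussian f"
| "subgaussian_family (Suc k) f \<longleftrightarrow> subgaussian f \<and>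
     subgaussian_family k (\<lambda>n. D1 (f n)) \<and> subgaussian_family k (\<lambda>n. D2 (f n))"

lemma subgaussian_family_Suc_D: "subgaussian_family (Suc k) f \<Longrightarrow> subgaussian_family k f"
proof (induction k arbitrary: f)
  case (Suc k)
  show ?case
    using Suc.prems Suc.IH[of "\<lambda>n. D1 (f n)"] Suc.IH[of "\<lambda>n. D2 (f n)"]
    unfolding subgaussian_family.simps(2)[of "Suc k" f] subgaussian_family.simps(2)[of k f] by blast
qed simp

lemma subgaussian_family_SucI:
  assumes "subgaussian_family 0 f" "\<And>n z. has_partials (f n) (a n z) (b n z) z"
    "subgaussian_family k a" "subgaussian_family k b"
  shows "subgaussian_family (Suc k) f"
proof -
  have "(\<lambda>n. D1 (f n)) = a" "(\<lambda>n. D2 (f n)) = b"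
    using assms(2) by (auto intro!: ext has_partials_D1 has_partials_D2)
  with assms show ?thesis by simp
qed

lemma subgaussian_family_add_0:
  assumes "subgaussian_family 0 f" "subgaussian_family 0 g"
  shows "subgaussian_family 0 (\<lambda>n z. f n z + g n z)"
  unfolding subgaussian_family.simps subgaussian_def
proof (intro allI impI)
  fix s :: real assume s: "0 < s"
  obtain C C' where C: "\<And>n z. cmod (f n z) \<le> C * exp (s * (cmod z)\<^sup>2)"
    and C': "\<And>n z. cmod (g n z) \<le> C' * exp (s * (cmod z)\<^sup>2)" using assms s
    unfolding subgaussian_family.simps subgaussian_def by metis
  have "cmod (f n z + g n z) \<le> (C + C') * exp (s * (cmod z)\<^sup>2)" for n z
    using norm_triangle_mono[OF C C'] by (simp add: algebra_simps)
  then show "\<exists>C. \<forall>n z. cmod (f n z + g n z) \<le> C * exp (s * (cmod z)\<^sup>2)" by blast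
qed

lemma subgaussian_family_mult_0:
  assumes "subgaussian_family 0 f" "subgaussian_family 0 g"
  shows "subgaussian_family 0 (\<lambda>n z. f n z * g n z)"
  unfolding subgaussian_family.simps subgaussian_def
proof (intro allI impI)
  fix s :: real assume s: "0 < s"
  then have "0 < s / 2" by simp
  then obtain C C' where C: "\<And>n z. cmod (f n z) \<le> C * exp (s / 2 * (cmod z)\<^sup>2)"
    and C': "\<And>n z. cmod (g n z) \<le> C' * exp (s / 2 * (cmod z)\<^sup>2)"
    using assms unfolding subgaussian_family.simps subgaussian_def by metis
  have "cmod (f n z * g n z) \<le> (C * C') * exp (s * (cmod z)\<^sup>2)" for n z
  proof -
    have "cmod (f n z * g n z) \<le> (C * exp (s / 2 * (cmod z)\<^sup>2)) * (C' * exp (s / 2 * (cmod z)\<^sup>2))"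
      unfolding norm_mult
      by (rule mult_mono[OF C C' order_trans[OF norm_ge_zero C] norm_ge_zero])
    also have "\<dots> = (C * C') * (exp (s / 2 * (cmod z)\<^sup>2) * exp (s / 2 * (cmod z)\<^sup>2))"
      by (simp only: mult_ac)
    finally show ?thesis by (simp add: mult_exp_exp)
  qed
  then show "\<exists>C. \<forall>n z. cmod (f n z * g n z) \<le> C * exp (s * (cmod z)\<^sup>2)" by blast
qed

lemma subgaussian_family_0: "subgaussian_family k f \<Longrightarrow> subgaussian_family 0 f"
  by (cases k) auto

lemma subgaussian_family_add:
  assumes "\<And>n. smooth (f n)" "\<And>n. smooth (g n)" "subgaussian_family k f" "subgaussian_family k g"
  shows "subgaussian_family k (\<lambda>n z. f n z + g n z)"
  using assms
proof (induction k arbitrary: f g)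
  case 0
  then show ?case using subgaussian_family_add_0 by blast
next
  case (Suc k)
  show ?case
  proof (rule subgaussian_family_SucI)
    show "has_partials (\<lambda>z. f n z + g n z) (D1 (f n) z + D1 (g n) z) (D2 (f n) z + D2 (g n) z) z" for n z
      by (intro has_partials_add smooth_has_partials Suc.prems)
    show "subgaussian_family k (\<lambda>n z. D1 (f n) z + D1 (g n) z)"
         "subgaussian_family k (\<lambda>n z. D2 (f n) z + D2 (g n) z)"
      using Suc.prems by (auto intro!: Suc.IH smooth_D1 smooth_D2)
  qed (intro subgaussian_family_add_0 subgaussian_family_0[OF Suc.prems(3)] subgaussian_family_0[OF Suc.prems(4)])
qed

lemma subgaussian_family_mult:
  assumes "\<And>n. smooth (f n)" "\<And>n. smooth (g n)" "subgaussian_family k f" "subgaussian_family k g"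
  shows "subgaussian_family k (\<lambda>n z. f n z * g n z)"
  using assms
proof (induction k arbitrary: f g)
  case 0
  then show ?case using subgaussian_family_mult_0 by blast
next
  case (Suc k)
  note low = subgaussian_family_Suc_D[OF Suc.prems(3)] subgaussian_family_Suc_D[OF Suc.prems(4)]
  note D = smooth_D1 smooth_D2 smooth_mult Suc.prems(1,2)
  have 1: "subgaussian_family k (\<lambda>n. D1 (f n))" "subgaussian_family k (\<lambda>n. D2 (f n))"
      "subgaussian_family k (\<lambda>n. D1 (g n))" "subgaussian_family k (\<lambda>n. D2 (g n))"
    using Suc.prems by auto
  show ?case
  proof (rule subgaussian_family_SucI)
    show "has_partials (\<lambda>z. f n z * g n z) (f n z * D1 (g n) z + D1 (f n) z * g n z)
        (f n z * D2 (g n) z + D2 (f n) z * g n z) z" for n z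
      by (intro has_partials_mult smooth_has_partials Suc.prems)
    show "subgaussian_family k (\<lambda>n z. f n z * D1 (g n) z + D1 (f n) z * g n z)"
         "subgaussian_family k (\<lambda>n z. f n z * D2 (g n) z + D2 (f n) z * g n z)"
      by (intro subgaussian_family_add Suc.IH D low 1)+
  qed (intro subgaussian_family_mult_0 subgaussian_family_0[OF Suc.prems(3)] subgaussian_family_0[OF Suc.prems(4)])
qed

lemma subgaussian_family_const: "subgaussian_family k (\<lambda>n z. c)"
proof (induction k arbitrary: c)
  case 0
  have "cmod c \<le> cmod c * exp (s * (cmod z)\<^sup>2)" if "0 < s" for s z
    using that mult_left_mono[of 1 "exp (s * (cmod z)\<^sup>2)" "cmod c"] by simp
  then show ?case unfolding subgaussian_family.simps subgaussian_def by blast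
next
  case (Suc k)
  have "subgaussian_family 0 (\<lambda>n z. c)" using Suc.IH subgaussian_family_0 by blast
  then show ?case by (rule subgaussian_family_SucI[OF _ has_partials_const Suc.IH Suc.IH])
qed

lemma has_partials_monom:
  "has_partials (\<lambda>z. c * z ^ j) ((c * of_nat j) * z ^ (j - 1)) (\<i> * ((c * of_nat j) * z ^ (j - 1))) z"
  unfolding has_partials_holomorphic_iff by (auto intro!: derivative_eq_intros)

lemma subgaussian_family_monom: "subgaussian_family k (\<lambda>n z. c * z ^ j)"
proof (induction k arbitrary: c j)
  have base: "subgaussian_family 0 (\<lambda>n z. c * z ^ j)" for c j
    unfolding subgaussian_family.simps subgaussian_def
  proof (intro allI impI)
    fix s :: real assume "0 < s"
    then obtain K where K: "\<And>z. cmod (z ^ j) \<le> K * exp (s * (cmod z)\<^sup>2)"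
      using power_growth[of s j] by metis
    have "cmod (c * z ^ j) \<le> (cmod c * K) * exp (s * (cmod z)\<^sup>2)" for z
      using mult_left_mono[OF K[of z], of "cmod c"] by (simp add: norm_mult mult_ac)
    then show "\<exists>C. \<forall>n z. cmod (c * z ^ j) \<le> C * exp (s * (cmod z)\<^sup>2)" by blast
  qed
  {
    case 0
    show ?case by (rule base)
  next
    case (Suc k)
    have "subgaussian_family k (\<lambda>n z. (\<i> * (c * of_nat j)) * z ^ (j - 1))" by (rule Suc.IH)
    then have "subgaussian_family k (\<lambda>n z. \<i> * (c * of_nat j * z ^ (j - 1)))" by (simp only: mult.assoc)
    then show ?case by (rule subgaussian_family_SucI[OF base has_partials_monom Suc.IH])
  }
qed

text \<open>Each derivative of a dilated function brings out another factor \<open>1 / (n + 1)\<close>, which the coefficients \<open>c n\<close> absorb.\<close>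

lemma subgaussian_family_rescale:
  assumes "smooth A" "vanishes_outside R A" "\<And>n. cmod (c n) \<le> 1"
  shows "subgaussian_family k (\<lambda>n z. c n * A (of_real (inverse (real (Suc n))) * z))"
  using assms
proof (induction k arbitrary: A c)
  have base: "subgaussian_family 0 (\<lambda>n z. c n * A (of_real (inverse (real (Suc n))) * z))"
    if A: "smooth A" "vanishes_outside R A" and c: "\<And>n. cmod (c n) \<le> 1" for A and c :: "nat \<Rightarrow> complex"
  proof -
    obtain C where C: "0 \<le> C" "\<And>z. cmod (A z) \<le> C"
      using vanishes_outside_bounded[OF A(2) smooth_continuous[OF A(1)]] by blast
    have "cmod (c n * A w) \<le> C * exp (s * (cmod z)\<^sup>2)" if "0 < s" for s n w z
    proof -
      have "cmod (c n * A w) \<le> 1 * C" unfolding norm_mult using c C by (intro mult_mono) auto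
      also have "\<dots> \<le> C * exp (s * (cmod z)\<^sup>2)"
        using that C(1) mult_left_mono[of 1 "exp (s * (cmod z)\<^sup>2)" C] by simp
      finally show ?thesis .
    qed
    then show ?thesis unfolding subgaussian_family.simps subgaussian_def by blast
  qed
  {
    case 0
    show ?case by (rule base[OF 0])
  next
    case (Suc k)
    let ?r = "\<lambda>n. of_real (inverse (real (Suc n))) :: complex"
    have part: "has_partials (\<lambda>z. c n * A (?r n * z)) ((c n * ?r n) * D1 A (?r n * z)) ((c n * ?r n) * D2 A (?r n * z)) z" for n z
    proof -
      have "has_partials (\<lambda>z. A (?r n * z + 0)) (?r n * D1 A (?r n * z)) (?r n * D2 A (?r n * z)) z"
        by (rule has_partials_chain_affine) (use Suc.prems(1) in \<open>auto intro: smooth_has_partials\<close>)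
      from has_partials_cmult[OF this, of "c n"] show ?thesis by (simp add: mult.assoc)
    qed
    have c: "cmod (c n * ?r n) \<le> 1" for n
    proof -
      have "cmod (?r n) \<le> 1" unfolding norm_of_real by (simp add: field_simps)
      then show ?thesis unfolding norm_mult using Suc.prems(3)[of n] by (intro mult_le_one) auto
    qed
    show ?case
      by (rule subgaussian_family_SucI[OF base[OF Suc.prems] part
            Suc.IH[OF smooth_D1[OF Suc.prems(1)] vanishes_outside_D(1)[OF Suc.prems(2)] c]
            Suc.IH[OF smooth_D2[OF Suc.prems(1)] vanishes_outside_D(2)[OF Suc.prems(2)] c]])
  }
qed

lemma subgaussian_family_D_multi:
  assumes "\<And>k. subgaussian_family k f"
  shows "subgaussian_family k (\<lambda>n. D_multi \<alpha> (f n))"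
proof -
  have "\<forall>k. subgaussian_family k (\<lambda>n. (D2 ^^ j) (f n))" for j
  proof (induction j)
    case (Suc j)
    then have "subgaussian_family (Suc k) (\<lambda>n. (D2 ^^ j) (f n))" for k by blast
    then show ?case by simp
  qed (simp add: assms)
  then have "\<forall>k. subgaussian_family k (\<lambda>n. (D1 ^^ i) ((D2 ^^ j) (f n)))" for i j
  proof (induction i)
    case (Suc i)
    then have "subgaussian_family (Suc k) (\<lambda>n. (D1 ^^ i) ((D2 ^^ j) (f n)))" for k by blast
    then show ?case by simp
  qed simp
  then show ?thesis by (simp add: D_multi_def)
qed

text \<open>This turns the uniform bounds on a family into convergence to 0 in every space \<^const>\<open>Dq_space\<close>, after
multiplication by \<open>1 / (n + 1)\<close>.\<close>

lemma subgaussian_family_div_tendsto_0: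
  assumes q: "0 < q" and sm: "\<And>n. smooth (f n)" and f: "\<And>k. subgaussian_family k f"
  defines "g \<equiv> \<lambda>n z. of_real (inverse (real (Suc n))) * f n z"
  shows "g n \<in> Dq_space q" "(\<lambda>n. Dq_seminorm q \<alpha> (g n)) \<longlonglongrightarrow> 0"
proof -
  have fD: "f n \<in> Dq_space q" for n
  proof (rule Dq_spaceI[OF sm])
    show "q / 2 < q" using q by simp
    fix \<alpha>
    have "subgaussian_family 0 (\<lambda>n. D_multi \<alpha> (f n))" by (rule subgaussian_family_D_multi[OF f])
    moreover have "0 < q / 2" using q by simp
    ultimately show "\<exists>C. \<forall>z. cmod (D_multi \<alpha> (f n) z) \<le> C * exp (q / 2 * (cmod z)\<^sup>2)"
      unfolding subgaussian_family.simps subgaussian_def by blast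
  qed
  then show gD: "g n \<in> Dq_space q" for n unfolding g_def by (intro Dq_cmult)
  obtain C where C: "\<And>n z. cmod (D_multi \<alpha> (f n) z) \<le> C * exp (q * (cmod z)\<^sup>2)"
    using subgaussian_family_D_multi[OF f, of 0 \<alpha>] q unfolding subgaussian_family.simps subgaussian_def by blast
  have le: "Dq_seminorm q \<alpha> (g n) \<le> inverse (real (Suc n)) * C" for n
  proof (rule Dq_seminorm_le)
    fix z
    have "cmod (D_multi \<alpha> (g n) z) = inverse (real (Suc n)) * cmod (D_multi \<alpha> (f n) z)"
      unfolding g_def D_multi_cmult[OF sm] norm_mult norm_of_real by simp
    also have "\<dots> \<le> inverse (real (Suc n)) * (C * exp (q * (cmod z)\<^sup>2))"
      by (intro mult_left_mono C) auto
    finally show "cmod (D_multi \<alpha> (g n) z) \<le> inverse (real (Suc n)) * C * exp (q * (cmod z)\<^sup>2)"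
      by (simp only: mult.assoc)
  qed
  have "(\<lambda>n. inverse (real (Suc n)) * C) \<longlonglongrightarrow> 0 * C"
    by (intro tendsto_intros LIMSEQ_inverse_real_of_nat)
  then have "(\<lambda>n. inverse (real (Suc n)) * C) \<longlonglongrightarrow> 0" by simp
  then show "(\<lambda>n. Dq_seminorm q \<alpha> (g n)) \<longlonglongrightarrow> 0"
    by (rule tendsto_sandwich[OF always_eventually always_eventually tendsto_const, rotated 2])
       (use le Dq_seminorm_nonneg[OF gD] in auto)
qed

section \<open>Solvability and vanishing moments\<close>

lemma bounded_difference_quotient:
  assumes A: "smooth A" "vanishes_outside R A"
  shows "\<exists>L\<ge>0. \<forall>w. cmod (A w - A 0) \<le> L * cmod w"
proof -
  obtain C where C: "0 \<le> C" "\<And>z. cmod (A z) \<le> C"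
    using vanishes_outside_bounded[OF A(2) smooth_continuous[OF A(1)]] by blast
  obtain C1 where C1: "0 \<le> C1" "\<And>z. cmod (D1 A z) \<le> C1"
    using vanishes_outside_bounded[OF vanishes_outside_D(1)[OF A(2)] smooth_continuous[OF smooth_D1[OF A(1)]]] by blast
  obtain C2 where C2: "0 \<le> C2" "\<And>z. cmod (D2 A z) \<le> C2"
    using vanishes_outside_bounded[OF vanishes_outside_D(2)[OF A(2)] smooth_continuous[OF smooth_D2[OF A(1)]]] by blast
  define L where "L = max (2 * C) (2 * max C1 C2)"
  have "cmod (A w - A 0) \<le> L * cmod w" for w
  proof (cases "cmod w \<le> 1")
    case True
    have "cmod (A w - A 0) \<le> 2 * max C1 C2 * cmod (w - 0)"
      by (rule has_partials_lipschitz[of 0 A "D1 A" "D2 A"])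
         (use True C1(2) C2(2) smooth_has_partials[OF A(1)] in \<open>auto intro: max.coboundedI1 max.coboundedI2\<close>)
    also have "\<dots> \<le> L * cmod w" unfolding L_def by (intro mult_mono) (use C1 in auto)
    finally show ?thesis .
  next
    case False
    have "cmod (A w - A 0) \<le> 2 * C * 1"
      using norm_triangle_ineq4[of "A w" "A 0"] C(2)[of w] C(2)[of 0] by linarith
    also have "\<dots> \<le> L * cmod w" unfolding L_def by (intro mult_mono) (use False C in auto)
    finally show ?thesis .
  qed
  moreover have "0 \<le> L" using C by (simp add: L_def)
  ultimately show ?thesis by blast
qed

text \<open>The error \<open>A (z / (n + 1)) - A 0\<close> of a cutoff is \<open>1 / (n + 1)\<close> times a uniformly controlled family: the
Lipschitz bound yields linear growth of the quotient, and its first derivatives are exactly those of \<open>A\<close>, dilated.\<close>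

lemma subgaussian_family_difference_quotient:
  assumes A: "smooth A" "vanishes_outside R A"
  defines "r \<equiv> \<lambda>n. of_real (inverse (real (Suc n))) :: complex"
  shows "subgaussian_family k (\<lambda>n z. of_nat (Suc n) * (A (r n * z) - A 0))"
proof -
  obtain L where L: "0 \<le> L" "\<And>w. cmod (A w - A 0) \<le> L * cmod w"
    using bounded_difference_quotient[OF A] by blast
  have inv: "of_nat (Suc n) * r n = 1" for n
    unfolding r_def by (simp del: of_nat_Suc)
  have base: "subgaussian_family 0 (\<lambda>n z. of_nat (Suc n) * (A (r n * z) - A 0))"
    unfolding subgaussian_family.simps subgaussian_def
  proof (intro allI impI)
    fix s :: real assume "0 < s"
    then obtain K where K: "\<And>z. cmod (z ^ 1) \<le> K * exp (s * (cmod z)\<^sup>2)"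
      using power_growth[of s 1] by metis
    have "cmod (of_nat (Suc n) * (A (r n * z) - A 0)) \<le> (L * K) * exp (s * (cmod z)\<^sup>2)" for n z
    proof -
      have "cmod (of_nat (Suc n) * (A (r n * z) - A 0)) \<le> cmod (of_nat (Suc n)) * (L * cmod (r n * z))"
        unfolding norm_mult[of "of_nat (Suc n)"] by (intro mult_left_mono L) auto
      also have "\<dots> = L * cmod (of_nat (Suc n) * r n * z)" unfolding norm_mult by (simp only: mult_ac)
      also have "\<dots> = L * cmod z" by (simp only: inv mult_1)
      also have "\<dots> \<le> L * (K * exp (s * (cmod z)\<^sup>2))" using K[of z] L(1) by (intro mult_left_mono) auto
      finally show ?thesis by (simp only: mult.assoc)
    qed
    then show "\<exists>C. \<forall>n z. cmod (of_nat (Suc n) * (A (r n * z) - A 0)) \<le> C * exp (s * (cmod z)\<^sup>2)" by blast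
  qed
  show ?thesis
  proof (cases k)
    case 0
    then show ?thesis using base by simp
  next
    case (Suc j)
    have "has_partials (\<lambda>z. of_nat (Suc n) * (A (r n * z) - A 0)) (1 * D1 A (r n * z)) (1 * D2 A (r n * z)) z" for n z
    proof -
      have "has_partials (\<lambda>z. A (r n * z + 0)) (r n * D1 A (r n * z)) (r n * D2 A (r n * z)) z"
        by (rule has_partials_chain_affine) (use A(1) in \<open>auto simp: r_def intro: smooth_has_partials\<close>)
      from has_partials_cmult[OF has_partials_diff[OF this has_partials_const], of "of_nat (Suc n)"]
      show ?thesis
        by (simp only: diff_0_right add_0_right mult.assoc[symmetric] inv)
    qed
    moreover have "subgaussian_family j (\<lambda>n z. 1 * D1 A (r n * z))" "subgaussian_family j (\<lambda>n z. 1 * D2 A (r n * z))"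
      unfolding r_def
      by (rule subgaussian_family_rescale[OF smooth_D1[OF A(1)] vanishes_outside_D(1)[OF A(2)], of "\<lambda>_. 1"], simp)
         (rule subgaussian_family_rescale[OF smooth_D2[OF A(1)] vanishes_outside_D(2)[OF A(2)], of "\<lambda>_. 1"], simp)
    ultimately show ?thesis
      unfolding Suc by (rule subgaussian_family_SucI[OF base])
  qed
qed

lemma smooth_rescale:
  assumes "smooth A" "c \<in> \<real>"
  shows "smooth (\<lambda>z. A (c * z))"
proof -
  have "C_k k (\<lambda>z. A (c * z))" if "smooth A" for k A
    using that
  proof (induction k arbitrary: A)
    case 0
    then show ?case
      by (auto intro!: continuous_intros continuous_on_compose2[OF smooth_continuous[of A UNIV]])
  next
    case (Suc k)
    have part: "has_partials (\<lambda>z. A (c * z)) (c * D1 A (c * z)) (c * D2 A (c * z)) z" for z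
      using has_partials_chain_affine[OF _ assms(2), of A _ _ z 0] smooth_has_partials[OF Suc.prems] by simp
    show ?case
      by (rule C_k_SucI[OF part]; intro C_k_cmult Suc.IH smooth_D1 smooth_D2 Suc.prems)
  qed
  then show ?thesis using assms(1) by (simp add: smooth_def)
qed

lemma smooth_monom: "smooth (\<lambda>z. z ^ k)"
  by (rule smooth_entire) (intro holomorphic_intros)

text \<open>The cutoffs \<open>\<theta> n = A (z / (n + 1)) * z ^ k\<close> are test functions and equal
\<open>z ^ k + F n / (n + 1)\<close> with a controlled family \<open>F\<close>, so they converge to \<open>z ^ k\<close>. As \<open>z ^ k\<close> is holomorphic, \<open>dbar (\<theta> n)\<close>
is \<open>dbar (F n) / (n + 1)\<close> and converges to 0.\<close>

lemma dbar_solvable_imp_moments_zero: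
  assumes h: "h \<in> Dq_dual q" and q: "0 < q" and g: "g \<in> Dq_dual q'" and q': "0 < q'"
    and eq: "distr_eq (dbar_distr g) h"
  shows "h (\<lambda>z. z ^ k) = 0"
proof -
  define r where "r = (\<lambda>n. of_real (inverse (real (Suc n))) :: complex)"
  have r_inv: "r n * of_nat (Suc n) = 1" for n
    unfolding r_def by (simp del: of_nat_Suc)
  \<comment> \<open>The factor normalises \<open>A 0\<close> to 1, as \<open>radial_bump 0\<close> takes the value \<open>exp (- 1)\<close> at 0.\<close>
  define A where "A = (\<lambda>z. of_real (exp 1) * radial_bump 0 z)"
  have A: "smooth A" "vanishes_outside 1 A" and A0: "A 0 = 1"
  proof -
    show "smooth A" unfolding A_def by (intro smooth_cmult smooth_radial_bump)
    show "vanishes_outside 1 A"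
    proof (unfold vanishes_outside_def, intro allI impI)
      fix z :: complex assume "1 < cmod z"
      then have "1 \<le> (cmod z)\<^sup>2" by (simp add: one_le_power)
      then show "A z = 0" by (simp add: A_def radial_bump_def flat_exp_def)
    qed
    have "exp 1 * exp (- 1) = (1 :: real)" by (simp add: mult_exp_exp)
    then show "A 0 = 1" by (simp add: A_def radial_bump_def flat_exp_def flip: of_real_mult)
  qed
  define F where "F = (\<lambda>n z. of_nat (Suc n) * (A (r n * z) - A 0) * (1 * z ^ k))"
  have smA: "smooth (\<lambda>z. A (r n * z))" for n
    by (rule smooth_rescale[OF A(1)]) (simp add: r_def)
  have smQ: "smooth (\<lambda>z. of_nat (Suc n) * (A (r n * z) - A 0))" for n
    by (intro smooth_cmult smooth_diff smA smooth_const)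
  have smF: "smooth (F n)" for n
    unfolding F_def by (intro smooth_mult smQ smooth_const smooth_monom)
  have famF: "subgaussian_family j F" for j
  proof -
    have "subgaussian_family j (\<lambda>n z. of_nat (Suc n) * (A (r n * z) - A 0))"
      unfolding r_def by (rule subgaussian_family_difference_quotient[OF A])
    then show ?thesis
      unfolding F_def
      by (rule subgaussian_family_mult[OF smQ smooth_mult[OF smooth_const smooth_monom] _ subgaussian_family_monom])
  qed
  define \<theta> where "\<theta> = (\<lambda>n z. A (r n * z) * z ^ k)"
  have split: "\<theta> n z = z ^ k + r n * F n z" for n z
  proof -
    have "r n * F n z = (r n * of_nat (Suc n)) * ((A (r n * z) - A 0) * z ^ k)"
      unfolding F_def by (simp only: mult_1 mult_ac)
    then show ?thesis unfolding r_inv \<theta>_def A0 by (simp add: algebra_simps)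
  qed
  have test: "\<theta> n \<in> test_functions" for n
  proof (rule vanishes_outside_test_function)
    show "smooth (\<theta> n)" unfolding \<theta>_def by (intro smooth_mult smA smooth_monom)
    show "vanishes_outside (real (Suc n)) (\<theta> n)"
    proof (unfold vanishes_outside_def, intro allI impI)
      fix z assume z: "real (Suc n) < cmod z"
      have "cmod (r n * z) = inverse (real (Suc n)) * cmod z"
        unfolding norm_mult r_def norm_of_real by simp
      also have "1 < \<dots>" using z by (simp add: field_simps)
      finally show "\<theta> n z = 0" using A(2) by (simp add: vanishes_outside_def \<theta>_def)
    qed
  qed
  have "(\<lambda>n. h (\<theta> n)) \<longlonglongrightarrow> h (\<lambda>z. z ^ k)"
  proof (rule Dq_dual_tendsto[OF h test_function_in_Dq[OF test q] power_in_Dq[OF q]])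
    show "(\<lambda>n. Dq_seminorm q \<alpha> (\<lambda>z. \<theta> n z - z ^ k)) \<longlonglongrightarrow> 0" for \<alpha>
      using subgaussian_family_div_tendsto_0(2)[OF q smF famF, of \<alpha>] by (simp add: split r_def)
  qed
  moreover have "(\<lambda>n. - g (dbar (\<theta> n))) \<longlonglongrightarrow> 0"
  proof -
    have dbar_\<theta>: "dbar (\<theta> n) = (\<lambda>z. r n * dbar (F n) z)" for n
    proof
      fix z
      have m: "has_partials (\<lambda>z. 1 * z ^ k) (1 * of_nat k * z ^ (k - 1)) (\<i> * (1 * of_nat k * z ^ (k - 1))) z"
        by (rule has_partials_monom)
      have "has_partials (\<lambda>z. 1 * z ^ k + r n * F n z) (1 * of_nat k * z ^ (k - 1) + r n * D1 (F n) z)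
          (\<i> * (1 * of_nat k * z ^ (k - 1)) + r n * D2 (F n) z) z"
        by (intro has_partials_add m has_partials_cmult smooth_has_partials smF)
      moreover have "\<theta> n = (\<lambda>z. 1 * z ^ k + r n * F n z)" by (simp add: split fun_eq_iff)
      ultimately have p: "has_partials (\<theta> n) (1 * of_nat k * z ^ (k - 1) + r n * D1 (F n) z)
          (\<i> * (1 * of_nat k * z ^ (k - 1)) + r n * D2 (F n) z) z" by simp
      show "dbar (\<theta> n) z = r n * dbar (F n) z"
        unfolding dbar_def has_partials_D1[OF p] has_partials_D2[OF p] by (simp add: algebra_simps add_divide_distrib)
    qed
    have fam: "subgaussian_family j (\<lambda>n. dbar (F n))" for j
    proof -
      have D: "subgaussian_family j (\<lambda>n. D1 (F n))" "subgaussian_family j (\<lambda>n. D2 (F n))"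
        using famF[of "Suc j"] by auto
      have "subgaussian_family j (\<lambda>n z. (1/2) * (D1 (F n) z + \<i> * D2 (F n) z))"
        by (intro subgaussian_family_mult subgaussian_family_add subgaussian_family_const D
            smooth_const smooth_add smooth_mult smooth_D1 smooth_D2 smF)
      then show ?thesis by (simp add: dbar_def[abs_def])
    qed
    have "(\<lambda>n. g (dbar (\<theta> n))) \<longlonglongrightarrow> g (\<lambda>z. 0)"
    proof (rule Dq_dual_tendsto[OF g _ Dq_zero])
      show "dbar (\<theta> n) \<in> Dq_space q'" for n
        by (intro Dq_dbar test_function_in_Dq test q')
      show "(\<lambda>n. Dq_seminorm q' \<alpha> (\<lambda>z. dbar (\<theta> n) z - 0)) \<longlonglongrightarrow> 0" for \<alpha>
        using subgaussian_family_div_tendsto_0(2)[OF q' smooth_dbar[OF smF] fam, of \<alpha>]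
        by (simp add: dbar_\<theta> r_def)
    qed
    from tendsto_minus[OF this] show ?thesis by (simp add: Dq_dual_zero[OF g])
  qed
  moreover have "h (\<theta> n) = - g (dbar (\<theta> n))" for n
    using eq test[of n] by (simp add: distr_eq_def dbar_distr_def)
  ultimately show ?thesis using LIMSEQ_unique by auto
qed

text \<open>The solution is \<open>- h \<circ> T / pi\<close>. For a test function \<open>\<phi>\<close> the functional \<open>h\<close> does not see the entire
function \<open>f\<close> by which \<open>T (dbar \<phi>)\<close> differs from \<open>pi * \<phi>\<close>.\<close>

lemma moments_zero_imp_dbar_solvable:
  assumes h: "h \<in> Dq_dual q" and b: "0 < b" "b < q" and moments: "\<And>k. h (\<lambda>z. z ^ k) = 0"
  shows "\<exists>g\<in>Dq_dual b. distr_eq (dbar_distr g) h"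
proof
  have q: "0 < q" using b by simp
  define T where "T = (\<lambda>\<psi>. fock_cauchy b 0 \<psi>)"
  define g where "g = (\<lambda>\<psi>. - h (T \<psi>) / of_real pi)"
  have T: "T \<psi> \<in> Dq_space q" if "\<psi> \<in> Dq_space b" for \<psi>
    unfolding T_def by (rule fock_cauchy_in_Dq[OF b that])
  show "g \<in> Dq_dual b"
    unfolding Dq_dual_def
  proof (intro CollectI conjI ballI allI)
    fix \<phi> \<psi> assume *: "\<phi> \<in> Dq_space b" "\<psi> \<in> Dq_space b"
    show "g (\<lambda>z. \<phi> z + \<psi> z) = g \<phi> + g \<psi>"
      using Dq_dual_add[OF h T[OF *(1)] T[OF *(2)]] fock_cauchy_add[OF b(1) *, of 0]
      by (simp add: g_def T_def add_divide_distrib)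
  next
    fix c \<psi> assume *: "\<psi> \<in> Dq_space b"
    show "g (\<lambda>z. c * \<psi> z) = c * g \<psi>"
      using Dq_dual_cmult[OF h T[OF *]] fock_cauchy_cmult[OF b(1) *, of 0]
      by (simp add: g_def T_def)
  next
    have "continuous_map (Dq_topology b) euclidean (h \<circ> T)"
      using h unfolding T_def Dq_dual_def
      by (intro continuous_map_compose[OF continuous_map_fock_cauchy[OF b]]) auto
    then have "continuous_map (Dq_topology b) euclidean ((\<lambda>w. - w / of_real pi) \<circ> (h \<circ> T))"
      by (rule continuous_map_compose) (auto intro!: continuous_intros)
    then show "continuous_map (Dq_topology b) euclidean g"
      by (simp add: g_def o_def)
  qed
  show "distr_eq (dbar_distr g) h"
    unfolding distr_eq_def
  proof
    fix \<phi> assume \<phi>: "\<phi> \<in> test_functions"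
    have \<phi>b: "\<phi> \<in> Dq_space b" and \<phi>q: "\<phi> \<in> Dq_space q"
      using test_function_in_Dq[OF \<phi>] b(1) q by auto
    have sm: "smooth \<phi>" using \<phi> by (simp add: test_functions_def)
    note d = Dq_dbar[OF \<phi>b]
    define f where "f = (\<lambda>z. T (dbar \<phi>) z + (- of_real pi) * \<phi> z)"
    have smT: "smooth (T (dbar \<phi>))" unfolding T_def by (rule smooth_fock_cauchy[OF b(1) d])
    have part: "has_partials f (D1 (T (dbar \<phi>)) z + (- of_real pi) * D1 \<phi> z)
        (D2 (T (dbar \<phi>)) z + (- of_real pi) * D2 \<phi> z) z" for z
      unfolding f_def by (intro has_partials_add has_partials_cmult smooth_has_partials smT sm)
    have "\<exists>a. (f has_field_derivative a) (at z)" for z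
    proof
      let ?a = "D1 (T (dbar \<phi>)) z + (- of_real pi) * D1 \<phi> z"
      let ?b = "D2 (T (dbar \<phi>)) z + (- of_real pi) * D2 \<phi> z"
      have "(D1 (T (dbar \<phi>)) z + \<i> * D2 (T (dbar \<phi>)) z) / 2 = of_real pi * ((D1 \<phi> z + \<i> * D2 \<phi> z) / 2)"
        using dbar_fock_cauchy[OF b(1) d, of z] unfolding T_def[symmetric] dbar_def .
      then have "D1 (T (dbar \<phi>)) z + \<i> * D2 (T (dbar \<phi>)) z = of_real pi * (D1 \<phi> z + \<i> * D2 \<phi> z)"
        by (simp only: times_divide_eq_right divide_cancel_right) simp
      then have "?a + \<i> * ?b = 0"
        by (simp add: algebra_simps)
      then have "?b = \<i> * ?a"
        by (simp add: complex_eq_iff)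
      then show "(f has_field_derivative ?a) (at z)"
        using part[of z] unfolding has_partials_holomorphic_iff[symmetric] by simp
    qed
    then have "f holomorphic_on UNIV" by (simp add: holomorphic_on_open)
    moreover obtain C where "\<And>w. cmod (f w) \<le> C * exp (b * (cmod w)\<^sup>2)"
    proof -
      obtain c where "\<And>z. cmod (T (dbar \<phi>) z) \<le> c * Dq_seminorm b (0, 0) (dbar \<phi>) * exp (b * (cmod z)\<^sup>2)"
        using norm_fock_cauchy_le[OF b(1), of 0] d unfolding T_def by blast
      moreover have "cmod ((- of_real pi) * \<phi> z) \<le> pi * (Dq_seminorm b (0, 0) \<phi> * exp (b * (cmod z)\<^sup>2))" for z
        unfolding norm_mult using Dq_growth[OF \<phi>b, of z] by (intro mult_mono) auto
      ultimately have "cmod (f z) \<le> c * Dq_seminorm b (0, 0) (dbar \<phi>) * exp (b * (cmod z)\<^sup>2)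
          + pi * (Dq_seminorm b (0, 0) \<phi> * exp (b * (cmod z)\<^sup>2))" for z
        unfolding f_def by (rule norm_triangle_mono)
      then have "cmod (f z) \<le> (c * Dq_seminorm b (0, 0) (dbar \<phi>) + pi * Dq_seminorm b (0, 0) \<phi>) * exp (b * (cmod z)\<^sup>2)" for z
        by (simp only: distrib_right mult.assoc)
      then show ?thesis using that by blast
    qed
    ultimately have "h f = 0"
      by (rule Dq_dual_entire_eq_0[OF h moments b])
    then have "h (T (dbar \<phi>)) = of_real pi * h \<phi>"
      unfolding f_def Dq_dual_add[OF h T[OF d] Dq_cmult[OF \<phi>q]] Dq_dual_cmult[OF h \<phi>q] by simp
    then show "dbar_distr g \<phi> = h \<phi>"
      by (simp add: dbar_distr_def g_def)
  qed
qed

theorem theorem4p1: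
  fixes q :: real and h :: "(complex \<Rightarrow> complex) \<Rightarrow> complex"
  assumes "0 < q" and "h \<in> Dq_dual q"
  shows "(\<forall>q'\<in>{0<..<q / exp 1}. \<exists>g\<in>Dq_dual q'. distr_eq (dbar_distr g) h)
           \<longleftrightarrow> (\<forall>k::nat. h (\<lambda>z. z ^ k) = 0)"
proof
  assume solv: "\<forall>q'\<in>{0<..<q / exp 1}. \<exists>g\<in>Dq_dual q'. distr_eq (dbar_distr g) h"
  have "0 < q / exp 1" using assms(1) by simp
  then obtain b where b: "0 < b" "b < q / exp 1" using dense by blast
  then have "b \<in> {0<..<q / exp 1}" by simp
  with solv obtain g where g: "g \<in> Dq_dual b" "distr_eq (dbar_distr g) h" by blast
  show "\<forall>k. h (\<lambda>z. z ^ k) = 0"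
    using dbar_solvable_imp_moments_zero[OF assms(2,1) g(1) b(1) g(2)] by simp
next
  assume moments: "\<forall>k::nat. h (\<lambda>z. z ^ k) = 0"
  show "\<forall>q'\<in>{0<..<q / exp 1}. \<exists>g\<in>Dq_dual q'. distr_eq (dbar_distr g) h"
  proof
    fix b assume b: "b \<in> {0<..<q / exp 1}"
    have "q / exp 1 \<le> q" using assms(1) by (simp add: divide_le_eq mult_le_cancel_left1)
    with b moments show "\<exists>g\<in>Dq_dual b. distr_eq (dbar_distr g) h"
      by (intro moments_zero_imp_dbar_solvable[OF assms(2)]) auto
  qed
qed

end
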